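(* Let $f:\mathbb{R}^{n_1\times\cdots\times n_d}\to\mathbb{R}$ be smooth and let $\{\mathcal{X}^{(t)}\}_{t\ge0}\subseteq\mathcal{M}_{\le\mathbf{r}}$ be an infinite sequence generated by the gradient-related approximate projection method (GRAP) described in the context, with parameters $\omega\in(0,1]$, $\rho,a\in(0,1)$, $s_{\min}>0$. Assume that $f$ is bounded below by $f^*$ and satisfies the Łojasiewicz gradient inequality (see context). If $\{\mathcal{X}^{(t)}\}_{t\ge0}$ has an accumulation point $\mathcal{X}^*$, then $\mathcal{X}^{(t)}$ converges to $\mathcal{X}^*$. Furthermore, if $\mathrm{rank}_{\mathrm{tc}}(\mathcal{X}^* )=\mathbf{r}$, then $\|\mathrm{P}_{\mathrm{T}_{\mathcal{X}^*}\mathcal{M}_{\le\mathbf{r}}}(-\nabla f(\mathcal{X}^* ))\|_{\mathrm F}=\|\mathrm{grad} f(\mathcal{X}^* )\|_{\mathrm F}=0$ and $$\|\mathcal{X}^{(t)}-\mathcal{X}^*\|_{\mathrm F}\le C\begin{cases}\mathrm e^{-ct},&\text{if }\theta=\tfrac12,\\ t^{-\frac{\theta}{1-2\theta}},&\text{if }0<\theta<\tfrac12\end{cases}$$ hold for some $C,c>0$, where $\theta\in(0,1/2]$ is the Łojasiewicz exponent at $\mathcal{X}^*$.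
   Context: Tensor notation. $\mathrm{St}(p,n)=\{\mathbf{X}\in\mathbb{R}^{n\times p}:\mathbf{X}^{\mathsf T}\mathbf{X}=\mathbf{I}_p\}$. $\mathbf{X}_{(k)}\in\mathbb{R}^{n_k\times n_{-k}}$, $n_{-k}=\prod_{i\ne k}n_i$, is the mode-$k$ unfolding, $(\mathcal{X}\times_k\mathbf{A})_{(k)}=\mathbf{A}\mathbf{X}_{(k)}$, and $\mathrm{rank}_{\mathrm{tc}}(\mathcal{X})=(\mathrm{rank}\,\mathbf{X}_{(1)},\dots,\mathrm{rank}\,\mathbf{X}_{(d)})$. $\mathbf{r}=(r_1,\dots,r_d)$ is a vector of positive integers with $r_k\le n_k$, and $\mathcal{M}_{\le\mathbf{r}}=\{\mathcal{X}:\mathrm{rank}_{\mathrm{tc}}(\mathcal{X})\le\mathbf{r}\}$ (componentwise). $\mathcal{M}_{\mathbf{r}}=\{\mathcal{X}:\mathrm{rank}_{\mathrm{tc}}(\mathcal{X})=\mathbf{r}\}$ is a smooth embedded submanifold, and $\mathrm{grad} f$ is the Riemannian gradient of $f|_{\mathcal{M}_{\mathbf{r}}}$ (orthogonal projection of $\nabla f$ onto the tangent space). $\mathrm{T}_{\mathcal{X}}\mathcal{M}_{\le\mathbf{r}}$ is the Bouligand tangent cone (limits of $(\mathcal{X}^{(i)}-\mathcal{X})/t^{(i)}$ with $\mathcal{X}^{(i)}\in\mathcal{M}_{\le\mathbf{r}}$, $\mathcal{X}^{(i)}\to\mathcal{X}$, $t^{(i)}>0$, $t^{(i)}\to0$).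 $\mathrm{P}_{\mathrm{T}_{\mathcal{X}}\mathcal{M}_{\le\mathbf{r}}}(\mathcal{A})$ denotes a (any) minimizer of $\|\mathcal{A}-\mathcal{V}\|_{\mathrm F}$ over $\mathcal{V}\in\mathrm{T}_{\mathcal{X}}\mathcal{M}_{\le\mathbf{r}}$ (its norm does not depend on the choice). Łojasiewicz gradient inequality. A point $\mathcal{X}\in\mathcal{M}_{\le\mathbf{r}}$ satisfies it if there are $\delta,L>0$ and $\theta\in(0,1/2]$ (the exponent at $\mathcal{X}$) such that $|f(\mathcal{X})-f(\mathcal{Y})|^{1-\theta}\le L\|\mathrm{P}_{\mathrm{T}_{\mathcal{Y}}\mathcal{M}_{\le\mathbf{r}}}(-\nabla f(\mathcal{Y}))\|_{\mathrm F}$ for all $\mathcal{Y}\in\mathcal{M}_{\le\mathbf{r}}$ with $\|\mathcal{Y}-\mathcal{X}\|_{\mathrm F}\le\delta$; $f$ satisfies it if every $\mathcal{X}\in\mathcal{M}_{\le\mathbf{r}}$ does. HOSVD. $\mathrm{P}^{\mathrm{HO}}_{\le\mathbf{r}}(\mathcal{A})=\mathcal{A}\times_{k=1}^d\bar{\mathbf{U}}_k\bar{\mathbf{U}}_k^{\mathsf T}$, where the columns of $\bar{\mathbf{U}}_k\in\mathrm{St}(r_k,n_k)$ are leading $r_k$ left singular vectors of $\mathbf{A}_{(k)}$. Approximate projection. For $\mathcal{X}=\mathcal{G}\times_{k=1}^d\mathbf{U}_k$ with $\mathrm{rank}_{\mathrm{tc}}(\mathcal{X})=\underline{\mathbf{r}}\le\mathbf{r}$,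 $\mathcal{G}\in\mathbb{R}^{\underline r_1\times\cdots\times\underline r_d}$, $\mathbf{U}_k\in\mathrm{St}(\underline r_k,n_k)$, and (randomly) chosen $\tilde{\mathbf{U}}_{k,1}\in\mathrm{St}(r_k-\underline r_k,n_k)$ with $\mathbf{U}_k^{\mathsf T}\tilde{\mathbf{U}}_{k,1}=0$, put $\tilde{\mathbf{S}}_k=[\mathbf{U}_k\ \tilde{\mathbf{U}}_{k,1}]$ and $$\tilde{\mathrm P}_{\mathrm{T}_{\mathcal{X}}\mathcal{M}_{\le\mathbf{r}}}\mathcal{A}=\mathcal{A}\times_{k=1}^d\mathrm{P}_{\tilde{\mathbf{S}}_k}+\sum_{k=1}^d\mathcal{G}\times_k\Big(\mathrm{P}^\perp_{\tilde{\mathbf{S}}_k}(\mathcal{A}\times_{j\ne k}\mathbf{U}_j^{\mathsf T})_{(k)}\mathbf{G}_{(k)}^\dagger\Big)\times_{j\ne k}\mathbf{U}_j,$$ where $\mathrm{P}_{\mathbf{S}}=\mathbf{S}\mathbf{S}^{\mathsf T}$, $\mathrm{P}_{\mathbf{S}}^\perp=\mathbf{I}-\mathbf{S}\mathbf{S}^{\mathsf T}$ and $\dagger$ is the Moore–Penrose pseudoinverse. GRAP. Start from $\mathcal{X}^{(0)}\in\mathcal{M}_{\le\mathbf{r}}$. At iteration $t$: (1) compute $g^{(t)}=\tilde{\mathrm P}_{\mathrm{T}_{\mathcal{X}^{(t)}}\mathcal{M}_{\le\mathbf{r}}}(-\nabla f(\mathcal{X}^{(t)}))$, repeating with other choices of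 the $\tilde{\mathbf{U}}_{k,1}$ until the angle condition $\langle-\nabla f(\mathcal{X}^{(t)}),g^{(t)}\rangle\ge\omega\|\mathrm{P}_{\mathrm{T}_{\mathcal{X}^{(t)}}\mathcal{M}_{\le\mathbf{r}}}(-\nabla f(\mathcal{X}^{(t)}))\|_{\mathrm F}\|g^{(t)}\|_{\mathrm F}$ holds; (2) given an initial stepsize $s_0^{(t)}>0$, take $s^{(t)}=\rho^l s_0^{(t)}>s_{\min}$ with the smallest integer $l$ such that $f(\mathcal{X}^{(t)})-f(\mathrm{P}^{\mathrm{HO}}_{\le\mathbf{r}}(\mathcal{X}^{(t)}+s^{(t)}g^{(t)}))\ge s^{(t)}a\langle-\nabla f(\mathcal{X}^{(t)}),g^{(t)}\rangle$ (Armijo backtracking; that such a stepsize exists at every iteration is part of the assumption that the sequence is generated by the method); (3) set $\mathcal{X}^{(t+1)}=\mathrm{P}^{\mathrm{HO}}_{\le\mathbf{r}}(\mathcal{X}^{(t)}+s^{(t)}g^{(t)})$. *)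

theory Defs
  imports "HOL-Analysis.Analysis" "Jordan_Normal_Form.DL_Rank"
begin


section \<open>Smooth maps, gradients, tangent cones, tangent spaces\<close>

text \<open>For open sets this is the usual notion of a \<open>k\<close> times continuously differentiable map.\<close>

fun C_k_on :: "nat \<Rightarrow> 'a::euclidean_space set \<Rightarrow> ('a \<Rightarrow> 'b::real_normed_vector) \<Rightarrow> bool" where
  "C_k_on 0 S f \<longleftrightarrow> continuous_on S f"
| "C_k_on (Suc k) S f \<longleftrightarrow>
     (\<forall>x\<in>S. f differentiable (at x)) \<and> (\<forall>v. C_k_on k S (\<lambda>x. frechet_derivative f (at x) v))"

definition smooth_on :: "'a::euclidean_space set \<Rightarrow> ('a \<Rightarrow> 'b::real_normed_vector) \<Rightarrow> bool" where
  "smooth_on S f \<longleftrightarrow> (\<forall>k. C_k_on k S f)"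

definition gradient :: "('a::euclidean_space \<Rightarrow> real) \<Rightarrow> 'a \<Rightarrow> 'a" where
  "gradient f x = (THE D. GDERIV f x :> D)"

definition bouligand_cone :: "'a::euclidean_space set \<Rightarrow> 'a \<Rightarrow> 'a set" where
  "bouligand_cone M x =
     {v. \<exists>y t. (\<forall>i::nat. y i \<in> M \<and> t i > 0) \<and> y \<longlonglongrightarrow> x \<and> t \<longlonglongrightarrow> 0 \<and>
           (\<lambda>i. (y i - x) /\<^sub>R t i) \<longlonglongrightarrow> v}"

text \<open>The tangent space of an embedded submanifold: velocities of smooth curves in it.\<close>

definition tangent_space :: "'a::euclidean_space set \<Rightarrow> 'a \<Rightarrow> 'a set" where
  "tangent_space M x =
     {v. \<exists>c e. e > 0 \<and> smooth_on {-e<..<e} c \<and> c ` {-e<..<e::real} \<subseteq> M \<and> c 0 = x \<and>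
           (c has_vector_derivative v) (at 0)}"

definition riemannian_gradient :: "'a::euclidean_space set \<Rightarrow> ('a \<Rightarrow> real) \<Rightarrow> 'a \<Rightarrow> 'a" where
  "riemannian_gradient M f x = closest_point (tangent_space M x) (gradient f x)"

text \<open>\<open>closest_point\<close> picks some nearest point; its distance to the projected point, and for a
  closed cone also its norm, does not depend on the choice.\<close>

definition cone_proj :: "'a::euclidean_space set \<Rightarrow> 'a \<Rightarrow> 'a \<Rightarrow> 'a" where
  "cone_proj M x a = closest_point (bouligand_cone M x) a"

definition lojasiewicz_at ::
  "'a::euclidean_space set \<Rightarrow> ('a \<Rightarrow> real) \<Rightarrow> 'a \<Rightarrow> real \<Rightarrow> bool" where
  "lojasiewicz_at M f x \<theta> \<longleftrightarrow> 0 < \<theta> \<and> \<theta> \<le> 1/2 \<and>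
     (\<exists>\<delta>>0. \<exists>L>0. \<forall>y\<in>M. norm (y - x) \<le> \<delta> \<longrightarrow>
        \<bar>f x - f y\<bar> powr (1 - \<theta>) \<le> L * norm (cone_proj M y (- gradient f y)))"

section \<open>Matrices\<close>

abbreviation mat_rank :: "real mat \<Rightarrow> nat" where
  "mat_rank A \<equiv> vec_space.rank (dim_row A) A"

definition St :: "nat \<Rightarrow> nat \<Rightarrow> real mat set" where
  "St p n = {U \<in> carrier_mat n p. transpose_mat U * U = 1\<^sub>m p}"

definition pinv :: "real mat \<Rightarrow> real mat" where
  "pinv A = (THE B. B \<in> carrier_mat (dim_col A) (dim_row A) \<and>
     A * B * A = A \<and> B * A * B = B \<and>
     transpose_mat (A * B) = A * B \<and> transpose_mat (B * A) = B * A)"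

text \<open>Full singular value decomposition \<open>A = W * S * V\<^sup>T\<close> with nonincreasing singular values.\<close>

definition svd :: "real mat \<Rightarrow> real mat \<Rightarrow> real mat \<Rightarrow> real mat \<Rightarrow> bool" where
  "svd A W S V \<longleftrightarrow>
     W \<in> St (dim_row A) (dim_row A) \<and> V \<in> St (dim_col A) (dim_col A) \<and>
     S \<in> carrier_mat (dim_row A) (dim_col A) \<and>
     (\<forall>i<dim_row A. \<forall>j<dim_col A. i \<noteq> j \<longrightarrow> S $$ (i, j) = 0) \<and>
     (\<forall>i<min (dim_row A) (dim_col A). 0 \<le> S $$ (i, i)) \<and>
     (\<forall>j<min (dim_row A) (dim_col A). \<forall>i\<le>j. S $$ (j, j) \<le> S $$ (i, i)) \<and>
     A = W * S * transpose_mat V"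

definition leading_left_singular_vectors :: "nat \<Rightarrow> real mat \<Rightarrow> real mat \<Rightarrow> bool" where
  "leading_left_singular_vectors p A U \<longleftrightarrow> p \<le> dim_row A \<and>
     (\<exists>W S V. svd A W S V \<and> U = mat_of_cols (dim_row A) (map (col W) [0..<p]))"

section \<open>Tensor algebra\<close>

text \<open>A tensor of shape \<open>n = [n\<^sub>1, \<dots>, n\<^sub>d]\<close> is a function on multi-indices of which only the values
  on \<open>multi_indices n\<close> matter. Modes and indices are counted from 0.\<close>

type_synonym tensor = "nat list \<Rightarrow> real"

definition multi_indices :: "nat list \<Rightarrow> nat list set" where
  "multi_indices n = {i. length i = length n \<and> (\<forall>k<length n. i ! k < n ! k)}"

text \<open>Column \<open>b\<close> of the mode-\<open>k\<close> unfolding belongs to the remaining indices \<open>i\<^sub>l\<close>, \<open>l \<noteq> k\<close>, with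
  \<open>b = (\<Sum>l\<noteq>k. i\<^sub>l * (\<Prod>m<l, m\<noteq>k. n\<^sub>m))\<close>; these are recovered as mixed radix digits.\<close>

definition unfold_index :: "nat list \<Rightarrow> nat \<Rightarrow> nat \<Rightarrow> nat \<Rightarrow> nat list" where
  "unfold_index n k a b =
     map (\<lambda>l. if l = k then a else b div (\<Prod>m\<in>{..<l} - {k}. n ! m) mod n ! l) [0..<length n]"

definition unfold :: "nat list \<Rightarrow> nat \<Rightarrow> tensor \<Rightarrow> real mat" where
  "unfold n k X =
     Matrix.mat (n ! k) (\<Prod>m\<in>{..<length n} - {k}. n ! m) (\<lambda>(a, b). X (unfold_index n k a b))"

definition mode_prod :: "nat \<Rightarrow> real mat \<Rightarrow> tensor \<Rightarrow> tensor" where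
  "mode_prod k A X = (\<lambda>i. \<Sum>a<dim_col A. A $$ (i ! k, a) * X (i[k := a]))"

lemma unfold_index_update:
  assumes "k < length n"
  shows "(unfold_index n k a b)[k := c] = unfold_index n k c b"
  using assms by (intro nth_equalityI) (auto simp: unfold_index_def nth_list_update)

lemma unfold_index_shape:
  assumes "k < length n"
  shows "unfold_index (n[k := m]) k a b = unfold_index n k a b"
proof -
  have *: "(\<Prod>j\<in>{..<l} - {k}. n[k := m] ! j) = (\<Prod>j\<in>{..<l} - {k}. n ! j)" for l
    by (rule prod.cong) auto
  show ?thesis
    unfolding unfold_index_def * by (rule nth_equalityI) auto
qed

text \<open>The characterization of the mode product by unfoldings.\<close>

lemma unfold_mode_prod:
  assumes "k < length n" and A: "A \<in> carrier_mat m (n ! k)"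
  shows "unfold (n[k := m]) k (mode_prod k A X) = A * unfold n k X"
proof -
  have c: "(\<Prod>j\<in>{..<length n} - {k}. n[k := m] ! j) = (\<Prod>j\<in>{..<length n} - {k}. n ! j)"
    by (rule prod.cong) auto
  have nth: "unfold_index n k a b ! k = a" for a b
    using assms(1) by (simp add: unfold_index_def)
  show ?thesis
  proof (rule eq_matI)
    fix a b
    assume "a < dim_row (A * unfold n k X)" and "b < dim_col (A * unfold n k X)"
    then show "unfold (n[k := m]) k (mode_prod k A X) $$ (a, b) = (A * unfold n k X) $$ (a, b)"
      using assms
      by (auto simp: unfold_def c mode_prod_def unfold_index_shape unfold_index_update nth
          scalar_prod_def lessThan_atLeast0 intro!: sum.cong)
  qed (use assms in \<open>auto simp: unfold_def c\<close>)
qed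

definition mode_prods :: "nat list \<Rightarrow> (nat \<Rightarrow> real mat) \<Rightarrow> tensor \<Rightarrow> tensor" where
  "mode_prods ks A X = fold (\<lambda>k. mode_prod k (A k)) ks X"

definition rank_tc :: "nat list \<Rightarrow> tensor \<Rightarrow> nat list" where
  "rank_tc n X = map (\<lambda>k. mat_rank (unfold n k X)) [0..<length n]"

section \<open>The Euclidean space of tensors of shape \<open>n\<close>\<close>

text \<open>The space \<open>\<real>\<^bsup>n\<^sub>1\<times>\<dots>\<times>n\<^sub>d\<^esup>\<close> is \<open>real ^ 'i\<close>, where the type \<open>'i\<close> labels the multi-indices via a
  bijection \<open>idx\<close> from \<open>'i\<close> onto \<open>multi_indices n\<close>; thus \<open>norm\<close> and \<open>inner\<close> are the Frobenius norm
  and inner product.\<close>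

definition to_tensor :: "('i::finite \<Rightarrow> nat list) \<Rightarrow> real ^ 'i \<Rightarrow> tensor" where
  "to_tensor idx X = (\<lambda>i. vec_nth X (inv_into UNIV idx i))"

definition of_tensor :: "('i::finite \<Rightarrow> nat list) \<Rightarrow> tensor \<Rightarrow> real ^ 'i" where
  "of_tensor idx F = (\<chi> j. F (idx j))"

definition tucker_variety ::
  "('i::finite \<Rightarrow> nat list) \<Rightarrow> nat list \<Rightarrow> nat list \<Rightarrow> (real ^ 'i) set" where
  "tucker_variety idx n r = {X. list_all2 (\<le>) (rank_tc n (to_tensor idx X)) r}"

definition tucker_manifold ::
  "('i::finite \<Rightarrow> nat list) \<Rightarrow> nat list \<Rightarrow> nat list \<Rightarrow> (real ^ 'i) set" where
  "tucker_manifold idx n r = {X. rank_tc n (to_tensor idx X) = r}"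

section \<open>The GRAP method\<close>

text \<open>All truncated HOSVDs of \<open>A\<close>; there may be several, as singular vectors are not unique.\<close>

definition hosvd ::
  "('i::finite \<Rightarrow> nat list) \<Rightarrow> nat list \<Rightarrow> nat list \<Rightarrow> real ^ 'i \<Rightarrow> (real ^ 'i) set" where
  "hosvd idx n r A =
     {of_tensor idx (mode_prods [0..<length n] (\<lambda>k. U k * transpose_mat (U k)) (to_tensor idx A)) |U.
        \<forall>k<length n.
          leading_left_singular_vectors (r ! k) (unfold n k (to_tensor idx A)) (U k)}"

text \<open>The approximate projection of \<open>A\<close> for the decomposition \<open>G \<times>\<^sub>1 U\<^sub>1 \<dots> \<times>\<^sub>d U\<^sub>d\<close>, where \<open>G\<close> has
  shape \<open>q\<close>, and for the matrices \<open>V\<^sub>k\<close> extending \<open>U\<^sub>k\<close> to \<open>S\<^sub>k = [U\<^sub>k V\<^sub>k]\<close>.\<close>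

definition approx_proj ::
  "nat list \<Rightarrow> nat list \<Rightarrow> tensor \<Rightarrow> (nat \<Rightarrow> real mat) \<Rightarrow> (nat \<Rightarrow> real mat) \<Rightarrow> tensor \<Rightarrow> tensor" where
  "approx_proj n q G U V A =
     (let d = length n;
          S = (\<lambda>k. mat_of_cols (n ! k) (cols (U k) @ cols (V k)));
          P = (\<lambda>k. S k * transpose_mat (S k));
          others = (\<lambda>k. filter (\<lambda>j. j \<noteq> k) [0..<d]);
          W = (\<lambda>k. unfold (q[k := n ! k]) k (mode_prods (others k) (\<lambda>j. transpose_mat (U j)) A));
          B = (\<lambda>k. (1\<^sub>m (n ! k) - P k) * W k * pinv (unfold q k G))
      in (\<lambda>i. mode_prods [0..<d] P A i +
              (\<Sum>k<d. mode_prods (others k) U (mode_prod k (B k) G) i)))"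

text \<open>All values at \<open>A\<close> of approximate projections onto the tangent cone at \<open>X\<close>.\<close>

definition approx_projs ::
  "('i::finite \<Rightarrow> nat list) \<Rightarrow> nat list \<Rightarrow> nat list \<Rightarrow> real ^ 'i \<Rightarrow> real ^ 'i \<Rightarrow> (real ^ 'i) set" where
  "approx_projs idx n r X A =
     {of_tensor idx (approx_proj n q G U V (to_tensor idx A)) |q G U V.
        rank_tc n (to_tensor idx X) = q \<and> list_all2 (\<le>) q r \<and>
        X = of_tensor idx (mode_prods [0..<length n] U G) \<and>
        (\<forall>k<length n. U k \<in> St (q ! k) (n ! k) \<and> V k \<in> St (r ! k - q ! k) (n ! k) \<and>
           transpose_mat (U k) * V k = 0\<^sub>m (q ! k) (r ! k - q ! k))}"

text \<open>One iteration from \<open>X\<close> to \<open>X'\<close>. The direction \<open>g\<close>, the initial stepsize \<open>s0\<close> and the truncated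
  HOSVDs \<open>Y m\<close> computed in the backtracking are arbitrary admissible choices.\<close>

definition grap_step ::
  "('i::finite \<Rightarrow> nat list) \<Rightarrow> nat list \<Rightarrow> nat list \<Rightarrow> real \<Rightarrow> real \<Rightarrow> real \<Rightarrow> real \<Rightarrow>
     (real ^ 'i \<Rightarrow> real) \<Rightarrow> real ^ 'i \<Rightarrow> real ^ 'i \<Rightarrow> bool" where
  "grap_step idx n r \<omega> \<rho> a smin f X X' \<longleftrightarrow>
     (\<exists>g\<in>approx_projs idx n r X (- gradient f X). \<exists>s0>0. \<exists>l Y.
        inner (- gradient f X) g
          \<ge> \<omega> * norm (cone_proj (tucker_variety idx n r) X (- gradient f X)) * norm g \<and>
        (\<forall>m\<le>l. Y m \<in> hosvd idx n r (X + (\<rho> ^ m * s0) *\<^sub>R g)) \<and>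
        f X - f (Y l) \<ge> \<rho> ^ l * s0 * a * inner (- gradient f X) g \<and>
        (\<forall>m<l. \<not> f X - f (Y m) \<ge> \<rho> ^ m * s0 * a * inner (- gradient f X) g) \<and>
        \<rho> ^ l * s0 > smin \<and>
        X' = Y l)"

definition grap_sequence ::
  "('i::finite \<Rightarrow> nat list) \<Rightarrow> nat list \<Rightarrow> nat list \<Rightarrow> real \<Rightarrow> real \<Rightarrow> real \<Rightarrow> real \<Rightarrow>
     (real ^ 'i \<Rightarrow> real) \<Rightarrow> (nat \<Rightarrow> real ^ 'i) \<Rightarrow> bool" where
  "grap_sequence idx n r \<omega> \<rho> a smin f X \<longleftrightarrow>
     X 0 \<in> tucker_variety idx n r \<and> (\<forall>t. grap_step idx n r \<omega> \<rho> a smin f (X t) (X (Suc t)))"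

end

theory Submission
  imports Defs
begin

text \<open>Let \<open>g\<^sub>t\<close> be the direction and \<open>s\<^sub>t\<close> the stepsize of step \<open>t\<close>, put \<open>e\<^sub>t = f X\<^sub>t - f X\<^sup>*\<close>, and let \<open>\<psi>\<^sub>t\<close> be the
  norm of the projection of \<open>-\<nabla>f X\<^sub>t\<close> onto the tangent cone at \<open>X\<^sub>t\<close>. The usual proof of convergence
  under a Lojasiewicz inequality needs that \<open>e\<^sub>t - e\<^sub>t\<^sub>+\<^sub>1\<close> dominates \<open>\<psi>\<^sub>t |X\<^sub>t\<^sub>+\<^sub>1 - X\<^sub>t|\<close>; a rate needs in
  addition that it dominates \<open>\<psi>\<^sub>t\<^sup>2\<close>. Both estimates rest on three facts about one step.

  \<^item> The approximate projection \<open>g\<close> of \<open>A\<close> is the orthogonal projection of \<open>A\<close> onto a linear space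
    (\<open>approx_projs_structure\<close>, \<open>normal_equation_inner\<close>): each summand with the pseudoinverse solves a
    least squares problem, and the summands are mutually orthogonal. So \<open>\<langle>A, g\<rangle> = |g|\<^sup>2\<close>, and Armijo's
    condition yields a decrease of at least \<open>a s |g|\<^sup>2\<close>.

  \<^item> The truncated higher-order SVD is quasi-optimal (\<open>hosvd_error\<close>), by a weak Eckart--Young bound in
    each mode and a telescoping of the projections. So a step is not longer than a multiple of \<open>s |g|\<close>.

  \<^item> The angle condition gives \<open>g = 0\<close> or \<open>\<omega> \<psi> \<le> |g|\<close>. If \<open>g = 0\<close> the iterate does not move, so that
    the first of the two estimates holds in either case (\<open>grap_step_estimates\<close>).

  Convergence to the accumulation point is then the finite length argument of \<open>lojasiewicz_convergence\<close>.

  Let the limit \<open>X\<^sup>*\<close> have rank exactly \<open>r\<close>. By semicontinuity of the rank the iterates eventually have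
  rank \<open>r\<close> as well. At such points the tangent cone consists of vectors
  \<open>C \<times>\<^sub>1 P\<^sub>1 \<dots> \<times>\<^sub>d P\<^sub>d + (\<Sum>k. X \<times>\<^sub>k B\<^sub>k)\<close>, where the columns of \<open>P\<^sub>k\<close> are combinations of columns of the
  unfolding of \<open>X\<close> (\<open>bouligand_cone_subset_tangents\<close>). This explicit form has two uses. For such
  vectors \<open>v\<close> one has \<open>\<langle>A, v\<rangle> = \<langle>g, v\<rangle>\<close>, so that \<open>g = 0\<close> forces \<open>\<psi> = 0\<close>, and \<open>\<omega> \<psi>\<^sub>t \<le> |g\<^sub>t|\<close> holds
  without exception; moreover, a vector of this form at \<open>X\<^sup>*\<close> is a limit of vectors of this form at the
  \<open>X\<^sub>t\<close>, and since \<open>g\<^sub>t \<rightarrow> 0\<close> it follows that \<open>\<nabla>f X\<^sup>*\<close> is orthogonal to the tangent cone at \<open>X\<^sup>*\<close>. Hence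
  both projected gradients vanish there. Finally \<open>e\<^sub>t - e\<^sub>t\<^sub>+\<^sub>1\<close> is at least a multiple of \<open>e\<^sub>t powr (2 * (1 - \<theta>))\<close>,
  and this recursion together with \<open>|X\<^sub>t - X\<^sup>*| \<le> K (e\<^sub>t powr \<theta>)\<close> gives the rates (\<open>lojasiewicz_rates\<close>).\<close>

(* the bullet is kept for the scalar product of vectors of the matrix library *)
no_notation inner (infix "\<bullet>" 70)

section \<open>Ranks and pseudoinverses of real matrices\<close>

lemma mat_mult_assoc:
  fixes A B C :: "real mat"
  assumes "dim_col A = dim_row B" "dim_col B = dim_row C"
  shows "A * B * C = A * (B * C)"
  using assms by (intro assoc_mult_mat[of A "dim_row A" "dim_col A" B "dim_col B" C "dim_col C"]) auto

text \<open>The columns of a product lie in the span of the columns of its left factor.\<close>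

lemma rank_mult_le:
  fixes A B :: "real mat"
  assumes A: "A \<in> carrier_mat n p" and B: "B \<in> carrier_mat p m"
  shows "mat_rank (A * B) \<le> p"
proof -
  interpret vec_space "TYPE(real)" n .
  have cA: "set (cols A) \<subseteq> carrier_vec n" and cB: "set (cols (A * B)) \<subseteq> carrier_vec n"
    using A B cols_dim by fastforce+
  have "set (cols (A * B)) \<subseteq> span (set (cols A))"
  proof
    fix v assume "v \<in> set (cols (A * B))"
    then obtain j where j: "j < m" "v = col (A * B) j"
      using A B by (auto simp: cols_def)
    then have "v = A *\<^sub>v col B j" using A B by auto
    moreover have "col B j \<in> carrier_vec p" using B j by auto
    ultimately have "v \<in> col_space A" using A B col_space_eq[OF A] by (auto intro!: mult_mat_vec_carrier)
    then show "v \<in> span (set (cols A))" by (simp add: col_space_def)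
  qed
  then have sub: "span (set (cols (A * B))) \<subseteq> span (set (cols A))"
    using cA by (simp add: span_subsetI)
  have sA: "VectorSpace.subspace class_ring (span (set (cols A))) V"
    and sB: "VectorSpace.subspace class_ring (span (set (cols (A * B)))) V"
    using cA cB by (auto intro: span_is_subspace)
  have vA: "vectorspace class_ring (vs (span (set (cols A))))"
    using sA subspace_is_vs by blast
  have fd: "vectorspace.fin_dim class_ring (vs (span (set (cols A))))"
     "vectorspace.fin_dim class_ring (vs (span (set (cols (A * B)))))"
    using cA cB by (auto intro!: fin_dim_span)
  have "rank (A * B) \<le> rank A"
    unfolding rank_def
    using vectorspace.subspace_dim[OF vA nested_subspaces[OF sA sB sub] fd(1)] fd(2) by simp
  also have "\<dots> \<le> p" using rank_le_nc[OF A] .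
  finally show ?thesis using A by simp
qed

lemma carrier_mat_eqI_cols:
  assumes "A \<in> carrier_mat n m" "B \<in> carrier_mat n m" "\<And>j. j < m \<Longrightarrow> col A j = col B j"
  shows "A = B"
  by (rule mat_col_eqI) (use assms in auto)

lemma mult_mat_zero_vec: "A \<in> carrier_mat n m \<Longrightarrow> (A :: real mat) *\<^sub>v 0\<^sub>v m = 0\<^sub>v n"
  by (intro eq_vecI) auto

text \<open>\<open>C\<^sup>T C v = 0\<close> implies \<open>|C v|\<^sup>2 = 0\<close>, so the Gram matrix inherits the trivial kernel of \<open>C\<close>.\<close>

lemma gram_invertible:
  fixes C :: "real mat"
  assumes C: "C \<in> carrier_mat n p"
    and inj: "\<And>v. v \<in> carrier_vec p \<Longrightarrow> C *\<^sub>v v = 0\<^sub>v n \<Longrightarrow> v = 0\<^sub>v p"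
  obtains H where "H \<in> carrier_mat p p" "H * (C\<^sup>T * C) = 1\<^sub>m p" "(C\<^sup>T * C) * H = 1\<^sub>m p"
proof -
  have CC: "C\<^sup>T * C \<in> carrier_mat p p" using C by auto
  have "Determinant.det (C\<^sup>T * C) \<noteq> 0"
  proof
    assume "Determinant.det (C\<^sup>T * C) = 0"
    then obtain v where v: "v \<in> carrier_vec p" "v \<noteq> 0\<^sub>v p" "(C\<^sup>T * C) *\<^sub>v v = 0\<^sub>v p"
      using det_0_iff_vec_prod_zero_field[OF CC] by auto
    have Cv: "C *\<^sub>v v \<in> carrier_vec n" using C v by auto
    have "(C *\<^sub>v v) \<bullet> (C *\<^sub>v v) = (C\<^sup>T *\<^sub>v (C *\<^sub>v v)) \<bullet> v"
      using transpose_vec_mult_scalar[of C n p v "C *\<^sub>v v"] C v Cv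
      by (metis comm_scalar_prod mult_mat_vec_carrier transpose_carrier_mat)
    also have "C\<^sup>T *\<^sub>v (C *\<^sub>v v) = 0\<^sub>v p" using v C by (metis assoc_mult_mat_vec transpose_carrier_mat)
    also have "0\<^sub>v p \<bullet> v = 0" using v by simp
    finally have "C *\<^sub>v v = 0\<^sub>v n" using Cv conjugate_square_eq_0_vec[of "C *\<^sub>v v" n] by simp
    with inj v show False by blast
  qed
  from det_non_zero_imp_unit[OF CC this] show ?thesis
    using that unfolding Units_def by (auto simp: ring_mat_def)
qed

text \<open>The columns of \<open>C\<close> are a basis of the column space that consists of columns of \<open>A\<close>. Thus \<open>C = A F\<close> for
  a selection matrix \<open>F\<close>, and \<open>D F = 1\<close> follows by cancelling \<open>C\<close> in \<open>C D F = C\<close>. The one-sided inverses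
  turn statements about ranks into matrix identities.\<close>

lemma rank_factorization:
  fixes A :: "real mat"
  assumes A: "A \<in> carrier_mat n m" and p: "p = mat_rank A"
  obtains C D E F where
    "C \<in> carrier_mat n p" "D \<in> carrier_mat p m" "E \<in> carrier_mat p n" "F \<in> carrier_mat m p"
    "A = C * D" "E * C = 1\<^sub>m p" "D * F = 1\<^sub>m p"
proof -
  interpret vec_space "TYPE(real)" n .
  have p_def: "p = rank A" using p A by simp
  have cA: "set (cols A) \<subseteq> carrier_vec n"
    using A cols_dim by fastforce
  obtain S where S: "maximal S (\<lambda>T. T \<subseteq> set (cols A) \<and> lin_indpt T)"
    using maximal_exists[of "(\<lambda>T. T \<subseteq> set (cols A) \<and> lin_indpt T)" "card (set (cols A))" "{}"]
    by (meson List.finite_set card_mono empty_iff empty_subsetI finite_lin_indpt2 rev_finite_subset)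
  have pS: "p = card S" unfolding p_def using rank_card_indpt[OF A S] .
  have SA: "S \<subseteq> set (cols A)" and li: "lin_indpt S" using S by (auto simp: maximal_def)
  have fS: "finite S" using SA finite_subset by blast
  obtain xs where xs: "set xs = S" "distinct xs" using fS finite_distinct_list by blast
  have lxs: "length xs = p" using xs pS distinct_card by fastforce
  have xsc: "set xs \<subseteq> carrier_vec n" using xs SA cA by auto
  define C where "C = mat_of_cols n xs"
  have C: "C \<in> carrier_mat n p" using mat_of_cols_carrier(1)[of n xs] lxs by (simp add: C_def)
  have colsC: "cols C = xs" unfolding C_def using xsc by simp
  have inj: "v = 0\<^sub>v p" if "v \<in> carrier_vec p" "C *\<^sub>v v = 0\<^sub>v n" for v
    using lin_depI[OF C that(1) _ that(2)] colsC xs li by auto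
  have "\<exists>d \<in> carrier_vec p. C *\<^sub>v d = col A j" if "j < m" for j
  proof -
    have cj: "col A j \<in> set (cols A)" using that A by (auto simp: cols_def)
    have "col A j \<in> span S"
    proof (cases "col A j \<in> S")
      case True
      then show ?thesis using SA cA span_mem by (meson subset_trans)
    next
      case False
      show ?thesis
      proof (rule ccontr)
        assume ns: "col A j \<notin> span S"
        have "lin_indpt (S \<union> {col A j})"
          using ns lin_dep_iff_in_span[of S "col A j"] li False SA cA cj by auto
        then have "S \<union> {col A j} = S" using S cj SA unfolding maximal_def by blast
        with False show False by auto
      qed
    qed
    then have "col A j \<in> col_space C" by (simp add: col_space_def colsC xs)
    then show ?thesis using col_space_eq[OF C] C by auto
  qed
  then obtain d where d: "\<And>j. j < m \<Longrightarrow> d j \<in> carrier_vec p \<and> C *\<^sub>v d j = col A j" by metis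
  define D where "D = mat_of_cols p (map d [0..<m])"
  have D: "D \<in> carrier_mat p m" unfolding D_def using mat_of_cols_carrier(1)[of p "map d [0..<m]"] by simp
  have ACD: "A = C * D"
  proof (rule carrier_mat_eqI_cols[of _ n m])
    fix j assume j: "j < m"
    have "col D j = d j" using j d by (simp add: D_def)
    then show "col A j = col (C * D) j" using j d C D col_mult2[of C n p D m j] by simp
  qed (use A C D in auto)
  have "\<exists>i<m. xs ! l = col A i" if "l < p" for l
  proof -
    have "xs ! l \<in> set (cols A)" using that lxs xs SA nth_mem by blast
    then show ?thesis using A by (auto simp: cols_def)
  qed
  then obtain s where s: "\<And>l. l < p \<Longrightarrow> s l < m \<and> xs ! l = col A (s l)" by metis
  define F where "F = mat_of_cols m (map (\<lambda>l. unit_vec m (s l) :: real Matrix.vec) [0..<p])"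
  have F: "F \<in> carrier_mat m p" unfolding F_def using mat_of_cols_carrier(1)[of m "map (\<lambda>l. unit_vec m (s l)) [0..<p]"] by simp
  \<comment> \<open>The columns of \<open>F\<close> are unit vectors that pick the basis columns of \<open>A\<close>.\<close>
  have CAF: "A * F = C"
  proof (rule carrier_mat_eqI_cols[of _ n p])
    fix l assume l: "l < p"
    then have "col (A * F) l = A *\<^sub>v unit_vec m (s l)" using A F s by (auto simp: F_def)
    also have "\<dots> = col A (s l)" using s[OF l] A by (intro eq_vecI) (auto simp: scalar_prod_right_unit)
    also have "\<dots> = col C l" using s[OF l] l colsC C by (metis carrier_matD(2) cols_nth)
    finally show "col (A * F) l = col C l" .
  qed (use A F C in auto)
  obtain H where H: "H \<in> carrier_mat p p" "H * (C\<^sup>T * C) = 1\<^sub>m p" "(C\<^sup>T * C) * H = 1\<^sub>m p"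
    using gram_invertible[OF C inj] by blast
  define E where "E = H * C\<^sup>T"
  have E: "E \<in> carrier_mat p n" using H C by (simp add: E_def)
  have EC: "E * C = 1\<^sub>m p" using H C by (simp add: E_def mat_mult_assoc)
  have "D * F = E * C * (D * F)" using EC D F by simp
  also have "\<dots> = E * (A * F)" using E C D F ACD by (simp add: mat_mult_assoc)
  also have "\<dots> = 1\<^sub>m p" by (simp add: CAF EC)
  finally have DF: "D * F = 1\<^sub>m p" .
  show ?thesis using that[OF C D E F ACD EC DF] .
qed

lemma rank_leI_factor:
  fixes A :: "real mat"
  assumes "A = C * D" "C \<in> carrier_mat n p" "D \<in> carrier_mat p m"
  shows "mat_rank A \<le> p"
  using rank_mult_le[OF assms(2,3)] assms(1) by simp

text \<open>If \<open>A\<close> factors through dimension \<open>q\<close>, then so does \<open>E A F\<close>, which has rank \<open>p\<close>.\<close>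

lemma rank_geI_det:
  fixes A :: "real mat"
  assumes A: "A \<in> carrier_mat n m" and E: "E \<in> carrier_mat p n" and F: "F \<in> carrier_mat m p"
    and d: "Determinant.det (E * A * F) \<noteq> 0"
  shows "p \<le> mat_rank A"
proof -
  define q where "q = mat_rank A"
  obtain C D where CD: "C \<in> carrier_mat n q" "D \<in> carrier_mat q m" "A = C * D"
    using rank_factorization[OF A q_def] by metis
  have "E * A * F = (E * C) * (D * F)" using E F CD by (simp add: mat_mult_assoc)
  moreover have "vec_space.rank p (E * A * F) = p"
    using vec_space.low_rank_det_zero[of "E * A * F" p] E F A d by auto
  moreover have "dim_row (E * C * (D * F)) = p" using E by simp
  ultimately have "p \<le> q" using rank_mult_le[of "E * C" p q "D * F" p] E F CD by simp
  then show ?thesis by (simp add: q_def)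
qed

text \<open>The conditions that define the pseudoinverse by a definite description; existence and uniqueness
  are needed to make use of that description.\<close>

definition is_pinv :: "real mat \<Rightarrow> real mat \<Rightarrow> bool" where
  "is_pinv A B \<longleftrightarrow> B \<in> carrier_mat (dim_col A) (dim_row A) \<and>
     A * B * A = A \<and> B * A * B = B \<and>
     transpose_mat (A * B) = A * B \<and> transpose_mat (B * A) = B * A"

lemma transpose_mult_dims:
  fixes A B :: "real mat"
  shows "dim_col A = dim_row B \<Longrightarrow> (A * B)\<^sup>T = B\<^sup>T * A\<^sup>T"
  by (rule transpose_mult[of A "dim_row A" "dim_col A" B "dim_col B"]) auto

lemma is_pinv_unique:
  assumes "is_pinv A B" "is_pinv A C"
  shows "B = C"
proof -
  have dims: "dim_row B = dim_col A" "dim_col B = dim_row A" "dim_row C = dim_col A" "dim_col C = dim_row A"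
    using assms by (auto simp: is_pinv_def)
  have B: "A * B * A = A" "B * A * B = B" "(A * B)\<^sup>T = A * B" "(B * A)\<^sup>T = B * A"
    and C: "A * C * A = A" "C * A * C = C" "(A * C)\<^sup>T = A * C" "(C * A)\<^sup>T = C * A"
    using assms unfolding is_pinv_def by blast+
  have "A * B = (A * C * A) * B" by (simp only: C)
  also have "\<dots> = (A * C) * (A * B)" using dims by (simp add: mat_mult_assoc)
  also have "\<dots> = (A * C)\<^sup>T * (A * B)\<^sup>T" by (simp only: B C)
  also have "\<dots> = ((A * B) * (A * C))\<^sup>T" using dims by (simp add: transpose_mult_dims)
  also have "(A * B) * (A * C) = (A * B * A) * C" using dims by (simp add: mat_mult_assoc)
  finally have AB: "A * B = A * C" by (simp only: B C)
  have "B * A = B * (A * C * A)" by (simp only: C)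
  also have "\<dots> = (B * A) * (C * A)" using dims by (simp add: mat_mult_assoc)
  also have "\<dots> = (B * A)\<^sup>T * (C * A)\<^sup>T" by (simp only: B C)
  also have "\<dots> = ((C * A) * (B * A))\<^sup>T" using dims by (simp add: transpose_mult_dims)
  also have "(C * A) * (B * A) = C * (A * B * A)" using dims by (simp add: mat_mult_assoc)
  finally have BA: "B * A = C * A" by (simp only: B C)
  have "B = B * A * B" by (simp only: B)
  also have "\<dots> = C * A * B" by (simp only: BA)
  also have "\<dots> = C * (A * B)" using dims by (simp add: mat_mult_assoc)
  also have "\<dots> = C * (A * C)" by (simp only: AB)
  also have "\<dots> = C * A * C" using dims by (simp add: mat_mult_assoc)
  finally show ?thesis by (simp only: C)
qed

text \<open>For a rank factorization \<open>A = C D\<close> the pseudoinverse is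
  \<open>D\<^sup>T (D D\<^sup>T)\<^sup>-\<^sup>1 (C\<^sup>T C)\<^sup>-\<^sup>1 C\<^sup>T\<close>.\<close>

lemma is_pinv_exists: "\<exists>B. is_pinv A B"
proof -
  define p n m where "p = mat_rank A" "n = dim_row A" "m = dim_col A"
  have A: "A \<in> carrier_mat n m" by (simp add: p_n_m_def)
  obtain C D E F where *: "C \<in> carrier_mat n p" "D \<in> carrier_mat p m" "E \<in> carrier_mat p n"
      "F \<in> carrier_mat m p" "E * C = 1\<^sub>m p" "D * F = 1\<^sub>m p" and ACD: "A = C * D"
    using rank_factorization[OF A p_n_m_def(1)] by metis
  have injC: "v = 0\<^sub>v p" if v: "v \<in> carrier_vec p" "C *\<^sub>v v = 0\<^sub>v n" for v
  proof -
    have "v = (E * C) *\<^sub>v v" using * v by simp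
    also have "\<dots> = E *\<^sub>v (C *\<^sub>v v)" using * v by (intro assoc_mult_mat_vec) auto
    finally show ?thesis using v * by (simp add: mult_mat_zero_vec)
  qed
  have injD: "v = 0\<^sub>v p" if v: "v \<in> carrier_vec p" "D\<^sup>T *\<^sub>v v = 0\<^sub>v m" for v
  proof -
    have "v = (D * F)\<^sup>T *\<^sub>v v" using * v by simp
    also have "\<dots> = (F\<^sup>T * D\<^sup>T) *\<^sub>v v" by (subst transpose_mult_dims) (use * in simp_all)
    also have "\<dots> = F\<^sup>T *\<^sub>v (D\<^sup>T *\<^sub>v v)" using * v by (intro assoc_mult_mat_vec) auto
    finally show ?thesis using v * by (simp add: mult_mat_zero_vec)
  qed
  obtain H where H: "H \<in> carrier_mat p p" "H * (C\<^sup>T * C) = 1\<^sub>m p" "(C\<^sup>T * C) * H = 1\<^sub>m p"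
    using gram_invertible[OF *(1) injC] by blast
  have DT: "D\<^sup>T \<in> carrier_mat m p" using * by simp
  obtain K where K: "K \<in> carrier_mat p p" "K * (D\<^sup>T\<^sup>T * D\<^sup>T) = 1\<^sub>m p" "(D\<^sup>T\<^sup>T * D\<^sup>T) * K = 1\<^sub>m p"
    using gram_invertible[OF DT injD] by blast
  define G where "G = D\<^sup>T * K * H * C\<^sup>T"
  have HT: "H\<^sup>T = H"
  proof -
    have "H\<^sup>T = H\<^sup>T * ((C\<^sup>T * C) * H)" using H by simp
    also have "\<dots> = (H\<^sup>T * (C\<^sup>T * C)) * H" using H * by (simp add: mat_mult_assoc)
    also have "H\<^sup>T * (C\<^sup>T * C) = ((C\<^sup>T * C) * H)\<^sup>T" using H(1) * by (simp add: transpose_mult_dims)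
    finally show ?thesis using H by simp
  qed
  have KT: "K\<^sup>T = K"
  proof -
    have "K\<^sup>T = K\<^sup>T * ((D * D\<^sup>T) * K)" using K by simp
    also have "\<dots> = (K\<^sup>T * (D * D\<^sup>T)) * K" using K * by (simp add: mat_mult_assoc)
    also have "K\<^sup>T * (D * D\<^sup>T) = ((D * D\<^sup>T) * K)\<^sup>T" using K(1) * by (simp add: transpose_mult_dims)
    finally show ?thesis using K by simp
  qed
  have K3: "D * D\<^sup>T * K = 1\<^sub>m p" and K2: "K * (D * D\<^sup>T) = 1\<^sub>m p" using K by simp_all
  have "A * G = C * (D * D\<^sup>T * K) * (H * C\<^sup>T)" using *(1-4) H(1) K(1) by (simp add: mat_mult_assoc G_def ACD)
  then have AG: "A * G = C * H * C\<^sup>T" unfolding K3 using *(1-4) H(1) K(1) by (simp add: mat_mult_assoc)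
  have "G * A = D\<^sup>T * K * (H * (C\<^sup>T * C)) * D" using *(1-4) H(1) K(1) by (simp add: mat_mult_assoc G_def ACD)
  then have GA: "G * A = D\<^sup>T * K * D" unfolding H(2) using *(1-4) H(1) K(1) by (simp add: mat_mult_assoc)
  have "A * G * A = C * (H * (C\<^sup>T * C)) * D" unfolding AG unfolding ACD using *(1-4) H(1) by (simp add: mat_mult_assoc)
  then have 1: "A * G * A = A" unfolding H(2) using *(1-4) H(1) ACD by simp
  have "G * A * G = D\<^sup>T * (K * (D * D\<^sup>T)) * (K * H * C\<^sup>T)" unfolding GA using *(1-4) H(1) K(1) by (simp add: mat_mult_assoc G_def ACD)
  also have "\<dots> = D\<^sup>T * (K * H * C\<^sup>T)" unfolding K2 using *(1-4) H(1) K(1) by simp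
  finally have 2: "G * A * G = G" using * H K by (simp add: G_def mat_mult_assoc)
  have 3: "(A * G)\<^sup>T = A * G" unfolding AG using * H HT by (simp add: transpose_mult_dims mat_mult_assoc)
  have 4: "(G * A)\<^sup>T = G * A" unfolding GA using * K KT by (simp add: transpose_mult_dims mat_mult_assoc)
  have "G \<in> carrier_mat m n" unfolding G_def by (rule carrier_matI) (use *(1-4) H(1) K(1) in auto)
  then have "is_pinv A G" unfolding is_pinv_def using 1 2 3 4 by (simp add: p_n_m_def)
  then show ?thesis by blast
qed

lemma is_pinv_pinv: "is_pinv A (pinv A)"
proof -
  have "pinv A = (THE B. is_pinv A B)" by (simp add: pinv_def is_pinv_def)
  moreover have "\<exists>!B. is_pinv A B" using is_pinv_exists is_pinv_unique by blast
  ultimately show ?thesis using theI'[of "is_pinv A"] by simp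
qed

section \<open>The Frobenius inner product of matrices\<close>

definition fdot :: "real mat \<Rightarrow> real mat \<Rightarrow> real" where
  "fdot A B = (\<Sum>i<dim_row A. \<Sum>j<dim_col A. A $$ (i, j) * B $$ (i, j))"

lemma fdot_commute:
  "dim_row A = dim_row B \<Longrightarrow> dim_col A = dim_col B \<Longrightarrow> fdot A B = fdot B A"
  by (simp add: fdot_def mult.commute)

lemma fdot_transpose:
  "dim_row A = dim_row B \<Longrightarrow> dim_col A = dim_col B \<Longrightarrow> fdot A\<^sup>T B\<^sup>T = fdot A B"
  unfolding fdot_def by (subst sum.swap) simp

lemma fdot_mult_left:
  assumes "A \<in> carrier_mat n p" "M \<in> carrier_mat p m" "N \<in> carrier_mat n m"
  shows "fdot (A * M) N = fdot M (A\<^sup>T * N)"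
proof -
  have "fdot (A * M) N = (\<Sum>i<n. \<Sum>j<m. \<Sum>k<p. A $$ (i, k) * M $$ (k, j) * N $$ (i, j))"
    using assms unfolding fdot_def
    by (auto simp: scalar_prod_def lessThan_atLeast0 sum_distrib_right intro!: sum.cong)
  also have "\<dots> = (\<Sum>i<n. \<Sum>k<p. \<Sum>j<m. A $$ (i, k) * M $$ (k, j) * N $$ (i, j))"
    by (rule sum.cong[OF refl], rule sum.swap)
  also have "\<dots> = (\<Sum>k<p. \<Sum>i<n. \<Sum>j<m. A $$ (i, k) * M $$ (k, j) * N $$ (i, j))"
    by (rule sum.swap)
  also have "\<dots> = (\<Sum>k<p. \<Sum>j<m. \<Sum>i<n. A $$ (i, k) * M $$ (k, j) * N $$ (i, j))"
    by (rule sum.cong[OF refl], rule sum.swap)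
  also have "\<dots> = fdot M (A\<^sup>T * N)"
    using assms unfolding fdot_def
    by (auto simp: scalar_prod_def lessThan_atLeast0 sum_distrib_left mult_ac intro!: sum.cong)
  finally show ?thesis .
qed

lemma fdot_mult_right:
  assumes "M \<in> carrier_mat n p" "A \<in> carrier_mat p m" "N \<in> carrier_mat n m"
  shows "fdot (M * A) N = fdot M (N * A\<^sup>T)"
proof -
  have "fdot (M * A) N = fdot (A\<^sup>T * M\<^sup>T) N\<^sup>T"
    using assms fdot_transpose[of "M * A" N] by (simp add: transpose_mult_dims)
  also have "\<dots> = fdot M\<^sup>T (A * N\<^sup>T)"
    using fdot_mult_left[of "A\<^sup>T" m p "M\<^sup>T" n "N\<^sup>T"] assms by simp
  also have "A * N\<^sup>T = (N * A\<^sup>T)\<^sup>T" using assms by (simp add: transpose_mult_dims)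
  also have "fdot M\<^sup>T (N * A\<^sup>T)\<^sup>T = fdot M (N * A\<^sup>T)"
    by (rule fdot_transpose) (use assms in auto)
  finally show ?thesis .
qed

section \<open>Mode products of tensors\<close>

lemma finite_multi_indices [simp]: "finite (multi_indices n)"
proof (rule finite_subset)
  show "multi_indices n \<subseteq> {i. set i \<subseteq> {..<sum_list n} \<and> length i = length n}"
  proof (auto simp: multi_indices_def in_set_conv_nth)
    fix i k assume "length i = length n" "\<forall>k<length n. i ! k < n ! k" "k < length n"
    then have "i ! k < n ! k" "n ! k \<le> sum_list n" by (auto intro: member_le_sum_list)
    then show "i ! k < sum_list n" by linarith
  qed
  show "finite {i. set i \<subseteq> {..<sum_list n} \<and> length i = length n}"
    by (rule finite_lists_length_eq) simp
qed

lemma multi_indices_update: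
  "i \<in> multi_indices n \<Longrightarrow> k < length n \<Longrightarrow> a < m \<Longrightarrow> i[k := a] \<in> multi_indices (n[k := m])"
  by (auto simp: multi_indices_def nth_list_update)

lemma multi_indices_update':
  "i \<in> multi_indices (n[k := m]) \<Longrightarrow> k < length n \<Longrightarrow> a < n ! k \<Longrightarrow> i[k := a] \<in> multi_indices n"
  by (auto simp: multi_indices_def nth_list_update)

lemma multi_indices_nth: "i \<in> multi_indices n \<Longrightarrow> k < length n \<Longrightarrow> i ! k < n ! k"
  by (auto simp: multi_indices_def)

lemma multi_indices_length: "i \<in> multi_indices n \<Longrightarrow> length i = length n"
  by (auto simp: multi_indices_def)

text \<open>The inner product of tensors of an arbitrary shape \<open>n\<close>, as the cores of Tucker decompositions have
  shapes different from that of the ambient space.\<close>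

definition tdot :: "nat list \<Rightarrow> tensor \<Rightarrow> tensor \<Rightarrow> real" where
  "tdot n X Y = (\<Sum>i\<in>multi_indices n. X i * Y i)"

lemma tdot_cong:
  "(\<And>i. i \<in> multi_indices n \<Longrightarrow> X i = X' i) \<Longrightarrow> (\<And>i. i \<in> multi_indices n \<Longrightarrow> Y i = Y' i) \<Longrightarrow>
     tdot n X Y = tdot n X' Y'"
  by (simp add: tdot_def)

text \<open>Both sides are sums over all pairs of indices that agree except in mode \<open>k\<close>.\<close>

lemma tdot_mode_prod:
  assumes k: "k < length n" and A: "A \<in> carrier_mat m (n ! k)"
  shows "tdot (n[k := m]) (mode_prod k A X) Y = tdot n X (mode_prod k A\<^sup>T Y)"
proof -
  have "tdot (n[k := m]) (mode_prod k A X) Y =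
    (\<Sum>(i, a)\<in>multi_indices (n[k := m]) \<times> {..<n ! k}. A $$ (i ! k, a) * X (i[k := a]) * Y i)"
    using A by (simp add: tdot_def mode_prod_def sum_distrib_right sum.cartesian_product)
  also have "\<dots> = (\<Sum>(i, b)\<in>multi_indices n \<times> {..<m}. A $$ (b, i ! k) * X i * Y (i[k := b]))"
    by (rule sum.reindex_bij_witness[where i = "\<lambda>(i, b). (i[k := b], i ! k)" and j = "\<lambda>(i, a). (i[k := a], i ! k)"])
      (use k in \<open>auto simp: multi_indices_length multi_indices_nth intro: multi_indices_update multi_indices_update'
        dest: multi_indices_nth[where k=k]\<close>)
  also have "\<dots> = tdot n X (mode_prod k A\<^sup>T Y)"
    using A k unfolding tdot_def mode_prod_def
    by (subst sum.cartesian_product[symmetric])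
      (auto simp: sum_distrib_left mult_ac multi_indices_nth intro!: sum.cong)
  finally show ?thesis .
qed

lemma mode_prod_commute:
  assumes "k \<noteq> l"
  shows "mode_prod k A (mode_prod l B X) = mode_prod l B (mode_prod k A X)"
proof
  fix i
  have "mode_prod k A (mode_prod l B X) i =
    (\<Sum>a<dim_col A. \<Sum>b<dim_col B. A $$ (i ! k, a) * (B $$ (i ! l, b) * X (i[k := a, l := b])))"
    using assms by (simp add: mode_prod_def sum_distrib_left)
  also have "\<dots> = (\<Sum>b<dim_col B. \<Sum>a<dim_col A. A $$ (i ! k, a) * (B $$ (i ! l, b) * X (i[k := a, l := b])))"
    by (rule sum.swap)
  also have "\<dots> = mode_prod l B (mode_prod k A X) i"
    using assms by (simp add: mode_prod_def sum_distrib_left mult_ac list_update_swap)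
  finally show "mode_prod k A (mode_prod l B X) i = mode_prod l B (mode_prod k A X) i" .
qed

lemma mode_prod_mode_prod:
  assumes "k < length i" "i ! k < dim_row A" "dim_col A = dim_row B"
  shows "mode_prod k A (mode_prod k B X) i = mode_prod k (A * B) X i"
proof -
  have "mode_prod k A (mode_prod k B X) i =
    (\<Sum>a<dim_col A. \<Sum>b<dim_col B. A $$ (i ! k, a) * B $$ (a, b) * X (i[k := b]))"
    using assms by (simp add: mode_prod_def sum_distrib_left mult.assoc)
  also have "\<dots> = (\<Sum>b<dim_col B. \<Sum>a<dim_col A. A $$ (i ! k, a) * B $$ (a, b) * X (i[k := b]))"
    by (rule sum.swap)
  also have "\<dots> = mode_prod k (A * B) X i"
    using assms by (simp add: mode_prod_def scalar_prod_def sum_distrib_right lessThan_atLeast0)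
  finally show ?thesis .
qed

lemma mode_prod_one:
  assumes "k < length i" "i ! k < m"
  shows "mode_prod k (1\<^sub>m m) X i = X i"
proof -
  have "mode_prod k (1\<^sub>m m) X i = (\<Sum>a<m. if a = i ! k then X (i[k := a]) else 0)"
    unfolding mode_prod_def by (rule sum.cong) (use assms in auto)
  then show ?thesis using assms by simp
qed

lemma mode_prod_cong:
  assumes "\<And>a. a < dim_col A \<Longrightarrow> X (i[k := a]) = Y (i[k := a])"
  shows "mode_prod k A X i = mode_prod k A Y i"
  using assms by (simp add: mode_prod_def)

lemma mode_prods_Nil [simp]: "mode_prods [] A X = X"
  by (simp add: mode_prods_def)

lemma mode_prods_Cons: "mode_prods (k # ks) A X = mode_prods ks A (mode_prod k (A k) X)"
  by (simp add: mode_prods_def)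

lemma mode_prods_snoc: "mode_prods (ks @ [k]) A X = mode_prod k (A k) (mode_prods ks A X)"
  by (simp add: mode_prods_def)

lemma mode_prods_mode_prod:
  "k \<notin> set ks \<Longrightarrow> mode_prods ks A (mode_prod k B X) = mode_prod k B (mode_prods ks A X)"
proof (induction ks arbitrary: X)
  case (Cons l ks)
  then show ?case by (simp add: mode_prods_Cons mode_prod_commute[of l k])
qed simp

lemma mode_prods_rev:
  "distinct ks \<Longrightarrow> mode_prods (rev ks) A X = mode_prods ks A X"
  by (induction ks arbitrary: X) (auto simp: mode_prods_Cons mode_prods_snoc mode_prods_mode_prod)

text \<open>Products in different modes commute, so any of them may be carried out first.\<close>

lemma mode_prods_extract:
  "distinct ks \<Longrightarrow> k \<in> set ks \<Longrightarrow>
    mode_prods ks A X = mode_prods (filter (\<lambda>j. j \<noteq> k) ks) A (mode_prod k (A k) X)"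
proof (induction ks arbitrary: X)
  case (Cons l ks)
  show ?case
  proof (cases "l = k")
    case True
    then have "filter (\<lambda>j. j \<noteq> k) ks = ks" using Cons.prems by (auto intro!: filter_True)
    then show ?thesis using True by (simp add: mode_prods_Cons)
  next
    case False
    then show ?thesis using Cons by (simp add: mode_prods_Cons mode_prod_commute)
  qed
qed simp

text \<open>A set that is closed under changes in the modes \<open>ks\<close> takes the place of a shape. With it, factors in
  mode \<open>k\<close> can be compared without tracking the shapes in the other modes.\<close>

lemma mode_prods_cong_set:
  assumes "\<And>i. i \<in> S \<Longrightarrow> X i = Y i" and "\<And>i k a. i \<in> S \<Longrightarrow> k \<in> set ks \<Longrightarrow> i[k := a] \<in> S" and "i \<in> S"
  shows "mode_prods ks A X i = mode_prods ks A Y i"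
  using assms
proof (induction ks arbitrary: X Y i)
  case (Cons k ks)
  show ?case unfolding mode_prods_Cons
    by (rule Cons.IH) (use Cons.prems in \<open>auto intro!: mode_prod_cong\<close>)
qed simp

text \<open>The shape after mode products whose factors have \<open>m k\<close> rows.\<close>

definition reshape :: "nat list \<Rightarrow> (nat \<Rightarrow> nat) \<Rightarrow> nat list \<Rightarrow> nat list" where
  "reshape ks m n = fold (\<lambda>k n. n[k := m k]) ks n"

lemma reshape_Cons: "reshape (k # ks) m n = reshape ks m (n[k := m k])"
  by (simp add: reshape_def)

lemma length_reshape [simp]: "length (reshape ks m n) = length n"
  by (induction ks arbitrary: n) (auto simp: reshape_def)

lemma nth_reshape:
  "l < length n \<Longrightarrow> reshape ks m n ! l = (if l \<in> set ks then m l else n ! l)"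
  by (induction ks arbitrary: n) (auto simp: reshape_Cons, auto simp: reshape_def)

lemma tdot_mode_prods:
  assumes "distinct ks" "\<And>k. k \<in> set ks \<Longrightarrow> k < length n \<and> A k \<in> carrier_mat (m k) (n ! k)"
  shows "tdot (reshape ks m n) (mode_prods ks A X) Y = tdot n X (mode_prods (rev ks) (\<lambda>k. (A k)\<^sup>T) Y)"
  using assms
proof (induction ks arbitrary: X n)
  case (Cons k ks)
  have "tdot (reshape (k # ks) m n) (mode_prods (k # ks) A X) Y =
    tdot (n[k := m k]) (mode_prod k (A k) X) (mode_prods (rev ks) (\<lambda>k. (A k)\<^sup>T) Y)"
    unfolding reshape_Cons mode_prods_Cons
    by (rule Cons.IH) (use Cons.prems in \<open>auto simp: nth_list_update\<close>)
  also have "\<dots> = tdot n X (mode_prod k (A k)\<^sup>T (mode_prods (rev ks) (\<lambda>k. (A k)\<^sup>T) Y))"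
    by (rule tdot_mode_prod) (use Cons.prems in auto)
  finally show ?case by (simp add: mode_prods_snoc)
qed (simp add: reshape_def)

text \<open>The reversal of \<open>ks\<close> makes the innermost pair of factors meet first.\<close>

lemma mode_prods_isometry_cancel:
  assumes "distinct ks"
    "\<And>k. k \<in> set ks \<Longrightarrow> k < length n \<and> U k \<in> carrier_mat (m k) (n ! k) \<and> (U k)\<^sup>T * U k = 1\<^sub>m (n ! k)"
    "i \<in> multi_indices n"
  shows "mode_prods (rev ks) (\<lambda>k. (U k)\<^sup>T) (mode_prods ks U X) i = X i"
  using assms
proof (induction ks arbitrary: X n i)
  case (Cons k ks)
  have k: "k < length n" "U k \<in> carrier_mat (m k) (n ! k)" "(U k)\<^sup>T * U k = 1\<^sub>m (n ! k)"
    using Cons.prems by auto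
  have i: "k < length i" "i ! k < n ! k" using Cons.prems k by (auto simp: multi_indices_def)
  have "mode_prods (rev (k # ks)) (\<lambda>k. (U k)\<^sup>T) (mode_prods (k # ks) U X) i =
    mode_prod k (U k)\<^sup>T (mode_prods (rev ks) (\<lambda>k. (U k)\<^sup>T) (mode_prods ks U (mode_prod k (U k) X))) i"
    by (simp add: mode_prods_snoc mode_prods_Cons)
  also have "\<dots> = mode_prod k (U k)\<^sup>T (mode_prod k (U k) X) i"
  proof (rule mode_prod_cong)
    fix a assume "a < dim_col (U k)\<^sup>T"
    then have a: "a < m k" using k by simp
    show "mode_prods (rev ks) (\<lambda>k. (U k)\<^sup>T) (mode_prods ks U (mode_prod k (U k) X)) (i[k := a]) =
      mode_prod k (U k) X (i[k := a])"
      by (rule Cons.IH[where n = "n[k := m k]"])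
        (use Cons.prems a in \<open>auto simp: nth_list_update intro!: multi_indices_update\<close>)
  qed
  also have "\<dots> = X i" using k i by (subst mode_prod_mode_prod) (auto simp: mode_prod_one)
  finally show ?case .
qed simp

section \<open>Unfoldings as isometries\<close>

lemma mixed_radix_unique:
  fixes e :: "nat \<Rightarrow> nat"
  assumes "\<And>l. l < d \<Longrightarrow> b div (\<Prod>m<l. e m) mod e l = c div (\<Prod>m<l. e m) mod e l"
  shows "b mod (\<Prod>m<d. e m) = c mod (\<Prod>m<d. e m)"
  using assms by (induction d) (auto simp: mod_mult2_eq)

lemma mixed_radix_exists:
  fixes e i :: "nat \<Rightarrow> nat"
  assumes "\<And>l. l < d \<Longrightarrow> i l < e l"
  shows "\<exists>b<(\<Prod>m<d. e m). \<forall>l<d. b div (\<Prod>m<l. e m) mod e l = i l"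
  using assms
proof (induction d)
  case (Suc d)
  then obtain b where b: "b < (\<Prod>m<d. e m)" "\<And>l. l < d \<Longrightarrow> b div (\<Prod>m<l. e m) mod e l = i l" by auto
  define E where "E = (\<Prod>m<d. e m)"
  define c where "c = b + E * i d"
  have id: "i d < e d" using Suc by simp
  have "c < E * (Suc (i d))" using b by (simp add: c_def E_def)
  also have "\<dots> \<le> E * e d" using id by (intro mult_le_mono) auto
  finally have "c < (\<Prod>m<Suc d. e m)" by (simp add: E_def)
  moreover have "c div (\<Prod>m<l. e m) mod e l = i l" if "l < Suc d" for l
  proof (cases "l = d")
    case True
    have "c div E = i d" using b(1) by (simp add: c_def flip: E_def)
    then show ?thesis using True id by (simp add: E_def)
  next
    case False
    then have l: "l < d" using that by simp
    have digit: "x div y mod z = x mod (y * z) div y" for x y z :: nat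
      by (cases "y = 0") (simp_all add: mod_mult2_eq)
    have dv: "(\<Prod>m<l. e m) * e l dvd E"
      using l prod_dvd_prod_subset[of "{..<d}" "{..<Suc l}" e] by (auto simp: E_def)
    have "c mod ((\<Prod>m<l. e m) * e l) = b mod ((\<Prod>m<l. e m) * e l)"
      using dv unfolding c_def by (metis dvd_trans dvd_triv_left mod_add_right_eq dvd_eq_mod_eq_0 add_0_right)
    then show ?thesis using b(2)[OF l] by (simp add: digit)
  qed
  ultimately show ?case by blast
qed auto

text \<open>With radix 1 in place \<open>k\<close>, the digits of the column number are precisely the remaining indices.\<close>

lemma unfold_index_bij:
  assumes k: "k < length n"
  shows "bij_betw (\<lambda>(a, b). unfold_index n k a b)
    ({..<n ! k} \<times> {..<\<Prod>m\<in>{..<length n} - {k}. n ! m}) (multi_indices n)"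
proof -
  define e where "e l = (if l = k then 1 else n ! l)" for l
  have E: "(\<Prod>m\<in>{..<l} - {k}. n ! m) = (\<Prod>m<l. e m)" for l
    by (rule prod.mono_neutral_cong_left) (auto simp: e_def)
  have nth: "unfold_index n k a b ! l = (if l = k then a else b div (\<Prod>m<l. e m) mod e l)"
    if "l < length n" for l a b
    using that by (simp add: unfold_index_def E e_def)
  show ?thesis unfolding bij_betw_def
  proof
    show "inj_on (\<lambda>(a, b). unfold_index n k a b) ({..<n ! k} \<times> {..<\<Prod>m\<in>{..<length n} - {k}. n ! m})"
    proof (rule inj_onI, clarsimp simp: E)
      fix a b a' b'
      assume b: "b < (\<Prod>m<length n. e m)" "b' < (\<Prod>m<length n. e m)"
        and eq: "unfold_index n k a b = unfold_index n k a' b'"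
      have "a = a'" using nth[OF k] eq by metis
      moreover have "b mod (\<Prod>m<length n. e m) = b' mod (\<Prod>m<length n. e m)"
      proof (rule mixed_radix_unique)
        fix l assume l: "l < length n"
        show "b div prod e {..<l} mod e l = b' div prod e {..<l} mod e l"
          using nth[OF l, of a b] nth[OF l, of a' b'] eq by (cases "l = k") (auto simp: e_def)
      qed
      ultimately show "a = a' \<and> b = b'" using b by simp
    qed
    show "(\<lambda>(a, b). unfold_index n k a b) ` ({..<n ! k} \<times> {..<\<Prod>m\<in>{..<length n} - {k}. n ! m}) = multi_indices n"
    proof (intro equalityI subsetI)
      fix i assume "i \<in> (\<lambda>(a, b). unfold_index n k a b) ` ({..<n ! k} \<times> {..<\<Prod>m\<in>{..<length n} - {k}. n ! m})"
      then obtain a b where ab: "a < n ! k" "b < (\<Prod>m<length n. e m)" "i = unfold_index n k a b" by (auto simp: E)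
      have pos: "0 < e l" if "l < length n" for l
      proof (rule ccontr)
        assume "\<not> 0 < e l"
        then have "(\<Prod>m<length n. e m) = 0" using that by (intro prod_zero) auto
        then show False using ab(2) by (metis not_less_zero)
      qed
      have "i ! l < n ! l" if "l < length n" for l
        using nth[OF that, of a b] ab pos[OF that] by (cases "l = k") (auto simp: e_def)
      then show "i \<in> multi_indices n" using ab by (simp add: multi_indices_def unfold_index_def)
    next
      fix i assume i: "i \<in> multi_indices n"
      have "\<exists>b<(\<Prod>m<length n. e m). \<forall>l<length n. b div (\<Prod>m<l. e m) mod e l = (if l = k then 0 else i ! l)"
        by (rule mixed_radix_exists) (use i in \<open>auto simp: e_def multi_indices_def\<close>)
      then obtain b where b: "b < (\<Prod>m<length n. e m)"
        "\<And>l. l < length n \<Longrightarrow> b div (\<Prod>m<l. e m) mod e l = (if l = k then 0 else i ! l)" by auto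
      have "i = unfold_index n k (i ! k) b"
        by (rule nth_equalityI) (use i b nth in \<open>auto simp: multi_indices_def unfold_index_def\<close>)
      then show "i \<in> (\<lambda>(a, b). unfold_index n k a b) ` ({..<n ! k} \<times> {..<\<Prod>m\<in>{..<length n} - {k}. n ! m})"
        using b i k by (auto simp: E multi_indices_def intro!: image_eqI[where x = "(i ! k, b)"])
    qed
  qed
qed

lemma tdot_unfold:
  assumes k: "k < length n"
  shows "tdot n X Y = fdot (unfold n k X) (unfold n k Y)"
proof -
  have "tdot n X Y = (\<Sum>(a, b)\<in>{..<n ! k} \<times> {..<\<Prod>m\<in>{..<length n} - {k}. n ! m}.
    X (unfold_index n k a b) * Y (unfold_index n k a b))"
    unfolding tdot_def
    by (subst sum.reindex_bij_betw[OF unfold_index_bij[OF k], symmetric]) (simp add: case_prod_unfold)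
  then show ?thesis by (simp add: fdot_def unfold_def sum.cartesian_product)
qed

lemma unfold_eqD:
  assumes k: "k < length n" and eq: "unfold n k X = unfold n k Y" and i: "i \<in> multi_indices n"
  shows "X i = Y i"
proof -
  have "i \<in> (\<lambda>(a, b). unfold_index n k a b) ` ({..<n ! k} \<times> {..<\<Prod>m\<in>{..<length n} - {k}. n ! m})"
    using unfold_index_bij[OF k] i unfolding bij_betw_def by simp
  then obtain a b where ab: "a < n ! k" "b < (\<Prod>m\<in>{..<length n} - {k}. n ! m)" "i = unfold_index n k a b"
    by auto
  have "unfold n k X $$ (a, b) = unfold n k Y $$ (a, b)" using eq by simp
  then show ?thesis using ab by (simp add: unfold_def)
qed

lemma unfold_index_in:
  assumes k: "k < length n" and "a < n ! k" "b < (\<Prod>m\<in>{..<length n} - {k}. n ! m)"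
  shows "unfold_index n k a b \<in> multi_indices n"
  using unfold_index_bij[OF k] assms unfolding bij_betw_def by auto

lemma unfold_cong:
  assumes "k < length n" "\<And>i. i \<in> multi_indices n \<Longrightarrow> X i = Y i"
  shows "unfold n k X = unfold n k Y"
  unfolding unfold_def by (rule cong_mat) (use assms unfold_index_in in auto)

section \<open>Mode products as linear operators\<close>

text \<open>Tensors of the fixed shape \<open>n\<close> are vectors of the Euclidean space \<open>real ^ 'i\<close>; square factors keep the
  shape, and so mode products become linear operators of this space.\<close>

locale tensor_shape =
  fixes idx :: "'i::finite \<Rightarrow> nat list" and n :: "nat list"
  assumes bij: "bij_betw idx UNIV (multi_indices n)"
begin

abbreviation T :: "real ^ 'i \<Rightarrow> tensor" where "T \<equiv> to_tensor idx"

abbreviation unf :: "nat \<Rightarrow> real ^ 'i \<Rightarrow> real mat" where "unf k Z \<equiv> unfold n k (T Z)"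

abbreviation nc :: "nat \<Rightarrow> nat" where "nc k \<equiv> \<Prod>m\<in>{..<length n} - {k}. n ! m"

abbreviation sq :: "nat \<Rightarrow> real mat set" where "sq k \<equiv> carrier_mat (n ! k) (n ! k)"

definition mode_op :: "nat \<Rightarrow> real mat \<Rightarrow> real ^ 'i \<Rightarrow> real ^ 'i" where
  "mode_op k M Z = of_tensor idx (mode_prod k M (T Z))"

lemma idx_in: "idx j \<in> multi_indices n"
  using bij by (auto simp: bij_betw_def)

lemma to_tensor_of_tensor: "i \<in> multi_indices n \<Longrightarrow> T (of_tensor idx F) i = F i"
  using bij by (auto simp: to_tensor_def of_tensor_def bij_betw_def f_inv_into_f)

lemma to_tensor_idx: "T Z (idx j) = Z $ j"
  using bij by (auto simp: to_tensor_def bij_betw_def inv_into_f_f)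

lemma of_tensor_cong: "(\<And>i. i \<in> multi_indices n \<Longrightarrow> F i = H i) \<Longrightarrow> of_tensor idx F = of_tensor idx H"
  by (simp add: of_tensor_def idx_in)

lemma of_tensor_to_tensor: "of_tensor idx (T Z) = Z"
  by (simp add: of_tensor_def to_tensor_idx Finite_Cartesian_Product.vec_eq_iff)

lemma inner_tdot: "inner Z Y = tdot n (T Z) (T Y)"
proof -
  have "tdot n (T Z) (T Y) = (\<Sum>j\<in>UNIV. T Z (idx j) * T Y (idx j))"
    unfolding tdot_def by (rule sum.reindex_bij_betw[OF bij, symmetric])
  then show ?thesis by (simp add: to_tensor_idx inner_vec_def)
qed

lemma inner_of_tensor: "inner Z (of_tensor idx F) = tdot n (T Z) F"
  unfolding inner_tdot by (rule tdot_cong) (auto simp: to_tensor_of_tensor)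

lemma inner_fdot: "k < length n \<Longrightarrow> inner Z Y = fdot (unf k Z) (unf k Y)"
  by (simp add: inner_tdot tdot_unfold)

lemma unf_carrier: "unf k Z \<in> carrier_mat (n ! k) (nc k)"
  by (simp add: unfold_def)

lemma unf_dims [simp]: "dim_row (unf k Z) = n ! k" "dim_col (unf k Z) = nc k"
  by (simp_all add: unfold_def)

lemma unf_inj: "k < length n \<Longrightarrow> unf k Z = unf k Y \<Longrightarrow> Z = Y"
  using unfold_eqD[of k n "T Z" "T Y"] idx_in
  by (simp add: Finite_Cartesian_Product.vec_eq_iff flip: to_tensor_idx)

lemma unf_index:
  "a < n ! k \<Longrightarrow> b < nc k \<Longrightarrow> unf k Z $$ (a, b) = T Z (unfold_index n k a b)"
  by (simp add: unfold_def)

lemma T_linear: "T (Z + Y) i = T Z i + T Y i" "T (c *\<^sub>R Z) i = c * T Z i" "T (Z - Y) i = T Z i - T Y i"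
  by (auto simp: to_tensor_def)

lemma unf_add: "unf k (Z + Y) = unf k Z + unf k Y"
  by (intro eq_matI) (auto simp: T_linear unfold_def)

lemma unf_diff: "unf k (Z - Y) = unf k Z - unf k Y"
  by (intro eq_matI) (auto simp: T_linear unfold_def)

lemma unf_scale: "unf k (c *\<^sub>R Z) = c \<cdot>\<^sub>m unf k Z"
  by (intro eq_matI) (auto simp: T_linear unfold_def)

lemma unf_of_tensor: "k < length n \<Longrightarrow> unf k (of_tensor idx F) = unfold n k F"
  by (rule unfold_cong) (auto simp: to_tensor_of_tensor)

lemma unf_mode_op: "k < length n \<Longrightarrow> M \<in> sq k \<Longrightarrow> unf k (mode_op k M Z) = M * unf k Z"
  using unfold_mode_prod[of k n M "n ! k" "T Z"] by (simp add: mode_op_def unf_of_tensor)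

lemma mode_op_eqI: "k < length n \<Longrightarrow> M \<in> sq k \<Longrightarrow> unf k Y = M * unf k Z \<Longrightarrow> Y = mode_op k M Z"
  by (rule unf_inj[of k]) (auto simp: unf_mode_op)

lemma linear_mode_op: "linear (mode_op k M)"
  by (rule linearI)
    (auto simp: mode_op_def of_tensor_def mode_prod_def T_linear Finite_Cartesian_Product.vec_eq_iff sum_distrib_left algebra_simps sum.distrib)

lemma mode_op_sum: "mode_op k M (\<Sum>j\<in>J. Z j) = (\<Sum>j\<in>J. mode_op k M (Z j))"
  by (rule linear_sum[OF linear_mode_op])

lemma mode_op_add: "mode_op k M (Z + Y) = mode_op k M Z + mode_op k M Y"
  by (rule linear_add[OF linear_mode_op])

lemma mode_op_diff: "mode_op k M (Z - Y) = mode_op k M Z - mode_op k M Y"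
  by (rule linear_diff[OF linear_mode_op])

lemma mode_op_op:
  assumes "k < length n" "M \<in> sq k" "N \<in> sq k"
  shows "mode_op k M (mode_op k N Z) = mode_op k (M * N) Z"
  by (rule mode_op_eqI) (use assms unf_carrier[of k Z] in \<open>auto simp: unf_mode_op mat_mult_assoc\<close>)

lemma mode_op_one: "k < length n \<Longrightarrow> mode_op k (1\<^sub>m (n ! k)) Z = Z"
  by (rule mode_op_eqI[symmetric]) (use unf_carrier[of k Z] in auto)

lemma mode_op_zero: "k < length n \<Longrightarrow> mode_op k (0\<^sub>m (n ! k) (n ! k)) Z = 0"
  by (simp add: mode_op_def mode_prod_def of_tensor_def Finite_Cartesian_Product.vec_eq_iff multi_indices_nth idx_in)

lemma mode_op_mat_diff:
  "k < length n \<Longrightarrow> M \<in> sq k \<Longrightarrow> N \<in> sq k \<Longrightarrow> mode_op k (M - N) Z = mode_op k M Z - mode_op k N Z"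
  by (rule mode_op_eqI[symmetric]) (use unf_carrier[of k Z] in \<open>auto simp: unf_diff unf_mode_op minus_mult_distrib_mat\<close>)

lemma mode_prod_to_tensor_of_tensor:
  assumes "l < length n" "M \<in> sq l" "i \<in> multi_indices n"
  shows "mode_prod l M (T (of_tensor idx F)) i = mode_prod l M F i"
  by (rule mode_prod_cong) (use assms multi_indices_update'[of i n l "n ! l"] in \<open>auto simp: to_tensor_of_tensor\<close>)

lemma mode_op_of_tensor:
  assumes "l < length n" "M \<in> sq l"
  shows "mode_op l M (of_tensor idx F) = of_tensor idx (mode_prod l M F)"
  unfolding mode_op_def by (rule of_tensor_cong) (use assms mode_prod_to_tensor_of_tensor in auto)

lemma mode_op_commute:
  assumes "k < length n" "l < length n" "k \<noteq> l" "M \<in> sq k" "N \<in> sq l"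
  shows "mode_op k M (mode_op l N Z) = mode_op l N (mode_op k M Z)"
  using assms mode_op_of_tensor[of k M] mode_op_of_tensor[of l N] mode_prod_commute[of k l M N "T Z"]
  by (simp add: mode_op_def[of k M Z] mode_op_def[of l N Z])

text \<open>An instance of \<open>tdot_mode_prod\<close> in which the shape does not change.\<close>

lemma mode_op_adjoint:
  assumes "k < length n" "M \<in> sq k"
  shows "inner (mode_op k M Z) Y = inner Z (mode_op k M\<^sup>T Y)"
proof -
  have "inner (mode_op k M Z) Y = tdot n (T Y) (mode_prod k M (T Z))"
    by (simp add: mode_op_def inner_of_tensor inner_commute)
  also have "\<dots> = tdot n (mode_prod k M (T Z)) (T Y)" by (simp add: tdot_def mult.commute)
  also have "\<dots> = tdot n (T Z) (mode_prod k M\<^sup>T (T Y))"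
    using tdot_mode_prod[of k n M "n ! k"] assms by simp
  finally show ?thesis by (simp add: mode_op_def inner_of_tensor)
qed

definition mode_ops :: "nat list \<Rightarrow> (nat \<Rightarrow> real mat) \<Rightarrow> real ^ 'i \<Rightarrow> real ^ 'i" where
  "mode_ops ks M Z = fold (\<lambda>k. mode_op k (M k)) ks Z"

lemma mode_ops_Nil [simp]: "mode_ops [] M Z = Z" by (simp add: mode_ops_def)
lemma mode_ops_Cons: "mode_ops (k # ks) M Z = mode_ops ks M (mode_op k (M k) Z)" by (simp add: mode_ops_def)
lemma mode_ops_snoc: "mode_ops (ks @ [k]) M Z = mode_op k (M k) (mode_ops ks M Z)" by (simp add: mode_ops_def)

lemma of_tensor_mode_prods:
  assumes "\<And>k. k \<in> set ks \<Longrightarrow> k < length n \<and> M k \<in> sq k"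
  shows "of_tensor idx (mode_prods ks M F) = mode_ops ks M (of_tensor idx F)"
  using assms by (induction ks arbitrary: F) (auto simp: mode_prods_Cons mode_ops_Cons mode_op_of_tensor)

lemma mode_ops_op_commute:
  assumes "\<And>k. k \<in> set ks \<Longrightarrow> k < length n \<and> M k \<in> sq k" "l \<notin> set ks" "l < length n" "N \<in> sq l"
  shows "mode_ops ks M (mode_op l N Z) = mode_op l N (mode_ops ks M Z)"
  using assms by (induction ks arbitrary: Z) (auto simp: mode_ops_Cons mode_op_commute[of _ l])

lemma mode_ops_adjoint:
  assumes "\<And>k. k \<in> set ks \<Longrightarrow> k < length n \<and> M k \<in> sq k"
  shows "inner (mode_ops ks M Z) Y = inner Z (mode_ops (rev ks) (\<lambda>k. (M k)\<^sup>T) Y)"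
  using assms by (induction ks arbitrary: Z) (auto simp: mode_ops_Cons mode_ops_snoc mode_op_adjoint)

lemma mode_ops_invariant:
  assumes "\<And>k. k \<in> set ks \<Longrightarrow> mode_op k (P k) Z = Z"
  shows "mode_ops ks P Z = Z"
  using assms by (induction ks) (auto simp: mode_ops_Cons)

text \<open>Since the operators commute, each of them can be carried out last; the range of the composition is
  therefore contained in the range of each of them.\<close>

lemma mode_ops_extract:
  assumes "\<And>k. k \<in> set ks \<Longrightarrow> k < length n \<and> M k \<in> sq k" "distinct ks" "l \<in> set ks"
  shows "\<exists>Y. mode_ops ks M Z = mode_op l (M l) Y"
  using assms
proof (induction ks arbitrary: Z)
  case (Cons k ks)
  show ?case
  proof (cases "l = k")
    case True
    then show ?thesis using Cons.prems by (auto simp: mode_ops_Cons mode_ops_op_commute)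
  next
    case False
    then show ?thesis using Cons.IH[of "mode_op k (M k) Z"] Cons.prems by (simp add: mode_ops_Cons)
  qed
qed simp

definition orth_proj_at :: "nat \<Rightarrow> real mat \<Rightarrow> bool" where
  "orth_proj_at k P \<longleftrightarrow> P \<in> sq k \<and> P\<^sup>T = P \<and> P * P = P"

lemma mode_ops_proj_invariant:
  assumes P: "\<And>k. k < length n \<Longrightarrow> orth_proj_at k (P k)" and k: "k < length n"
  shows "mode_op k (P k) (mode_ops [0..<length n] P A) = mode_ops [0..<length n] P A"
proof -
  obtain Y where Y: "mode_ops [0..<length n] P A = mode_op k (P k) Y"
    using mode_ops_extract[of "[0..<length n]" P k A] k P by (auto simp: orth_proj_at_def)
  then show ?thesis using mode_op_op[OF k, of "P k" "P k" Y] P[OF k] by (simp add: orth_proj_at_def)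
qed

lemma mode_op_proj_contraction:
  assumes "k < length n" "orth_proj_at k P"
  shows "norm (mode_op k P Z) \<le> norm Z"
proof -
  have "(norm (mode_op k P Z))\<^sup>2 = inner Z (mode_op k P Z)"
    using assms mode_op_adjoint[of k P Z "mode_op k P Z"] mode_op_op[of k P P Z]
    by (simp add: orth_proj_at_def power2_norm_eq_inner)
  also have "\<dots> \<le> norm Z * norm (mode_op k P Z)" by (rule norm_cauchy_schwarz)
  finally show ?thesis
    by (cases "norm (mode_op k P Z) = 0") (auto simp: power2_eq_square mult.commute)
qed

text \<open>Telescoping, with each remaining factor a contraction.\<close>

lemma mode_ops_proj_error:
  assumes "\<And>k. k \<in> set ks \<Longrightarrow> k < length n \<and> orth_proj_at k (P k)"
  shows "norm (A - mode_ops ks P A) \<le> (\<Sum>k\<leftarrow>ks. norm (A - mode_op k (P k) A))"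
  using assms
proof (induction ks rule: rev_induct)
  case (snoc k ks)
  have "A - mode_ops (ks @ [k]) P A = (A - mode_op k (P k) A) + mode_op k (P k) (A - mode_ops ks P A)"
    by (simp add: mode_ops_snoc mode_op_diff)
  then have "norm (A - mode_ops (ks @ [k]) P A) \<le> norm (A - mode_op k (P k) A) + norm (mode_op k (P k) (A - mode_ops ks P A))"
    using norm_triangle_ineq by metis
  also have "norm (mode_op k (P k) (A - mode_ops ks P A)) \<le> norm (A - mode_ops ks P A)"
    by (rule mode_op_proj_contraction) (use snoc.prems in auto)
  finally show ?case using snoc by fastforce
qed simp

section \<open>The approximate projection\<close>

text \<open>For \<open>X\<close> of multilinear rank exactly \<open>r\<close> these are the tangent vectors of the variety at \<open>X\<close>, written in terms
  of \<open>X\<close> itself and not of a Tucker decomposition: \<open>C \<times>\<^sub>1 P\<^sub>1 \<dots> \<times>\<^sub>d P\<^sub>d\<close> varies the core, with the columns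
  of \<open>P\<^sub>k\<close> in the column space of the unfolding of \<open>X\<close>, and \<open>X \<times>\<^sub>k B\<^sub>k\<close> varies the \<open>k\<close>-th factor. In this
  form they depend continuously on \<open>X\<close> for fixed \<open>R\<close>, \<open>B\<close> and \<open>C\<close>.\<close>

definition tangents :: "real ^ 'i \<Rightarrow> (real ^ 'i) set" where
  "tangents X = {mode_ops [0..<length n] (\<lambda>k. unf k X * R k) C + (\<Sum>k<length n. mode_op k (B k) X) |R B C.
     \<forall>k<length n. R k \<in> carrier_mat (nc k) (n ! k) \<and> B k \<in> sq k}"

text \<open>The vectors \<open>w\<close> considered here form a linear space that contains \<open>g\<close>, and its parts \<open>w0\<close> and
  \<open>X \<times>\<^sub>k N\<^sub>k\<close> are mutually orthogonal: the \<open>k\<close>-th of the latter is annihilated by \<open>P\<^sub>k\<close>, while all other parts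
  are invariant under \<open>P\<^sub>k\<close>. So the normal equations of the parts say that \<open>g\<close> is the orthogonal projection
  of \<open>A\<close> onto this space.\<close>

lemma normal_equation_inner:
  assumes P: "\<And>k. k < length n \<Longrightarrow> orth_proj_at k (P k)"
    and XP: "\<And>k. k < length n \<Longrightarrow> mode_op k (P k) X = X"
    and M: "\<And>k. k < length n \<Longrightarrow> M k \<in> sq k" and PM: "\<And>k. k < length n \<Longrightarrow> P k * M k = 0\<^sub>m (n ! k) (n ! k)"
    and normal: "\<And>k N. k < length n \<Longrightarrow> N \<in> sq k \<Longrightarrow> P k * N = 0\<^sub>m (n ! k) (n ! k) \<Longrightarrow>
      inner A (mode_op k N X) = inner (mode_op k (M k) X) (mode_op k N X)"
    and g: "g = mode_ops [0..<length n] P A + (\<Sum>k<length n. mode_op k (M k) X)"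
    and N: "\<And>k. k < length n \<Longrightarrow> N k \<in> sq k" and PN: "\<And>k. k < length n \<Longrightarrow> P k * N k = 0\<^sub>m (n ! k) (n ! k)"
    and w0: "\<And>k. k < length n \<Longrightarrow> mode_op k (P k) w0 = w0"
    and w: "w = w0 + (\<Sum>k<length n. mode_op k (N k) X)"
  shows "inner A w = inner g w"
proof -
  let ?d = "length n"
  have orth: "inner y (mode_op k K X) = 0"
    if k: "k < ?d" and y: "mode_op k (P k) y = y" and K: "K \<in> sq k" "P k * K = 0\<^sub>m (n ! k) (n ! k)" for y k K
  proof -
    have "inner y (mode_op k K X) = inner (mode_op k (P k) y) (mode_op k K X)" using y by simp
    also have "\<dots> = inner y (mode_op k (P k * K) X)"
      using mode_op_adjoint[OF k, of "P k" y "mode_op k K X"] mode_op_op[OF k, of "P k" K X] P[OF k] K by (simp add: orth_proj_at_def)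
    finally show ?thesis using K mode_op_zero[OF k] by simp
  qed
  have inv: "mode_op k (P k) (mode_op j K X) = mode_op j K X" if "k < ?d" "j < ?d" "j \<noteq> k" "K \<in> sq j" for j k K
    using mode_op_commute[of k j "P k" K X] that P[of k] XP[of k] by (simp add: orth_proj_at_def)
  have inv0: "mode_op k (P k) (mode_ops [0..<?d] P A) = mode_ops [0..<?d] P A" if "k < ?d" for k
    by (rule mode_ops_proj_invariant[OF P that])
  have a: "inner (mode_ops [0..<?d] P A) w0 = inner A w0"
  proof -
    have "inner (mode_ops [0..<?d] P A) w0 = inner A (mode_ops (rev [0..<?d]) (\<lambda>k. (P k)\<^sup>T) w0)"
      by (rule mode_ops_adjoint) (use P in \<open>auto simp: orth_proj_at_def\<close>)
    also have "mode_ops (rev [0..<?d]) (\<lambda>k. (P k)\<^sup>T) w0 = w0"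
      by (rule mode_ops_invariant) (use P w0 in \<open>auto simp: orth_proj_at_def\<close>)
    finally show ?thesis .
  qed
  have b: "inner (mode_ops [0..<?d] P A) (mode_op k (N k) X) = 0" if "k < ?d" for k
    by (rule orth) (use that inv0 N PN in auto)
  have c: "inner (mode_op k (M k) X) w0 = 0" if "k < ?d" for k
    by (subst inner_commute, rule orth) (use that w0 M PM in auto)
  have d: "inner (mode_op j (M j) X) (mode_op k (N k) X) = (if j = k then inner A (mode_op k (N k) X) else 0)"
    if "k < ?d" "j < ?d" for j k
    using orth[of k "mode_op j (M j) X" "N k"] inv[of k j "M j"] that M N PN normal[of k "N k"] by auto
  have e: "inner (\<Sum>j<?d. mode_op j (M j) X) (\<Sum>k<?d. mode_op k (N k) X) =
    (\<Sum>j<?d. \<Sum>k<?d. inner (mode_op j (M j) X) (mode_op k (N k) X))"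
    by (subst inner_sum_left, subst inner_sum_right) simp
  have "inner g w = inner (mode_ops [0..<?d] P A) w0 + (\<Sum>k<?d. inner (mode_ops [0..<?d] P A) (mode_op k (N k) X))
      + (\<Sum>k<?d. inner (mode_op k (M k) X) w0) + (\<Sum>j<?d. \<Sum>k<?d. inner (mode_op j (M j) X) (mode_op k (N k) X))"
    unfolding g w inner_add_left inner_add_right e
    by (subst inner_sum_left, subst inner_sum_right) simp
  also have "\<dots> = inner A w0 + (\<Sum>j<?d. \<Sum>k<?d. if j = k then inner A (mode_op k (N k) X) else 0)"
    using a b c d by simp
  also have "\<dots> = inner A w" unfolding w by (simp add: inner_add_right inner_sum_right)
  finally show ?thesis by simp
qed

end

lemma sum_lessThan_add_if:
  fixes f g :: "nat \<Rightarrow> real"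
  shows "(\<Sum>l<q + p. if l < q then f l else g (l - q)) = (\<Sum>l<q. f l) + (\<Sum>l<p. g l)"
  by (induction p) auto

text \<open>Turns the projection onto the column space of the block matrix \<open>[U V]\<close> into a sum of two projections.\<close>

lemma append_cols_mult_transpose:
  fixes U V :: "real mat"
  assumes U: "U \<in> carrier_mat m q" and V: "V \<in> carrier_mat m p"
  shows "mat_of_cols m (cols U @ cols V) * (mat_of_cols m (cols U @ cols V))\<^sup>T = U * U\<^sup>T + V * V\<^sup>T"
proof (rule eq_matI)
  let ?S = "mat_of_cols m (cols U @ cols V)"
  have S: "?S \<in> carrier_mat m (q + p)" using mat_of_cols_carrier(1)[of m "cols U @ cols V"] U V by simp
  fix i j assume "i < dim_row (U * U\<^sup>T + V * V\<^sup>T)" "j < dim_col (U * U\<^sup>T + V * V\<^sup>T)"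
  then have ij: "i < m" "j < m" using U V by auto
  have ent: "?S $$ (a, l) = (if l < q then U $$ (a, l) else V $$ (a, l - q))" if "a < m" "l < q + p" for a l
    using that U V by (auto simp: mat_of_cols_index nth_append)
  have "(?S * ?S\<^sup>T) $$ (i, j) = (\<Sum>l<q + p. ?S $$ (i, l) * ?S $$ (j, l))"
    using ij S by (auto simp: scalar_prod_def lessThan_atLeast0)
  also have "\<dots> = (\<Sum>l<q + p. if l < q then U $$ (i, l) * U $$ (j, l) else V $$ (i, l - q) * V $$ (j, l - q))"
    by (rule sum.cong) (use ent ij in auto)
  also have "\<dots> = (\<Sum>l<q. U $$ (i, l) * U $$ (j, l)) + (\<Sum>l<p. V $$ (i, l) * V $$ (j, l))"
    by (rule sum_lessThan_add_if)
  also have "\<dots> = (U * U\<^sup>T + V * V\<^sup>T) $$ (i, j)"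
    using ij U V by (auto simp: scalar_prod_def lessThan_atLeast0)
  finally show "(?S * ?S\<^sup>T) $$ (i, j) = (U * U\<^sup>T + V * V\<^sup>T) $$ (i, j)" .
qed (use U V in auto)

lemma idempotent_mult_complement:
  fixes P :: "real mat"
  assumes "P \<in> carrier_mat m m" "P * P = P"
  shows "P * (1\<^sub>m m - P) = 0\<^sub>m m m"
proof -
  have "P * (1\<^sub>m m - P) = P * 1\<^sub>m m - P * P"
    by (rule mult_minus_distrib_mat[of _ m m _ m]) (use assms in auto)
  then show ?thesis using assms by (simp add: minus_r_inv_mat)
qed

lemma St_D: "U \<in> St p n \<Longrightarrow> U \<in> carrier_mat n p" "U \<in> St p n \<Longrightarrow> U\<^sup>T * U = 1\<^sub>m p"
  by (auto simp: St_def)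

lemma mat_zero_mult: "(A :: real mat) \<in> carrier_mat n m \<Longrightarrow> 0\<^sub>m k n * A = 0\<^sub>m k m"
  by simp

lemma orthonormal_projection:
  assumes "U \<in> St q m" "V \<in> St p m" "U\<^sup>T * V = 0\<^sub>m q p"
  shows "(U * U\<^sup>T + V * V\<^sup>T)\<^sup>T = U * U\<^sup>T + V * V\<^sup>T"
    and "(U * U\<^sup>T + V * V\<^sup>T) * (U * U\<^sup>T + V * V\<^sup>T) = U * U\<^sup>T + V * V\<^sup>T"
    and "(U * U\<^sup>T + V * V\<^sup>T) * U = U"
proof -
  note U = St_D[OF assms(1)] and V = St_D[OF assms(2)]
  have VU: "V\<^sup>T * U = 0\<^sub>m p q"
    using arg_cong[OF assms(3), of transpose_mat] U V by (simp add: transpose_mult_dims zero_transpose_mat)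
  let ?P = "U * U\<^sup>T + V * V\<^sup>T"
  have P: "?P \<in> carrier_mat m m" using U V by auto
  show "?P\<^sup>T = ?P"
    using U(1) V(1) by (subst transpose_add[of _ m m]) (auto simp: transpose_mult_dims)
  have "?P * U = U * U\<^sup>T * U + V * V\<^sup>T * U"
    by (rule add_mult_distrib_mat[of _ m m]) (use U V in auto)
  also have "\<dots> = U * (U\<^sup>T * U) + V * (V\<^sup>T * U)" using U(1) V(1) by (simp add: mat_mult_assoc)
  finally show PU: "?P * U = U" unfolding U(2) VU using U(1) V(1) by simp
  have "?P * V = U * U\<^sup>T * V + V * V\<^sup>T * V"
    by (rule add_mult_distrib_mat[of _ m m]) (use U V in auto)
  also have "\<dots> = U * (U\<^sup>T * V) + V * (V\<^sup>T * V)" using U(1) V(1) by (simp add: mat_mult_assoc)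
  finally have PV: "?P * V = V" unfolding V(2) assms(3) using U(1) V(1) by simp
  have "?P * ?P = ?P * (U * U\<^sup>T) + ?P * (V * V\<^sup>T)"
    by (rule mult_add_distrib_mat[of _ m m]) (use U V in auto)
  also have "\<dots> = ?P * U * U\<^sup>T + ?P * V * V\<^sup>T" using U(1) V(1) by (simp add: mat_mult_assoc)
  finally show "?P * ?P = ?P" unfolding PU PV .
qed

context tensor_shape
begin

text \<open>With \<open>X = G \<times>\<^sub>j U\<^sub>j\<close> and \<open>M\<^sub>k = B\<^sub>k U\<^sub>k\<^sup>T\<close> the \<open>k\<close>-th summand \<open>G \<times>\<^sub>k B\<^sub>k \<times>\<^sub>j\<^sub>\<noteq>\<^sub>k U\<^sub>j\<close> of the approximate
  projection equals \<open>X \<times>\<^sub>k M\<^sub>k\<close>. In the core space, to which the orthonormal \<open>U\<^sub>j\<close> reduce all inner products,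
  the normal equation for \<open>E = N U\<^sub>k\<close> reads \<open>\<langle>W, E G\<^sub>k\<rangle> = \<langle>W G\<^sub>k\<^sup>\<dagger> G\<^sub>k, E G\<^sub>k\<rangle>\<close>, and this holds since \<open>G\<^sub>k\<^sup>\<dagger> G\<^sub>k\<close> is the orthogonal
  projection onto the row space of \<open>G\<^sub>k\<close>.\<close>

lemma approx_projs_structure:
  assumes g: "g \<in> approx_projs idx n r X A"
  obtains P M where
    "\<And>k. k < length n \<Longrightarrow> orth_proj_at k (P k)" "\<And>k. k < length n \<Longrightarrow> mode_op k (P k) X = X"
    "\<And>k. k < length n \<Longrightarrow> M k \<in> sq k" "\<And>k. k < length n \<Longrightarrow> P k * M k = 0\<^sub>m (n ! k) (n ! k)"
    "\<And>k N. k < length n \<Longrightarrow> N \<in> sq k \<Longrightarrow> P k * N = 0\<^sub>m (n ! k) (n ! k) \<Longrightarrow>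
      inner A (mode_op k N X) = inner (mode_op k (M k) X) (mode_op k N X)"
    "g = mode_ops [0..<length n] P A + (\<Sum>k<length n. mode_op k (M k) X)"
proof -
  define d where "d = length n"
  obtain q G U V where gq: "g = of_tensor idx (approx_proj n q G U V (T A))"
    and q: "rank_tc n (T X) = q" and X: "X = of_tensor idx (mode_prods [0..<d] U G)"
    and UV: "\<And>k. k < d \<Longrightarrow> U k \<in> St (q ! k) (n ! k) \<and> V k \<in> St (r ! k - q ! k) (n ! k) \<and>
           (U k)\<^sup>T * V k = 0\<^sub>m (q ! k) (r ! k - q ! k)"
    using g unfolding approx_projs_def d_def by blast
  have lq: "length q = d" using q by (auto simp: rank_tc_def d_def)
  note U = St_D[OF conjunct1[OF UV]]
  have V: "V k \<in> carrier_mat (n ! k) (r ! k - q ! k)" if "k < d" for k using UV[OF that] by (auto simp: St_def)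
  define others where "others k = filter (\<lambda>j. j \<noteq> k) [0..<d]" for k
  have oth: "distinct (others k)" "set (others k) = {..<d} - {k}" for k by (auto simp: others_def)
  define S where "S k = mat_of_cols (n ! k) (cols (U k) @ cols (V k))" for k
  define P where "P k = S k * (S k)\<^sup>T" for k
  have P_eq: "P k = U k * (U k)\<^sup>T + V k * (V k)\<^sup>T" if "k < d" for k
    unfolding P_def S_def by (rule append_cols_mult_transpose) (use U V that in auto)
  have Pproj: "orth_proj_at k (P k)" and PU: "P k * U k = U k" if "k < d" for k
    using orthonormal_projection[of "U k" "q ! k" "n ! k" "V k" "r ! k - q ! k"] UV[OF that] U[OF that] V[OF that]
    unfolding orth_proj_at_def P_eq[OF that] by auto
  define Tk where "Tk k B = of_tensor idx (mode_prods (others k) U (mode_prod k B G))" for k B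
  define s where "s k = q[k := n ! k]" for k
  have ls: "length (s k) = d" for k by (simp add: s_def lq)
  define W where "W k = unfold (s k) k (mode_prods (others k) (\<lambda>j. (U j)\<^sup>T) (T A))" for k
  define Gk where "Gk k = unfold q k G" for k
  define c where "c k = (\<Prod>m\<in>{..<d} - {k}. q ! m)" for k
  have Gk: "Gk k \<in> carrier_mat (q ! k) (c k)" for k by (simp add: Gk_def unfold_def c_def lq)
  have cs: "(\<Prod>m\<in>{..<d} - {k}. s k ! m) = c k" for k
    unfolding c_def by (rule prod.cong) (auto simp: s_def)
  have unf_s: "unfold (s k) k Y \<in> carrier_mat (n ! k) (c k)" if "k < d" for k Y
    using that cs[of k] by (simp add: unfold_def ls) (simp add: s_def lq)
  have W: "W k \<in> carrier_mat (n ! k) (c k)" if "k < d" for k unfolding W_def by (rule unf_s[OF that])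
  have opX: "mode_op k N X = Tk k (N * U k)" if k: "k < d" and N: "N \<in> sq k" for k N
  proof -
    have "mode_op k N X = of_tensor idx (mode_prod k N (mode_prods [0..<d] U G))"
      unfolding X by (rule mode_op_of_tensor) (use k N d_def in auto)
    also have "mode_prods [0..<d] U G = mode_prods (others k) U (mode_prod k (U k) G)"
      unfolding others_def by (rule mode_prods_extract) (use k in auto)
    also have "mode_prod k N (mode_prods (others k) U (mode_prod k (U k) G)) =
      mode_prods (others k) U (mode_prod k N (mode_prod k (U k) G))"
      by (rule mode_prods_mode_prod[symmetric]) (use oth in auto)
    also have "of_tensor idx \<dots> = Tk k (N * U k)" unfolding Tk_def
    proof (rule of_tensor_cong)
      fix i assume i: "i \<in> multi_indices n"
      show "mode_prods (others k) U (mode_prod k N (mode_prod k (U k) G)) i =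
        mode_prods (others k) U (mode_prod k (N * U k) G) i"
        by (rule mode_prods_cong_set[where S = "{i. k < length i \<and> i ! k < n ! k}"])
          (use i k N U[OF k] oth d_def in \<open>auto simp: mode_prod_mode_prod multi_indices_def nth_list_update\<close>)
    qed
    finally show ?thesis .
  qed
  have XTk: "Tk k (U k) = X" if "k < d" for k
    using opX[OF that, of "1\<^sub>m (n ! k)"] mode_op_one[of k X] U[OF that] that by (simp add: d_def)
  have tdot_Tk: "tdot n Y (mode_prods (others k) U (mode_prod k B G)) =
      fdot (unfold (s k) k (mode_prods (others k) (\<lambda>j. (U j)\<^sup>T) Y)) (B * Gk k)"
    if k: "k < d" and B: "B \<in> carrier_mat (n ! k) (q ! k)" for k B Y
  proof -
    have shape: "reshape (others k) ((!) n) (s k) = n"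
      by (rule nth_equalityI) (use k in \<open>auto simp: ls d_def[symmetric] nth_reshape oth s_def lq nth_list_update\<close>)
    have "tdot n Y (mode_prods (others k) U (mode_prod k B G)) =
      tdot (reshape (others k) ((!) n) (s k)) (mode_prods (others k) U (mode_prod k B G)) Y"
      by (simp add: shape tdot_def mult.commute)
    also have "\<dots> = tdot (s k) (mode_prod k B G) (mode_prods (rev (others k)) (\<lambda>j. (U j)\<^sup>T) Y)"
      by (rule tdot_mode_prods) (use oth U in \<open>auto simp: ls s_def lq\<close>)
    also have "\<dots> = fdot (unfold (s k) k (mode_prod k B G)) (unfold (s k) k (mode_prods (others k) (\<lambda>j. (U j)\<^sup>T) Y))"
      using k oth by (simp add: tdot_unfold ls mode_prods_rev)
    also have "unfold (s k) k (mode_prod k B G) = B * Gk k"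
      unfolding s_def Gk_def by (rule unfold_mode_prod) (use k lq B in auto)
    also have "fdot (B * Gk k) (unfold (s k) k (mode_prods (others k) (\<lambda>j. (U j)\<^sup>T) Y)) =
      fdot (unfold (s k) k (mode_prods (others k) (\<lambda>j. (U j)\<^sup>T) Y)) (B * Gk k)"
      by (rule fdot_commute) (use B Gk[of k] unf_s[OF k, of "mode_prods (others k) (\<lambda>j. (U j)\<^sup>T) Y"] in auto)
    finally show ?thesis .
  qed
  have inner_A: "inner A (Tk k B) = fdot (W k) (B * Gk k)"
    if "k < d" "B \<in> carrier_mat (n ! k) (q ! k)" for k B
    using tdot_Tk[OF that, of "T A"] by (simp add: Tk_def inner_of_tensor W_def)
  have inner_Tk: "inner (Tk k B') (Tk k B) = fdot (B' * Gk k) (B * Gk k)"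
    if k: "k < d" and B: "B \<in> carrier_mat (n ! k) (q ! k)" and B': "B' \<in> carrier_mat (n ! k) (q ! k)" for k B B'
  proof -
    let ?H = "mode_prods (others k) U (mode_prod k B' G)"
    have "inner (Tk k B') (Tk k B) = tdot n ?H (mode_prods (others k) U (mode_prod k B G))"
      unfolding inner_tdot Tk_def by (rule tdot_cong) (auto simp: to_tensor_of_tensor)
    also have "\<dots> = fdot (unfold (s k) k (mode_prods (others k) (\<lambda>j. (U j)\<^sup>T) ?H)) (B * Gk k)"
      by (rule tdot_Tk[OF k B])
    also have "unfold (s k) k (mode_prods (others k) (\<lambda>j. (U j)\<^sup>T) ?H) = unfold (s k) k (mode_prod k B' G)"
    proof (rule unfold_cong)
      fix i assume "i \<in> multi_indices (s k)"
      then have "mode_prods (rev (others k)) (\<lambda>j. (U j)\<^sup>T) ?H i = mode_prod k B' G i"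
        by (intro mode_prods_isometry_cancel[where n = "s k" and m = "(!) n"])
          (use oth U in \<open>auto simp: ls s_def lq\<close>)
      then show "mode_prods (others k) (\<lambda>j. (U j)\<^sup>T) ?H i = mode_prod k B' G i"
        using oth by (simp add: mode_prods_rev)
    qed (use k ls in auto)
    also have "\<dots> = B' * Gk k"
      unfolding s_def Gk_def by (rule unfold_mode_prod) (use k lq B' in auto)
    finally show ?thesis .
  qed
  define B where "B k = (1\<^sub>m (n ! k) - P k) * W k * pinv (Gk k)" for k
  define M where "M k = B k * (U k)\<^sup>T" for k
  have pinv: "pinv (Gk k) \<in> carrier_mat (c k) (q ! k)" "Gk k * pinv (Gk k) * Gk k = Gk k"
    "(pinv (Gk k) * Gk k)\<^sup>T = pinv (Gk k) * Gk k" for k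
    using is_pinv_pinv[of "Gk k"] Gk[of k] unfolding is_pinv_def by auto
  have Psq: "P k \<in> sq k" if "k < d" for k using Pproj[OF that] by (simp add: orth_proj_at_def)
  have B: "B k \<in> carrier_mat (n ! k) (q ! k)" if "k < d" for k
    unfolding B_def by (rule carrier_matI) (use pinv(1)[of k] W[OF that] Psq[OF that] in auto)
  have M: "M k \<in> sq k" if "k < d" for k unfolding M_def by (rule carrier_matI) (use B U that in auto)
  have MU: "M k * U k = B k" if "k < d" for k
  proof -
    have "M k * U k = B k * ((U k)\<^sup>T * U k)" using B[OF that] U[OF that] by (simp add: M_def mat_mult_assoc)
    then show ?thesis using B[OF that] U[OF that] by simp
  qed
  have PB0: "P k * (1\<^sub>m (n ! k) - P k) = 0\<^sub>m (n ! k) (n ! k)" if "k < d" for k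
    using Pproj[OF that] idempotent_mult_complement by (simp add: orth_proj_at_def)
  have PM: "P k * M k = 0\<^sub>m (n ! k) (n ! k)" if "k < d" for k
  proof -
    have "P k * M k = (P k * (1\<^sub>m (n ! k) - P k)) * (W k * pinv (Gk k) * (U k)\<^sup>T)"
      using Psq[OF that] W[OF that] pinv(1)[of k] U[OF that] by (simp add: M_def B_def mat_mult_assoc)
    also have "\<dots> = 0\<^sub>m (n ! k) (n ! k)" unfolding PB0[OF that]
      using W[OF that] pinv(1)[of k] U[OF that] by (intro mat_zero_mult[of _ _ "n ! k"]) auto
    finally show ?thesis .
  qed
  have normal: "inner A (mode_op k N X) = inner (mode_op k (M k) X) (mode_op k N X)"
    if k: "k < d" and N: "N \<in> sq k" and PN: "P k * N = 0\<^sub>m (n ! k) (n ! k)" for k N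
  proof -
    define Q where "Q = 1\<^sub>m (n ! k) - P k"
    have Qsq: "Q \<in> sq k" using Psq[OF k] unfolding Q_def by (rule minus_carrier_mat)
    have QT: "Q\<^sup>T = Q" unfolding Q_def
      using Pproj[OF k] by (subst transpose_minus[of _ "n ! k" "n ! k"]) (auto simp: orth_proj_at_def)
    have QN: "Q * N = N"
      unfolding Q_def using N PN Psq[OF k] by (subst minus_mult_distrib_mat[of _ "n ! k" "n ! k"]) auto
    define E where "E = N * U k"
    have E: "E \<in> carrier_mat (n ! k) (q ! k)" using N U[OF k] by (simp add: E_def)
    have QE: "Q * E = E" using QN N U[OF k] Qsq unfolding E_def by (metis assoc_mult_mat)
    note cc = Qsq E Gk[of k] pinv(1)[of k] W[OF k]
    have "fdot (B k * Gk k) (E * Gk k) = fdot (Q * (W k * pinv (Gk k) * Gk k)) (E * Gk k)"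
      using cc Psq[OF k] by (simp add: B_def Q_def[symmetric] mat_mult_assoc)
    also have "\<dots> = fdot (W k * pinv (Gk k) * Gk k) (Q\<^sup>T * (E * Gk k))"
      by (rule fdot_mult_left[of _ "n ! k" "n ! k" _ "c k"]) (use cc in auto)
    also have "Q\<^sup>T * (E * Gk k) = (Q * E) * Gk k" unfolding QT using cc by (simp add: mat_mult_assoc)
    also have "\<dots> = E * Gk k" by (simp only: QE)
    also have "W k * pinv (Gk k) * Gk k = W k * (pinv (Gk k) * Gk k)" using cc by (simp add: mat_mult_assoc)
    also have "fdot (W k * (pinv (Gk k) * Gk k)) (E * Gk k) = fdot (W k) ((E * Gk k) * (pinv (Gk k) * Gk k)\<^sup>T)"
      by (rule fdot_mult_right[of _ "n ! k" "c k" _ "c k"]) (use cc in auto)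
    also have "(E * Gk k) * (pinv (Gk k) * Gk k)\<^sup>T = E * (Gk k * pinv (Gk k) * Gk k)"
      unfolding pinv(3) using cc by (simp add: mat_mult_assoc)
    also have "\<dots> = E * Gk k" by (simp only: pinv(2))
    finally have "fdot (B k * Gk k) (E * Gk k) = fdot (W k) (E * Gk k)" .
    then show ?thesis
      using opX[OF k N] opX[OF k M[OF k]] inner_A[OF k E] inner_Tk[OF k E B[OF k]] MU[OF k] by (simp add: E_def)
  qed
  have PX: "mode_op k (P k) X = X" if "k < d" for k
    using opX[OF that Psq[OF that]] PU[OF that] XTk[OF that] by simp
  have geq: "g = mode_ops [0..<d] P A + (\<Sum>k<d. mode_op k (M k) X)"
  proof -
    have "g = of_tensor idx (\<lambda>i. mode_prods [0..<d] P (T A) i + (\<Sum>k<d. mode_prods (others k) U (mode_prod k (B k) G) i))"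
      unfolding gq approx_proj_def Let_def B_def W_def s_def Gk_def P_def S_def others_def d_def ..
    also have "\<dots> = of_tensor idx (mode_prods [0..<d] P (T A)) + (\<Sum>k<d. Tk k (B k))"
      by (simp add: of_tensor_def Finite_Cartesian_Product.vec_eq_iff Tk_def)
    also have "of_tensor idx (mode_prods [0..<d] P (T A)) = mode_ops [0..<d] P A"
      by (subst of_tensor_mode_prods) (use Psq in \<open>auto simp: d_def of_tensor_to_tensor\<close>)
    also have "(\<Sum>k<d. Tk k (B k)) = (\<Sum>k<d. mode_op k (M k) X)"
      by (rule sum.cong) (use opX M MU in auto)
    finally show ?thesis .
  qed
  show ?thesis
    by (rule that[of P M]) (use Pproj PX M PM normal geq in \<open>auto simp: d_def\<close>)
qed

lemma approx_projs_inner_self: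
  assumes "g \<in> approx_projs idx n r X A"
  shows "inner A g = (norm g)\<^sup>2"
proof -
  obtain P M where *:
    "\<And>k. k < length n \<Longrightarrow> orth_proj_at k (P k)" "\<And>k. k < length n \<Longrightarrow> mode_op k (P k) X = X"
    "\<And>k. k < length n \<Longrightarrow> M k \<in> sq k" "\<And>k. k < length n \<Longrightarrow> P k * M k = 0\<^sub>m (n ! k) (n ! k)"
    "\<And>k N. k < length n \<Longrightarrow> N \<in> sq k \<Longrightarrow> P k * N = 0\<^sub>m (n ! k) (n ! k) \<Longrightarrow>
      inner A (mode_op k N X) = inner (mode_op k (M k) X) (mode_op k N X)"
    "g = mode_ops [0..<length n] P A + (\<Sum>k<length n. mode_op k (M k) X)"
    using approx_projs_structure[OF assms] by blast
  have "inner A g = inner g g"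
    by (rule normal_equation_inner[where P = P and M = M and N = M, OF *(1-6) *(3,4) mode_ops_proj_invariant[OF *(1)] *(6)])
  then show ?thesis by (simp add: power2_norm_eq_inner)
qed

text \<open>Split \<open>B\<^sub>k = P\<^sub>k B\<^sub>k + (1 - P\<^sub>k) B\<^sub>k\<close>. The first part moves \<open>X\<close> inside the common range of the \<open>P\<^sub>k\<close>, the
  second one is of the kind for which the normal equation holds.\<close>

lemma approx_projs_inner_tangents:
  assumes g: "g \<in> approx_projs idx n r X A" and v: "v \<in> tangents X"
  shows "inner A v = inner g v"
proof -
  let ?d = "length n"
  obtain P M where *:
    "\<And>k. k < length n \<Longrightarrow> orth_proj_at k (P k)" "\<And>k. k < length n \<Longrightarrow> mode_op k (P k) X = X"
    "\<And>k. k < length n \<Longrightarrow> M k \<in> sq k" "\<And>k. k < length n \<Longrightarrow> P k * M k = 0\<^sub>m (n ! k) (n ! k)"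
    "\<And>k N. k < length n \<Longrightarrow> N \<in> sq k \<Longrightarrow> P k * N = 0\<^sub>m (n ! k) (n ! k) \<Longrightarrow>
      inner A (mode_op k N X) = inner (mode_op k (M k) X) (mode_op k N X)"
    "g = mode_ops [0..<length n] P A + (\<Sum>k<length n. mode_op k (M k) X)"
    using approx_projs_structure[OF g] by blast
  obtain R B C where v: "v = mode_ops [0..<?d] (\<lambda>k. unf k X * R k) C + (\<Sum>k<?d. mode_op k (B k) X)"
    and R: "\<And>k. k < ?d \<Longrightarrow> R k \<in> carrier_mat (nc k) (n ! k)" and B: "\<And>k. k < ?d \<Longrightarrow> B k \<in> sq k"
    using v unfolding tangents_def by blast
  have Psq: "P k \<in> sq k" if "k < ?d" for k using *(1)[OF that] by (simp add: orth_proj_at_def)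
  define Q where "Q k = 1\<^sub>m (n ! k) - P k" for k
  have Qsq: "Q k \<in> sq k" if "k < ?d" for k using Psq[OF that] unfolding Q_def by (rule minus_carrier_mat)
  \<comment> \<open>the component that leaves the range of \<open>P k\<close>\<close>
  define N where "N k = Q k * B k" for k
  have N: "N k \<in> sq k" if "k < ?d" for k using Qsq[OF that] B[OF that] by (simp add: N_def)
  have PQ: "P k * Q k = 0\<^sub>m (n ! k) (n ! k)" if "k < ?d" for k
    using *(1)[OF that] idempotent_mult_complement by (simp add: orth_proj_at_def Q_def)
  have PN: "P k * N k = 0\<^sub>m (n ! k) (n ! k)" if "k < ?d" for k
  proof -
    have "P k * N k = P k * Q k * B k" using Psq[OF that] Qsq[OF that] B[OF that] by (simp add: N_def mat_mult_assoc)
    then show ?thesis unfolding PQ[OF that] using B[OF that] by simp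
  qed
  define v0 where "v0 = mode_ops [0..<?d] (\<lambda>k. unf k X * R k) C"
  define w0 where "w0 = v0 + (\<Sum>k<?d. mode_op k (P k * B k) X)"
  have PunfX: "P k * unf k X = unf k X" if "k < ?d" for k
    using unf_mode_op[OF that Psq[OF that], of X] *(2)[OF that] by simp
  have inv0: "mode_op k (P k) v0 = v0" if k: "k < ?d" for k
  proof -
    have sq: "unf j X * R j \<in> sq j" if "j < ?d" for j using R[OF that] unf_carrier[of j X] by simp
    obtain Y where Y: "v0 = mode_op k (unf k X * R k) Y"
      using mode_ops_extract[of "[0..<?d]" "\<lambda>k. unf k X * R k" k C] k sq unfolding v0_def by auto
    have "mode_op k (P k) v0 = mode_op k (P k * (unf k X * R k)) Y"
      unfolding Y by (rule mode_op_op) (use k Psq sq in auto)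
    also have "P k * (unf k X * R k) = P k * unf k X * R k"
      using Psq[OF k] R[OF k] by (simp add: mat_mult_assoc)
    finally show ?thesis unfolding PunfX[OF k] Y .
  qed
  have inv1: "mode_op k (P k) (mode_op j (P j * B j) X) = mode_op j (P j * B j) X" if "k < ?d" "j < ?d" for j k
  proof (cases "j = k")
    case True
    have "P k * (P k * B k) = P k * P k * B k" using Psq[OF that(1)] B[OF that(1)] by (simp add: mat_mult_assoc)
    then have "P k * (P k * B k) = P k * B k" using *(1)[OF that(1)] by (simp add: orth_proj_at_def)
    then show ?thesis using True mode_op_op[OF that(1), of "P k" "P k * B k" X] Psq[OF that(1)] B[OF that(1)] by simp
  next
    case False
    then show ?thesis using mode_op_commute[of k j "P k" "P j * B j" X] *(2)[OF that(1)] Psq[OF that(1)] Psq[OF that(2)] B[OF that(2)] that by simp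
  qed
  have w0: "mode_op k (P k) w0 = w0" if "k < ?d" for k
    using inv0 inv1 that by (simp add: w0_def mode_op_add mode_op_sum)
  have "mode_op k (B k) X = mode_op k (P k * B k) X + mode_op k (N k) X" if k: "k < ?d" for k
  proof -
    have "N k = B k - P k * B k" unfolding N_def Q_def
      using B[OF k] Psq[OF k] by (subst minus_mult_distrib_mat[of _ "n ! k" "n ! k"]) auto
    then show ?thesis using mode_op_mat_diff[OF k B[OF k], of "P k * B k" X] Psq[OF k] B[OF k] by simp
  qed
  then have "v = w0 + (\<Sum>k<?d. mode_op k (N k) X)"
    by (simp add: v w0_def v0_def sum.distrib add.assoc)
  then show ?thesis
    by (intro normal_equation_inner[where P = P and M = M and N = N, OF *(1-6) N PN w0])
qed

end

section \<open>Truncated singular value decompositions\<close>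

text \<open>The identity matrix, cut off or extended by zeros to \<open>n\<close> rows and \<open>p\<close> columns; multiplication by it
  selects leading rows or columns.\<close>

definition eye :: "nat \<Rightarrow> nat \<Rightarrow> real mat" where
  "eye n p = Matrix.mat n p (\<lambda>(i, j). if i = j then 1 else 0)"

lemma eye_carrier [simp]: "eye n p \<in> carrier_mat n p" "dim_row (eye n p) = n" "dim_col (eye n p) = p"
  by (simp_all add: eye_def)

lemma eye_transpose: "(eye n p)\<^sup>T = eye p n"
  by (rule eq_matI) (auto simp: eye_def)

lemma eye_mult:
  assumes M: "M \<in> carrier_mat p m"
  shows "eye n p * M = Matrix.mat n m (\<lambda>(i, j). if i < p then M $$ (i, j) else 0)"
proof (rule eq_matI)
  fix i j assume "i < dim_row (Matrix.mat n m (\<lambda>(i, j). if i < p then M $$ (i, j) else 0))"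
    "j < dim_col (Matrix.mat n m (\<lambda>(i, j). if i < p then M $$ (i, j) else 0))"
  then have ij: "i < n" "j < m" by auto
  have "(eye n p * M) $$ (i, j) = (\<Sum>l = 0..<p. eye n p $$ (i, l) * M $$ (l, j))"
    using ij M by (simp add: scalar_prod_def)
  also have "\<dots> = (\<Sum>l = 0..<p. if l = i then M $$ (i, j) else 0)"
    by (rule sum.cong) (use ij in \<open>auto simp: eye_def\<close>)
  finally show "(eye n p * M) $$ (i, j) = Matrix.mat n m (\<lambda>(i, j). if i < p then M $$ (i, j) else 0) $$ (i, j)"
    using ij by simp
qed (use M in auto)

lemma eye_transpose_mult:
  assumes "M \<in> carrier_mat n m" "p \<le> n"
  shows "(eye n p)\<^sup>T * M = Matrix.mat p m (\<lambda>(i, j). M $$ (i, j))"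
  unfolding eye_transpose eye_mult[OF assms(1)] by (rule cong_mat) (use assms in auto)

text \<open>More rows than columns: completed by zero columns to a square matrix, \<open>N\<close> is singular.\<close>

lemma tall_left_kernel:
  fixes N :: "real mat"
  assumes N: "N \<in> carrier_mat (Suc p) q" and q: "q \<le> p"
  obtains c where "c \<in> carrier_mat (Suc p) 1" "c \<noteq> 0\<^sub>m (Suc p) 1" "c\<^sup>T * N = 0\<^sub>m 1 q"
proof -
  define I where "I = eye q (Suc p)"
  have I: "I \<in> carrier_mat q (Suc p)" by (simp add: I_def)
  have II: "I * I\<^sup>T = 1\<^sub>m q"
    unfolding I_def eye_transpose
    by (subst eye_mult[of _ _ q]) (use q in \<open>auto simp: eye_def intro!: eq_matI\<close>)
  have NI: "N * I \<in> carrier_mat (Suc p) (Suc p)" using N I by simp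
  have "vec_space.rank (Suc p) (N * I) \<le> q"
    using rank_mult_le[OF N I] N by simp
  then have "vec_space.rank (Suc p) (N * I) \<noteq> Suc p" using q by linarith
  then have "Determinant.det (N * I) = 0" using vec_space.det_rank_iff[OF NI] by blast
  then have "Determinant.det (N * I)\<^sup>T = 0" using det_transpose[OF NI] by simp
  then obtain v where v: "v \<in> carrier_vec (Suc p)" "v \<noteq> 0\<^sub>v (Suc p)" "(N * I)\<^sup>T *\<^sub>v v = 0\<^sub>v (Suc p)"
    using det_0_iff_vec_prod_zero_field[of "(N * I)\<^sup>T" "Suc p"] NI by auto
  define c where "c = Matrix.mat (Suc p) 1 (\<lambda>(i, j). vec_index v i)"
  have c: "c \<in> carrier_mat (Suc p) 1" by (simp add: c_def)
  have c0: "c \<noteq> 0\<^sub>m (Suc p) 1"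
  proof
    assume 0: "c = 0\<^sub>m (Suc p) 1"
    have "v = 0\<^sub>v (Suc p)"
    proof (rule eq_vecI)
      fix i assume "i < dim_vec (0\<^sub>v (Suc p) :: real Matrix.vec)"
      then have i: "i < Suc p" by simp
      have "c $$ (i, 0) = (0\<^sub>m (Suc p) 1 :: real mat) $$ (i, 0)" using 0 by simp
      then show "vec_index v i = vec_index (0\<^sub>v (Suc p)) i" using i by (simp add: c_def)
    qed (use v in auto)
    then show False using v by simp
  qed
  have "c\<^sup>T * (N * I) = 0\<^sub>m 1 (Suc p)"
  proof (rule eq_matI)
    fix i j assume ij: "i < dim_row (0\<^sub>m 1 (Suc p) :: real mat)" "j < dim_col (0\<^sub>m 1 (Suc p) :: real mat)"
    then have i: "i = 0" and j: "j < Suc p" by auto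
    define K where "K = N * I"
    have K: "K \<in> carrier_mat (Suc p) (Suc p)" using NI by (simp add: K_def)
    have "(c\<^sup>T * K) $$ (i, j) = vec_index (K\<^sup>T *\<^sub>v v) j"
      using i j c K v by (simp add: scalar_prod_def c_def mult.commute)
    then have "(c\<^sup>T * (N * I)) $$ (i, j) = vec_index ((N * I)\<^sup>T *\<^sub>v v) j" by (simp only: K_def)
    then show "(c\<^sup>T * (N * I)) $$ (i, j) = 0\<^sub>m 1 (Suc p) $$ (i, j)" using ij v by simp
  qed (use c NI in auto)
  then have "c\<^sup>T * (N * I) * I\<^sup>T = 0\<^sub>m 1 q" using I by simp
  moreover have "c\<^sup>T * (N * I) * I\<^sup>T = c\<^sup>T * (N * (I * I\<^sup>T))" using c N I by (simp add: mat_mult_assoc)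
  ultimately have "c\<^sup>T * N = 0\<^sub>m 1 q" using N by (simp add: II)
  then show ?thesis using that c c0 by blast
qed

lemma fdot_isometry_left:
  assumes "Q \<in> carrier_mat n p" "Q\<^sup>T * Q = 1\<^sub>m p" "M \<in> carrier_mat p m"
  shows "fdot (Q * M) (Q * M) = fdot M M"
proof -
  have "fdot (Q * M) (Q * M) = fdot M (Q\<^sup>T * (Q * M))"
    by (rule fdot_mult_left) (use assms in auto)
  also have "Q\<^sup>T * (Q * M) = Q\<^sup>T * Q * M" using assms(1,3) by (simp add: mat_mult_assoc)
  finally show ?thesis using assms by simp
qed

lemma fdot_isometry_right:
  assumes "Q \<in> carrier_mat n p" "Q\<^sup>T * Q = 1\<^sub>m p" "M \<in> carrier_mat m p"
  shows "fdot (M * Q\<^sup>T) (M * Q\<^sup>T) = fdot M M"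
proof -
  have "fdot (M * Q\<^sup>T) (M * Q\<^sup>T) = fdot M (M * Q\<^sup>T * (Q\<^sup>T)\<^sup>T)"
    by (rule fdot_mult_right[of _ m p]) (use assms in auto)
  also have "M * Q\<^sup>T * (Q\<^sup>T)\<^sup>T = M * (Q\<^sup>T * Q)" using assms(1,3) by (simp add: mat_mult_assoc)
  finally show ?thesis using assms by simp
qed

lemma fdot_self: "fdot M M = (\<Sum>i<dim_row M. \<Sum>j<dim_col M. (M $$ (i, j))\<^sup>2)"
  by (simp add: fdot_def power2_eq_square)

lemma fdot_self_nonneg: "0 \<le> fdot M M"
  by (simp add: fdot_self sum_nonneg)

lemma fdot_row_mult_le:
  assumes z: "z \<in> carrier_mat n 1" and B: "B \<in> carrier_mat n m"
  shows "fdot (z\<^sup>T * B) (z\<^sup>T * B) \<le> fdot z z * fdot B B"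
proof -
  have "fdot (z\<^sup>T * B) (z\<^sup>T * B) = (\<Sum>j<m. (\<Sum>i<n. z $$ (i, 0) * B $$ (i, j))\<^sup>2)"
    using z B by (simp add: fdot_self scalar_prod_def lessThan_atLeast0)
  also have "\<dots> \<le> (\<Sum>j<m. (\<Sum>i<n. (z $$ (i, 0))\<^sup>2) * (\<Sum>i<n. (B $$ (i, j))\<^sup>2))"
    by (intro sum_mono Cauchy_Schwarz_ineq_sum)
  also have "\<dots> = fdot z z * fdot B B"
    using z B sum.swap[of "\<lambda>i j. (B $$ (i, j))\<^sup>2" "{..<m}" "{..<n}"]
    by (subst sum_distrib_left[symmetric]) (simp add: fdot_self)
  finally show ?thesis .
qed

lemma eye_gram: "p \<le> n \<Longrightarrow> (eye n p)\<^sup>T * eye n p = 1\<^sub>m p"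
  by (subst eye_transpose_mult[of _ n p]) (auto simp: eye_def intro!: eq_matI)

lemma first_cols_eq_mult_eye:
  assumes W: "W \<in> carrier_mat n m" and p: "p \<le> m"
  shows "mat_of_cols n (map (col W) [0..<p]) = W * eye m p"
proof (rule eq_matI)
  fix i j assume "i < dim_row (W * eye m p)" "j < dim_col (W * eye m p)"
  then have ij: "i < n" "j < p" using W by auto
  have "(W * eye m p) $$ (i, j) = (\<Sum>l = 0..<m. W $$ (i, l) * eye m p $$ (l, j))"
    using ij W by (simp add: scalar_prod_def)
  also have "\<dots> = (\<Sum>l = 0..<m. if l = j then W $$ (i, j) else 0)"
    by (rule sum.cong) (use ij p in \<open>auto simp: eye_def\<close>)
  finally have "(W * eye m p) $$ (i, j) = W $$ (i, j)" using ij p by simp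
  then show "mat_of_cols n (map (col W) [0..<p]) $$ (i, j) = (W * eye m p) $$ (i, j)"
    using ij W p by (simp add: mat_of_cols_index)
qed (use W in auto)

lemma leading_left_singular_vectors_St:
  assumes "leading_left_singular_vectors p A U"
  shows "U \<in> St p (dim_row A)"
proof -
  obtain W S V where p: "p \<le> dim_row A" and svd: "svd A W S V"
    and U: "U = mat_of_cols (dim_row A) (map (col W) [0..<p])"
    using assms by (auto simp: leading_left_singular_vectors_def)
  define n where "n = dim_row A"
  have "W \<in> St n n" using svd unfolding svd_def n_def by blast
  note W = St_D[OF this]
  have U: "U = W * eye n p" unfolding U n_def[symmetric] by (rule first_cols_eq_mult_eye) (use W p n_def in auto)
  have "(W * eye n p)\<^sup>T * (W * eye n p) = (eye n p)\<^sup>T * (W\<^sup>T * W) * eye n p"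
    using W(1) by (simp add: transpose_mult_dims mat_mult_assoc)
  also have "\<dots> = (eye n p)\<^sup>T * eye n p" unfolding W(2) by (simp add: eye_transpose)
  also have "\<dots> = 1\<^sub>m p" by (rule eye_gram) (use p n_def in simp)
  finally have "(W * eye n p)\<^sup>T * (W * eye n p) = 1\<^sub>m p" .
  moreover have "W * eye n p \<in> carrier_mat n p" using W(1) by simp
  ultimately show ?thesis unfolding U St_def n_def by blast
qed

text \<open>Some combination \<open>z \<noteq> 0\<close> of the first \<open>p + 1\<close> left singular vectors annihilates \<open>X\<close>, as the rank of \<open>X\<close> is
  at most \<open>p\<close>. Hence \<open>\<sigma>\<^sub>p |z| \<le> |z\<^sup>T A| = |z\<^sup>T (A - X)| \<le> |z| |A - X|\<close> with \<open>\<sigma>\<^sub>p\<close> the largest of the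
  discarded singular values, of which there are at most \<open>n\<close>. The Eckart--Young theorem has 1 in place
  of the constant \<open>n\<close>; for the length of a step any constant will do.\<close>

lemma svd_truncation_error:
  assumes lead: "leading_left_singular_vectors p A U"
    and A: "A \<in> carrier_mat n m" and X: "X \<in> carrier_mat n m" and rX: "mat_rank X \<le> p"
  shows "fdot (A - U * U\<^sup>T * A) (A - U * U\<^sup>T * A) \<le> real n * fdot (A - X) (A - X)"
proof -
  obtain W S V where p: "p \<le> n" and svd: "svd A W S V"
    and U: "U = mat_of_cols n (map (col W) [0..<p])"
    using lead A by (auto simp: leading_left_singular_vectors_def)
  have W: "W \<in> carrier_mat n n" "W\<^sup>T * W = 1\<^sub>m n" and V: "V \<in> carrier_mat m m" "V\<^sup>T * V = 1\<^sub>m m"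
    and S: "S \<in> carrier_mat n m" and AWSV: "A = W * S * V\<^sup>T"
    and offdiag: "\<And>i j. i < n \<Longrightarrow> j < m \<Longrightarrow> i \<noteq> j \<Longrightarrow> S $$ (i, j) = 0"
    and nonneg: "\<And>i. i < min n m \<Longrightarrow> 0 \<le> S $$ (i, i)"
    and sorted: "\<And>i j. j < min n m \<Longrightarrow> i \<le> j \<Longrightarrow> S $$ (j, j) \<le> S $$ (i, i)"
    using svd A by (auto simp: svd_def St_def)
  have U: "U = W * eye n p" unfolding U by (rule first_cols_eq_mult_eye) (use W p in auto)
  define S' where "S' = S - eye n p * ((eye n p)\<^sup>T * S)"
  have S': "S' \<in> carrier_mat n m" unfolding S'_def by (intro minus_carrier_mat mult_carrier_mat[of _ n p]) (use S in \<open>auto intro: mult_carrier_mat\<close>)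
  have S'_ent: "S' $$ (i, j) = (if i < p then 0 else S $$ (i, j))" if "i < n" "j < m" for i j
    using that S p unfolding S'_def
    by (subst eye_transpose_mult[OF S p], subst eye_mult[of _ p m]) auto
  have "U * U\<^sup>T * A = W * eye n p * ((eye n p)\<^sup>T * ((W\<^sup>T * W) * S)) * V\<^sup>T"
    unfolding U AWSV using W(1) S V(1) by (simp add: transpose_mult_dims mat_mult_assoc)
  also have "\<dots> = W * (eye n p * ((eye n p)\<^sup>T * S)) * V\<^sup>T"
    unfolding W(2) using W(1) S V(1) by (simp add: mat_mult_assoc)
  finally have "A - U * U\<^sup>T * A = W * S * V\<^sup>T - W * (eye n p * ((eye n p)\<^sup>T * S)) * V\<^sup>T"
    using AWSV by simp
  also have "\<dots> = (W * S - W * (eye n p * ((eye n p)\<^sup>T * S))) * V\<^sup>T"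
    by (rule minus_mult_distrib_mat[symmetric, of _ n m]) (use W S V in auto)
  also have "W * S - W * (eye n p * ((eye n p)\<^sup>T * S)) = W * S'" unfolding S'_def
    by (rule mult_minus_distrib_mat[symmetric, of _ n n]) (use W S in auto)
  finally have "fdot (A - U * U\<^sup>T * A) (A - U * U\<^sup>T * A) = fdot (W * S' * V\<^sup>T) (W * S' * V\<^sup>T)" by simp
  also have "\<dots> = fdot (W * S') (W * S')" by (rule fdot_isometry_right) (use V W S' in auto)
  also have "\<dots> = fdot S' S'" by (rule fdot_isometry_left) (use W S' in auto)
  finally have err: "fdot (A - U * U\<^sup>T * A) (A - U * U\<^sup>T * A) = fdot S' S'" .
  show ?thesis
  proof (cases "p < min n m")
    case False
    have "S' $$ (i, j) = 0" if "i < n" "j < m" for i j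
      using S'_ent[OF that] offdiag[OF that] that False by (cases "i = j") auto
    then have "fdot S' S' = 0" using S' by (simp add: fdot_self)
    then show ?thesis using err fdot_self_nonneg[of "A - X"] by simp
  next
    case True
    \<comment> \<open>the largest discarded singular value, as indices start from 0\<close>
  define \<sigma> where "\<sigma> = S $$ (p, p)"
    have \<sigma>0: "0 \<le> \<sigma>" using nonneg True by (simp add: \<sigma>_def)
    have rowb: "(\<Sum>j<m. (S' $$ (i, j))\<^sup>2) \<le> \<sigma>\<^sup>2" if i: "i < n" for i
    proof -
      have "(\<Sum>j<m. (S' $$ (i, j))\<^sup>2) = (\<Sum>j<m. if j = i then (S' $$ (i, i))\<^sup>2 else 0)"
        by (rule sum.cong) (use S'_ent[OF i] offdiag[OF i] in auto)
      also have "\<dots> = (if i < m then (S' $$ (i, i))\<^sup>2 else 0)" by simp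
      also have "\<dots> \<le> \<sigma>\<^sup>2"
        using S'_ent[OF i, of i] sorted[of i p] nonneg[of i] i \<sigma>0 by (auto simp: \<sigma>_def intro!: power_mono)
      finally show ?thesis .
    qed
    have "fdot S' S' = (\<Sum>i<n. \<Sum>j<m. (S' $$ (i, j))\<^sup>2)" using S' by (simp add: fdot_self)
    also have "\<dots> \<le> (\<Sum>i<n. \<sigma>\<^sup>2)" by (rule sum_mono) (use rowb in auto)
    finally have up: "fdot S' S' \<le> real n * \<sigma>\<^sup>2" by simp
    define q where "q = mat_rank X"
    obtain C D where CD: "C \<in> carrier_mat n q" "D \<in> carrier_mat q m" "X = C * D"
      using rank_factorization[OF X q_def] by metis
    define J where "J = eye n (Suc p)"
    have J: "J \<in> carrier_mat n (Suc p)" and JJ: "J\<^sup>T * J = 1\<^sub>m (Suc p)"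
      using True eye_gram[of "Suc p" n] by (auto simp: J_def)
    have "J\<^sup>T * W\<^sup>T * C \<in> carrier_mat (Suc p) q" using J W CD by simp
    from tall_left_kernel[OF this] rX obtain c where
      c: "c \<in> carrier_mat (Suc p) 1" "c \<noteq> 0\<^sub>m (Suc p) 1" and c0: "c\<^sup>T * (J\<^sup>T * W\<^sup>T * C) = 0\<^sub>m 1 q"
      unfolding q_def by blast
    define y where "y = J * c"
    define z where "z = W * y"
    have y: "y \<in> carrier_mat n 1" and z: "z \<in> carrier_mat n 1" using J W c by (auto simp: y_def z_def)
    have y_ent: "y $$ (i, 0) = (if i < Suc p then c $$ (i, 0) else 0)" if "i < n" for i
      using that True c unfolding y_def J_def by (subst eye_mult[of _ "Suc p" 1]) auto
    have "z\<^sup>T * X = (c\<^sup>T * (J\<^sup>T * W\<^sup>T * C)) * D"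
      using J W(1) c(1) CD by (simp add: z_def y_def transpose_mult_dims mat_mult_assoc)
    then have zX: "z\<^sup>T * X = 0\<^sub>m 1 m" unfolding c0 using CD by simp
    have "z\<^sup>T * (A - X) = z\<^sup>T * A - z\<^sup>T * X"
      by (rule mult_minus_distrib_mat[of _ 1 n]) (use z A X in auto)
    also have "\<dots> = z\<^sup>T * A" unfolding zX using z A by (intro eq_matI) auto
    also have "\<dots> = y\<^sup>T * (W\<^sup>T * W) * S * V\<^sup>T" using y W(1) S V(1) by (simp add: AWSV z_def transpose_mult_dims mat_mult_assoc)
    also have "\<dots> = (y\<^sup>T * S) * V\<^sup>T" unfolding W(2) using y S V(1) by (simp add: mat_mult_assoc)
    finally have "fdot (z\<^sup>T * (A - X)) (z\<^sup>T * (A - X)) = fdot (y\<^sup>T * S) (y\<^sup>T * S)"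
      using fdot_isometry_right[OF V, of "y\<^sup>T * S" 1] y S by simp
    moreover have "fdot (z\<^sup>T * (A - X)) (z\<^sup>T * (A - X)) \<le> fdot z z * fdot (A - X) (A - X)"
      by (rule fdot_row_mult_le[OF z, of _ m]) (use X in auto)
    moreover have "fdot z z = fdot y y" unfolding z_def by (rule fdot_isometry_left) (use W y in auto)
    moreover have "\<sigma>\<^sup>2 * fdot y y \<le> fdot (y\<^sup>T * S) (y\<^sup>T * S)"
    proof -
      have ent: "(y\<^sup>T * S) $$ (0, j) = (if j < n then y $$ (j, 0) * S $$ (j, j) else 0)" if j: "j < m" for j
      proof -
        have "(y\<^sup>T * S) $$ (0, j) = (\<Sum>i<n. y $$ (i, 0) * S $$ (i, j))"
          using y S j by (simp add: scalar_prod_def lessThan_atLeast0)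
        also have "\<dots> = (\<Sum>i<n. if i = j then y $$ (j, 0) * S $$ (j, j) else 0)"
          by (rule sum.cong) (use offdiag j in auto)
        finally show ?thesis by simp
      qed
      have "\<sigma>\<^sup>2 * fdot y y = (\<Sum>i<n. \<sigma>\<^sup>2 * (y $$ (i, 0))\<^sup>2)"
        using y by (simp add: fdot_self sum_distrib_left)
      also have "\<dots> = (\<Sum>i<Suc p. \<sigma>\<^sup>2 * (y $$ (i, 0))\<^sup>2)"
        by (rule sum.mono_neutral_right) (use y_ent True in auto)
      also have "\<dots> \<le> (\<Sum>i<Suc p. ((y\<^sup>T * S) $$ (0, i))\<^sup>2)"
      proof (rule sum_mono)
        fix i assume i: "i \<in> {..<Suc p}"
        have "\<sigma>\<^sup>2 \<le> (S $$ (i, i))\<^sup>2"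
          using sorted[of p i] True i \<sigma>0 unfolding \<sigma>_def by (intro power_mono) auto
        then have "\<sigma>\<^sup>2 * (y $$ (i, 0))\<^sup>2 \<le> (S $$ (i, i))\<^sup>2 * (y $$ (i, 0))\<^sup>2" by (intro mult_right_mono) auto
        then show "\<sigma>\<^sup>2 * (y $$ (i, 0))\<^sup>2 \<le> ((y\<^sup>T * S) $$ (0, i))\<^sup>2"
          using ent[of i] i True by (simp add: power_mult_distrib mult.commute)
      qed
      also have "\<dots> \<le> (\<Sum>i<m. ((y\<^sup>T * S) $$ (0, i))\<^sup>2)"
        by (rule sum_mono2) (use True in auto)
      also have "\<dots> = fdot (y\<^sup>T * S) (y\<^sup>T * S)" using y S by (simp add: fdot_self)
      finally show ?thesis .
    qed
    ultimately have "\<sigma>\<^sup>2 * fdot y y \<le> fdot (A - X) (A - X) * fdot y y" by (simp add: mult.commute)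
    moreover have "0 < fdot y y"
    proof -
      have "\<exists>i<Suc p. c $$ (i, 0) \<noteq> 0"
      proof (rule ccontr)
        assume "\<not> ?thesis"
        then have "c = 0\<^sub>m (Suc p) 1" using c(1) by (intro eq_matI) auto
        then show False using c by simp
      qed
      then obtain i where i: "i < Suc p" "c $$ (i, 0) \<noteq> 0" by blast
      have "0 < (y $$ (i, 0))\<^sup>2" using y_ent[of i] i True by simp
      also have "\<dots> \<le> (\<Sum>i<n. (y $$ (i, 0))\<^sup>2)" by (rule member_le_sum) (use i True in auto)
      finally show ?thesis using y by (simp add: fdot_self)
    qed
    ultimately have "\<sigma>\<^sup>2 \<le> fdot (A - X) (A - X)" by simp
    then have "real n * \<sigma>\<^sup>2 \<le> real n * fdot (A - X) (A - X)" by (intro mult_left_mono) auto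
    then show ?thesis using up err by simp
  qed
qed

lemma sum_list_real_mult: "(\<Sum>x\<leftarrow>xs. real x * c) = real (sum_list xs) * c"
  by (induction xs) (auto simp: algebra_simps)

context tensor_shape
begin

lemma tucker_variety_iff:
  assumes "length r = length n"
  shows "Z \<in> tucker_variety idx n r \<longleftrightarrow> (\<forall>k<length n. mat_rank (unf k Z) \<le> r ! k)"
  using assms by (auto simp: tucker_variety_def rank_tc_def list_all2_conv_all_nth)

text \<open>Commuting the \<open>k\<close>-th projection to the outside bounds the \<open>k\<close>-th rank; the error is at most the
  sum of the truncation errors of the modes.\<close>

lemma hosvd_properties:
  assumes r: "length r = length n" and Y: "Y \<in> hosvd idx n r A"
  shows hosvd_in_variety: "Y \<in> tucker_variety idx n r"
    and hosvd_error: "X \<in> tucker_variety idx n r \<Longrightarrow> norm (A - Y) \<le> real (sum_list n) * norm (A - X)"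
proof -
  let ?d = "length n"
  obtain U where YU: "Y = of_tensor idx (mode_prods [0..<?d] (\<lambda>k. U k * (U k)\<^sup>T) (T A))"
    and lead: "\<And>k. k < ?d \<Longrightarrow> leading_left_singular_vectors (r ! k) (unf k A) (U k)"
    using Y by (auto simp: hosvd_def)
  have U: "U k \<in> carrier_mat (n ! k) (r ! k)" "(U k)\<^sup>T * U k = 1\<^sub>m (r ! k)" if "k < ?d" for k
    using leading_left_singular_vectors_St[OF lead[OF that]] by (auto simp: St_def)
  have P: "orth_proj_at k (U k * (U k)\<^sup>T)" if "k < ?d" for k
  proof -
    have "U k * (U k)\<^sup>T * (U k * (U k)\<^sup>T) = U k * ((U k)\<^sup>T * U k) * (U k)\<^sup>T"
      using U(1)[OF that] by (simp add: mat_mult_assoc)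
    then show ?thesis
      unfolding orth_proj_at_def U(2)[OF that] using U(1)[OF that] by (simp add: transpose_mult_dims)
  qed
  have Psq: "U k * (U k)\<^sup>T \<in> sq k" if "k < ?d" for k using P[OF that] by (simp add: orth_proj_at_def)
  have Yops: "Y = mode_ops [0..<?d] (\<lambda>k. U k * (U k)\<^sup>T) A"
    unfolding YU by (subst of_tensor_mode_prods) (use Psq in \<open>auto simp: of_tensor_to_tensor\<close>)
  show "Y \<in> tucker_variety idx n r" unfolding tucker_variety_iff[OF r]
  proof (intro allI impI)
    fix k assume k: "k < ?d"
    obtain Z where Z: "Y = mode_op k (U k * (U k)\<^sup>T) Z"
      using mode_ops_extract[of "[0..<?d]" "\<lambda>k. U k * (U k)\<^sup>T" k A] k Psq Yops by auto
    have "unf k Y = U k * ((U k)\<^sup>T * unf k Z)"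
      unfolding Z unf_mode_op[OF k Psq[OF k]] using U(1)[OF k] by (simp add: mat_mult_assoc)
    then show "mat_rank (unf k Y) \<le> r ! k"
      by (rule rank_leI_factor) (use U(1)[OF k] unf_carrier[of k Z] in auto)
  qed
  assume X: "X \<in> tucker_variety idx n r"
  have each: "norm (A - mode_op k (U k * (U k)\<^sup>T) A) \<le> real (n ! k) * norm (A - X)" if k: "k < ?d" for k
  proof -
    have "(norm (A - mode_op k (U k * (U k)\<^sup>T) A))\<^sup>2 =
      fdot (unf k A - U k * (U k)\<^sup>T * unf k A) (unf k A - U k * (U k)\<^sup>T * unf k A)"
      by (simp add: power2_norm_eq_inner inner_fdot[OF k] unf_diff unf_mode_op[OF k Psq[OF k]])
    also have "\<dots> \<le> real (n ! k) * fdot (unf k A - unf k X) (unf k A - unf k X)"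
      by (rule svd_truncation_error[OF lead[OF k] unf_carrier unf_carrier])
        (use X k in \<open>simp add: tucker_variety_iff[OF r]\<close>)
    also have "\<dots> = real (n ! k) * (norm (A - X))\<^sup>2"
      by (simp add: power2_norm_eq_inner inner_fdot[OF k] unf_diff)
    also have "\<dots> \<le> (real (n ! k))\<^sup>2 * (norm (A - X))\<^sup>2"
      by (intro mult_right_mono) (cases "n ! k", auto simp: power2_eq_square)
    finally have "(norm (A - mode_op k (U k * (U k)\<^sup>T) A))\<^sup>2 \<le> (real (n ! k) * norm (A - X))\<^sup>2"
      by (simp add: power_mult_distrib)
    then show ?thesis by (rule power2_le_imp_le) simp
  qed
  have "norm (A - Y) \<le> (\<Sum>k\<leftarrow>[0..<?d]. norm (A - mode_op k (U k * (U k)\<^sup>T) A))"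
    unfolding Yops by (rule mode_ops_proj_error) (use P in auto)
  also have "\<dots> \<le> (\<Sum>k\<leftarrow>[0..<?d]. real (n ! k) * norm (A - X))"
    by (rule sum_list_mono) (use each in auto)
  also have "\<dots> = real (sum_list n) * norm (A - X)"
    by (subst sum_list_real_mult[symmetric]) (simp add: sum_list_sum_nth lessThan_atLeast0 interv_sum_list_conv_sum_set_nat)
  finally show "norm (A - Y) \<le> real (sum_list n) * norm (A - X)" .
qed

end

section \<open>Limits of matrices of bounded rank\<close>

text \<open>Entrywise convergence, as the type of matrices carries no topology.\<close>

definition mtendsto :: "nat \<Rightarrow> nat \<Rightarrow> (nat \<Rightarrow> real mat) \<Rightarrow> real mat \<Rightarrow> bool" where
  "mtendsto n m Y L \<longleftrightarrow> (\<forall>i. Y i \<in> carrier_mat n m) \<and> L \<in> carrier_mat n m \<and>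
     (\<forall>a<n. \<forall>b<m. (\<lambda>i. Y i $$ (a, b)) \<longlonglongrightarrow> L $$ (a, b))"

lemma mtendsto_const: "L \<in> carrier_mat n m \<Longrightarrow> mtendsto n m (\<lambda>_. L) L"
  by (simp add: mtendsto_def)

lemma mtendsto_entry:
  "mtendsto n m Y L \<Longrightarrow> a < n \<Longrightarrow> b < m \<Longrightarrow> (\<lambda>i. Y i $$ (a, b)) \<longlonglongrightarrow> L $$ (a, b)"
  by (simp add: mtendsto_def)

lemma mtendstoD: "mtendsto n m Y L \<Longrightarrow> Y i \<in> carrier_mat n m" "mtendsto n m Y L \<Longrightarrow> L \<in> carrier_mat n m"
  by (auto simp: mtendsto_def)

lemma index_mult_mat_sum:
  fixes A B :: "real mat"
  assumes "A \<in> carrier_mat n p" "B \<in> carrier_mat p m" "a < n" "b < m"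
  shows "(A * B) $$ (a, b) = (\<Sum>l<p. A $$ (a, l) * B $$ (l, b))"
  using assms by (simp add: scalar_prod_def lessThan_atLeast0)

lemma mtendsto_mult:
  assumes Y: "mtendsto n p Y L" and Z: "mtendsto p m Z K"
  shows "mtendsto n m (\<lambda>i. Y i * Z i) (L * K)"
  unfolding mtendsto_def
proof (intro conjI allI impI)
  fix a b assume ab: "a < n" "b < m"
  have "(\<lambda>i. \<Sum>l<p. Y i $$ (a, l) * Z i $$ (l, b)) \<longlonglongrightarrow> (\<Sum>l<p. L $$ (a, l) * K $$ (l, b))"
    by (intro tendsto_sum tendsto_mult mtendsto_entry[OF Y] mtendsto_entry[OF Z]) (use ab in auto)
  then show "(\<lambda>i. (Y i * Z i) $$ (a, b)) \<longlonglongrightarrow> (L * K) $$ (a, b)"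
    using index_mult_mat_sum[OF mtendstoD(1)[OF Y] mtendstoD(1)[OF Z] ab]
      index_mult_mat_sum[OF mtendstoD(2)[OF Y] mtendstoD(2)[OF Z] ab] by simp
qed (use mtendstoD[OF Y] mtendstoD[OF Z] in \<open>auto intro: mult_carrier_mat\<close>)

lemma mtendsto_det:
  assumes Y: "mtendsto n n Y L"
  shows "(\<lambda>i. Determinant.det (Y i)) \<longlonglongrightarrow> Determinant.det L"
proof -
  have "(\<lambda>i. \<Sum>p | p permutes {0..<n}. signof p * (\<Prod>j = 0..<n. Y i $$ (j, p j))) \<longlonglongrightarrow>
    (\<Sum>p | p permutes {0..<n}. signof p * (\<Prod>j = 0..<n. L $$ (j, p j)))"
    by (intro tendsto_sum tendsto_mult tendsto_const tendsto_prod mtendsto_entry[OF Y])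
      (auto simp: permutes_in_image[where S = "{0..<n}", unfolded atLeastLessThan_iff] dest: permutes_in_image)
  then show ?thesis
    using det_def'[OF mtendstoD(1)[OF Y]] det_def'[OF mtendstoD(2)[OF Y]] by simp
qed

text \<open>The entries of the adjugate are determinants of submatrices.\<close>

lemma mtendsto_adj_mat:
  assumes Y: "mtendsto n n Y L"
  shows "mtendsto n n (\<lambda>i. adj_mat (Y i)) (adj_mat L)"
  unfolding mtendsto_def
proof (intro conjI allI impI)
  fix a b assume ab: "a < n" "b < n"
  have del: "mat_delete A b a $$ (i, j) = A $$ (if i < b then i else Suc i, if j < a then j else Suc j)"
    if "A \<in> carrier_mat n n" "i < n - 1" "j < n - 1" for A :: "real mat" and i j
    using that by (simp add: mat_delete_def)
  have "mtendsto (n - 1) (n - 1) (\<lambda>i. mat_delete (Y i) b a) (mat_delete L b a)"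
    unfolding mtendsto_def
  proof (intro conjI allI impI)
    fix i j assume ij: "i < n - 1" "j < n - 1"
    have "(\<lambda>l. Y l $$ (if i < b then i else Suc i, if j < a then j else Suc j)) \<longlonglongrightarrow>
      L $$ (if i < b then i else Suc i, if j < a then j else Suc j)"
      by (rule mtendsto_entry[OF Y]) (use ij in auto)
    then show "(\<lambda>l. mat_delete (Y l) b a $$ (i, j)) \<longlonglongrightarrow> mat_delete L b a $$ (i, j)"
      using del[OF mtendstoD(1)[OF Y] ij] del[OF mtendstoD(2)[OF Y] ij] by simp
  qed (use mat_delete_carrier[OF mtendstoD(1)[OF Y]] mat_delete_carrier[OF mtendstoD(2)[OF Y]] in auto)
  from mtendsto_det[OF this]
  have "(\<lambda>i. cofactor (Y i) b a) \<longlonglongrightarrow> cofactor L b a"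
    unfolding cofactor_def by (intro tendsto_mult tendsto_const)
  moreover have "adj_mat A $$ (a, b) = cofactor A b a" if "A \<in> carrier_mat n n" for A :: "real mat"
    using that ab by (simp add: adj_mat_def)
  ultimately show "(\<lambda>i. adj_mat (Y i) $$ (a, b)) \<longlonglongrightarrow> adj_mat L $$ (a, b)"
    using mtendstoD[OF Y] by simp
qed (use mtendstoD[OF Y] adj_mat(1) in auto)

text \<open>\<open>E L F = 1\<close> for suitable \<open>E\<close> and \<open>F\<close>, and \<open>det (E Y\<^sub>i F) \<noteq> 0\<close> is an open condition.\<close>

lemma rank_lower_semicontinuous:
  assumes Y: "mtendsto n m Y L"
  shows "\<forall>\<^sub>F i in sequentially. mat_rank L \<le> mat_rank (Y i)"
proof -
  define p where "p = mat_rank L"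
  obtain C D E F where *: "C \<in> carrier_mat n p" "D \<in> carrier_mat p m" "E \<in> carrier_mat p n"
      "F \<in> carrier_mat m p" "E * C = 1\<^sub>m p" "D * F = 1\<^sub>m p" and L: "L = C * D"
    using rank_factorization[OF mtendstoD(2)[OF Y] p_def] by metis
  have "mtendsto p p (\<lambda>i. E * Y i * F) (E * L * F)"
    by (intro mtendsto_mult[of _ m] mtendsto_mult[of _ n] Y mtendsto_const *)
  moreover have "E * L * F = (E * C) * (D * F)" unfolding L using *(1-4) by (simp add: mat_mult_assoc)
  ultimately have "(\<lambda>i. Determinant.det (E * Y i * F)) \<longlonglongrightarrow> 1"
    using mtendsto_det[of p "\<lambda>i. E * Y i * F" "1\<^sub>m p"] * by simp
  then have "\<forall>\<^sub>F i in sequentially. Determinant.det (E * Y i * F) \<noteq> 0"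
    by (rule tendsto_imp_eventually_ne) simp
  then show ?thesis
    by eventually_elim (use rank_geI_det[OF mtendstoD(1)[OF Y] *(3,4)] p_def in simp)
qed

text \<open>Let \<open>M = E Y F\<close> be an invertible \<open>p \<times> p\<close> matrix and \<open>Y = C D\<close> a rank factorization. Then \<open>M = (E C) (D F)\<close>
  with invertible factors, so \<open>Y F M\<^sup>-\<^sup>1 E Y = C D = Y\<close>. With the adjugate in place of the inverse the
  formula passes to limits entry by entry.\<close>

lemma rank_compression:
  fixes Y :: "real mat"
  assumes Y: "Y \<in> carrier_mat n m" and E: "E \<in> carrier_mat p n" and F: "F \<in> carrier_mat m p"
    and rank: "mat_rank Y \<le> p" and det: "Determinant.det (E * Y * F) \<noteq> 0"
  shows "Y * F * adj_mat (E * Y * F) * (E * Y) = Determinant.det (E * Y * F) \<cdot>\<^sub>m Y"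
proof -
  have "p = mat_rank Y" using rank rank_geI_det[OF Y E F det] by simp
  then obtain C D where CD: "C \<in> carrier_mat n p" "D \<in> carrier_mat p m" and YCD: "Y = C * D"
    using rank_factorization[OF Y] by metis
  define M where "M = E * Y * F"
  define d where "d = Determinant.det M"
  have M: "M \<in> carrier_mat p p" using E F Y by (simp add: M_def)
  have d0: "d \<noteq> 0" using det by (simp add: d_def M_def)
  have adj: "adj_mat M \<in> carrier_mat p p" "M * adj_mat M = d \<cdot>\<^sub>m 1\<^sub>m p" using adj_mat[OF M] by (auto simp: d_def)
  define K where "K = E * C"
  define H where "H = D * F * adj_mat M"
  have K: "K \<in> carrier_mat p p" and H: "H \<in> carrier_mat p p" using E F CD adj by (auto simp: K_def H_def)
  have "K * H = M * adj_mat M" unfolding K_def H_def M_def YCD using E F CD adj(1) YCD M_def by (simp add: mat_mult_assoc)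
  then have KH: "K * H = d \<cdot>\<^sub>m 1\<^sub>m p" using adj by simp
  have "K * ((1 / d) \<cdot>\<^sub>m H) = (1 / d) \<cdot>\<^sub>m (d \<cdot>\<^sub>m 1\<^sub>m p)"
    using mult_smult_distrib[OF K H] KH by simp
  also have "\<dots> = 1\<^sub>m p" using d0 by (intro eq_matI) auto
  finally have "((1 / d) \<cdot>\<^sub>m H) * K = 1\<^sub>m p"
    using mat_mult_left_right_inverse[of K p "(1 / d) \<cdot>\<^sub>m H"] K H by simp
  then have "(1 / d) \<cdot>\<^sub>m (H * K) = 1\<^sub>m p" using mult_smult_assoc_mat[OF H K] by simp
  then have "d \<cdot>\<^sub>m ((1 / d) \<cdot>\<^sub>m (H * K)) = d \<cdot>\<^sub>m 1\<^sub>m p" by simp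
  moreover have "d \<cdot>\<^sub>m ((1 / d) \<cdot>\<^sub>m (H * K)) = H * K" using d0 by (intro eq_matI) auto
  ultimately have HK: "H * K = d \<cdot>\<^sub>m 1\<^sub>m p" by simp
  have "Y * F * adj_mat M * (E * Y) = C * (H * K) * D"
    unfolding H_def K_def using E F CD adj(1) by (simp add: mat_mult_assoc YCD)
  also have "\<dots> = d \<cdot>\<^sub>m Y" unfolding HK YCD using CD
    by (simp add: mult_smult_distrib[of C n p "1\<^sub>m p" p] mult_smult_assoc_mat[of C n p D m])
  finally show ?thesis by (simp add: M_def d_def)
qed

text \<open>A tangent direction \<open>W\<close> at \<open>X\<close> of the matrices of rank at most \<open>rank X\<close> maps the kernel of \<open>X\<close> into its
  column space. Indeed, multiply \<open>det M Y = Y F adj M E Y\<close> for \<open>Y = X + t V\<close> by \<open>L\<close> from the left and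
  by \<open>R\<close> from the right: the left-hand side is \<open>t det M L V R\<close>, while on the right-hand side both outer factors
  are of order \<open>t\<close>.\<close>

lemma bounded_rank_tangent:
  fixes X :: "real mat"
  assumes X: "X \<in> carrier_mat n m" and V: "mtendsto n m V W"
    and t: "t \<longlonglongrightarrow> (0::real)" and t0: "\<And>i. t i \<noteq> 0"
    and rank: "\<And>i. mat_rank (X + t i \<cdot>\<^sub>m V i) \<le> mat_rank X"
    and L: "L \<in> carrier_mat l n" "L * X = 0\<^sub>m l m" and R: "R \<in> carrier_mat m s" "X * R = 0\<^sub>m n s"
  shows "L * W * R = 0\<^sub>m l s"
proof -
  define p where "p = mat_rank X"
  obtain C D E F where *: "C \<in> carrier_mat n p" "D \<in> carrier_mat p m" "E \<in> carrier_mat p n"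
      "F \<in> carrier_mat m p" "E * C = 1\<^sub>m p" "D * F = 1\<^sub>m p" and XCD: "X = C * D"
    using rank_factorization[OF X p_def] by metis
  define Y where "Y i = X + t i \<cdot>\<^sub>m V i" for i
  have Vc: "V i \<in> carrier_mat n m" for i using mtendstoD(1)[OF V] .
  have Yc: "Y i \<in> carrier_mat n m" for i using X Vc by (simp add: Y_def)
  have Ylim: "mtendsto n m Y X"
    unfolding mtendsto_def
  proof (intro conjI allI impI)
    fix a b assume ab: "a < n" "b < m"
    have "(\<lambda>i. X $$ (a, b) + t i * V i $$ (a, b)) \<longlonglongrightarrow> X $$ (a, b) + 0 * W $$ (a, b)"
      by (intro tendsto_intros t mtendsto_entry[OF V] ab)
    moreover have "Y i $$ (a, b) = X $$ (a, b) + t i * V i $$ (a, b)" for i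
      using ab X Vc[of i] by (simp add: Y_def)
    ultimately show "(\<lambda>i. Y i $$ (a, b)) \<longlonglongrightarrow> X $$ (a, b)" by simp
  qed (use Yc X in auto)
  define M where "M i = E * Y i * F" for i
  have Mlim: "mtendsto p p M (E * X * F)"
    unfolding M_def by (intro mtendsto_mult[of _ m] mtendsto_mult[of _ n] Ylim mtendsto_const *)
  have "E * X * F = (E * C) * (D * F)" unfolding XCD using *(1-4) by (simp add: mat_mult_assoc)
  then have EXF: "E * X * F = 1\<^sub>m p" using * by simp
  have detlim: "(\<lambda>i. Determinant.det (M i)) \<longlonglongrightarrow> 1" using mtendsto_det[OF Mlim] by (simp add: EXF)
  then have ev: "\<forall>\<^sub>F i in sequentially. Determinant.det (M i) \<noteq> 0"
    by (rule tendsto_imp_eventually_ne) simp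
  define Z where "Z i = L * V i * F * adj_mat (M i) * (E * V i * R)" for i
  have Mc: "M i \<in> carrier_mat p p" for i using mtendstoD(1)[OF Mlim] .
  have Ac: "adj_mat (M i) \<in> carrier_mat p p" for i using adj_mat(1)[OF Mc] .
  have Zlim: "mtendsto l s Z (L * W * F * adj_mat (E * X * F) * (E * W * R))"
    unfolding Z_def by (intro mtendsto_mult[of _ p] mtendsto_mult[of _ m] mtendsto_mult[of _ n] mtendsto_adj_mat
        Mlim V mtendsto_const L R *)
  have key: "Determinant.det (M i) \<cdot>\<^sub>m (L * V i * R) = t i \<cdot>\<^sub>m Z i" if det: "Determinant.det (M i) \<noteq> 0" for i
  proof -
    let ?d = "Determinant.det (M i)"
    have "L * Y i = L * X + L * (t i \<cdot>\<^sub>m V i)"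
      unfolding Y_def by (rule mult_add_distrib_mat[of _ l n]) (use L X Vc[of i] in auto)
    then have LY: "L * Y i = t i \<cdot>\<^sub>m (L * V i)"
      using L Vc[of i] mult_smult_distrib[OF L(1) Vc[of i]] by simp
    have "Y i * R = X * R + (t i \<cdot>\<^sub>m V i) * R"
      unfolding Y_def by (rule add_mult_distrib_mat[of _ n m]) (use R X Vc[of i] in auto)
    then have YR: "Y i * R = t i \<cdot>\<^sub>m (V i * R)"
      using R Vc[of i] mult_smult_assoc_mat[OF Vc[of i] R(1)] by simp
    have "Y i * F * adj_mat (M i) * (E * Y i) = ?d \<cdot>\<^sub>m Y i"
      unfolding M_def by (rule rank_compression[OF Yc *(3,4)])
        (use rank[of i] X det in \<open>auto simp: Y_def M_def p_def\<close>)
    then have "L * (Y i * F * adj_mat (M i) * (E * Y i)) * R = L * (?d \<cdot>\<^sub>m Y i) * R" by simp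
    moreover have "L * (Y i * F * adj_mat (M i) * (E * Y i)) * R = (L * Y i) * F * adj_mat (M i) * (E * (Y i * R))"
      using L(1) R(1) Yc[of i] *(3,4) Ac[of i] by (simp add: mat_mult_assoc)
    moreover have "(L * Y i) * F * adj_mat (M i) * (E * (Y i * R)) = t i \<cdot>\<^sub>m (t i \<cdot>\<^sub>m Z i)"
    proof -
      have 1: "t i \<cdot>\<^sub>m (L * V i) * F = t i \<cdot>\<^sub>m (L * V i * F)"
        by (rule mult_smult_assoc_mat[of _ l m]) (use L(1) Vc[of i] *(4) in auto)
      have 2: "t i \<cdot>\<^sub>m (L * V i * F) * adj_mat (M i) = t i \<cdot>\<^sub>m (L * V i * F * adj_mat (M i))"
        by (rule mult_smult_assoc_mat[of _ l p]) (use L(1) Vc[of i] *(4) Ac[of i] in auto)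
      have 3: "E * (t i \<cdot>\<^sub>m (V i * R)) = t i \<cdot>\<^sub>m (E * (V i * R))"
        by (rule mult_smult_distrib[of _ p n]) (use R(1) Vc[of i] *(3) in auto)
      have 4: "t i \<cdot>\<^sub>m (L * V i * F * adj_mat (M i)) * (t i \<cdot>\<^sub>m (E * (V i * R))) =
        t i \<cdot>\<^sub>m (L * V i * F * adj_mat (M i) * (t i \<cdot>\<^sub>m (E * (V i * R))))"
        by (rule mult_smult_assoc_mat[of _ l p _ s]) (use L(1) R(1) Vc[of i] *(3,4) Ac[of i] in auto)
      have 5: "L * V i * F * adj_mat (M i) * (t i \<cdot>\<^sub>m (E * (V i * R))) =
        t i \<cdot>\<^sub>m (L * V i * F * adj_mat (M i) * (E * (V i * R)))"
        by (rule mult_smult_distrib[of _ l p _ s]) (use L(1) R(1) Vc[of i] *(3,4) Ac[of i] in auto)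
      have 6: "E * (V i * R) = E * V i * R" using R(1) Vc[of i] *(3) by (simp add: mat_mult_assoc)
      show ?thesis unfolding LY YR 1 2 3 4 5 unfolding 6 Z_def ..
    qed
    moreover have "L * (?d \<cdot>\<^sub>m Y i) * R = t i \<cdot>\<^sub>m (?d \<cdot>\<^sub>m (L * V i * R))"
    proof -
      have 1: "L * (?d \<cdot>\<^sub>m Y i) = ?d \<cdot>\<^sub>m (L * Y i)" by (rule mult_smult_distrib[OF L(1) Yc])
      have 2: "?d \<cdot>\<^sub>m (t i \<cdot>\<^sub>m (L * V i)) = t i \<cdot>\<^sub>m (?d \<cdot>\<^sub>m (L * V i))"
        by (rule eq_matI) (auto simp: mult.left_commute)
      have 3: "t i \<cdot>\<^sub>m (?d \<cdot>\<^sub>m (L * V i)) * R = t i \<cdot>\<^sub>m (?d \<cdot>\<^sub>m (L * V i) * R)"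
        by (rule mult_smult_assoc_mat[of _ l m]) (use L(1) Vc[of i] R(1) in auto)
      have 4: "?d \<cdot>\<^sub>m (L * V i) * R = ?d \<cdot>\<^sub>m (L * V i * R)"
        by (rule mult_smult_assoc_mat[of _ l m]) (use L(1) Vc[of i] R(1) in auto)
      show ?thesis unfolding 1 LY 2 3 4 ..
    qed
    ultimately have eq: "t i \<cdot>\<^sub>m (?d \<cdot>\<^sub>m (L * V i * R)) = t i \<cdot>\<^sub>m (t i \<cdot>\<^sub>m Z i)" by simp
    have c: "L * V i * R \<in> carrier_mat l s" "Z i \<in> carrier_mat l s"
      using L(1) R(1) Vc[of i] mtendstoD(1)[OF Zlim] by auto
    show ?thesis
    proof (rule eq_matI)
      fix a b assume ab: "a < dim_row (t i \<cdot>\<^sub>m Z i)" "b < dim_col (t i \<cdot>\<^sub>m Z i)"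
      have "(t i \<cdot>\<^sub>m (?d \<cdot>\<^sub>m (L * V i * R))) $$ (a, b) = (t i \<cdot>\<^sub>m (t i \<cdot>\<^sub>m Z i)) $$ (a, b)" using eq by simp
      then have "t i * (?d \<cdot>\<^sub>m (L * V i * R)) $$ (a, b) = t i * (t i \<cdot>\<^sub>m Z i) $$ (a, b)"
        using ab c L(1) R(1) by simp
      then show "(?d \<cdot>\<^sub>m (L * V i * R)) $$ (a, b) = (t i \<cdot>\<^sub>m Z i) $$ (a, b)" using t0[of i] by simp
    qed (use c in auto)
  qed
  have LVR: "mtendsto l s (\<lambda>i. L * V i * R) (L * W * R)"
    by (intro mtendsto_mult[of _ m] mtendsto_mult[of _ n] V mtendsto_const L R)
  show ?thesis
  proof (rule eq_matI)
    fix a b assume "a < dim_row (0\<^sub>m l s :: real mat)" "b < dim_col (0\<^sub>m l s :: real mat)"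
    then have ab: "a < l" "b < s" by auto
    have lhs: "(\<lambda>i. Determinant.det (M i) * (L * V i * R) $$ (a, b)) \<longlonglongrightarrow> 1 * (L * W * R) $$ (a, b)"
      by (intro tendsto_mult detlim mtendsto_entry[OF LVR] ab)
    have rhs: "(\<lambda>i. t i * Z i $$ (a, b)) \<longlonglongrightarrow> 0 * (L * W * F * adj_mat (E * X * F) * (E * W * R)) $$ (a, b)"
      by (intro tendsto_mult t mtendsto_entry[OF Zlim] ab)
    have "\<forall>\<^sub>F i in sequentially. Determinant.det (M i) * (L * V i * R) $$ (a, b) = t i * Z i $$ (a, b)"
      using ev
    proof eventually_elim
      case (elim i)
      have "(Determinant.det (M i) \<cdot>\<^sub>m (L * V i * R)) $$ (a, b) = (t i \<cdot>\<^sub>m Z i) $$ (a, b)"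
        using key[OF elim] by simp
      then show ?case using ab mtendstoD(1)[OF LVR, of i] mtendstoD(1)[OF Zlim, of i] L(1) R(1) by simp
    qed
    then have "(\<lambda>i. Determinant.det (M i) * (L * V i * R) $$ (a, b)) \<longlonglongrightarrow> 0"
      using rhs by (simp add: filterlim_cong)
    then have "(L * W * R) $$ (a, b) = 0" using LIMSEQ_unique[OF lhs] by simp
    then show "(L * W * R) $$ (a, b) = 0\<^sub>m l s $$ (a, b)" using ab by simp
  qed (use L R mtendstoD(2)[OF V] in auto)
qed

section \<open>Tangent cones of the variety of bounded multilinear rank\<close>

context tensor_shape
begin

lemma mtendsto_unf:
  assumes k: "k < length n" and Z: "Z \<longlonglongrightarrow> Z'"
  shows "mtendsto (n ! k) (nc k) (\<lambda>i. unf k (Z i)) (unf k Z')"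
  unfolding mtendsto_def
proof (intro conjI allI impI unf_carrier)
  fix a b assume "a < n ! k" "b < nc k"
  then show "(\<lambda>i. unf k (Z i) $$ (a, b)) \<longlonglongrightarrow> unf k Z' $$ (a, b)"
    by (simp add: unf_index) (simp add: to_tensor_def tendsto_vec_nth[OF Z])
qed

lemma tendsto_mode_op:
  assumes k: "k < length n" and M: "mtendsto (n ! k) (n ! k) M M'" and Z: "Z \<longlonglongrightarrow> Z'"
  shows "(\<lambda>i. mode_op k (M i) (Z i)) \<longlonglongrightarrow> mode_op k M' Z'"
proof (rule vec_tendstoI)
  fix j
  have dims: "dim_col (M i) = n ! k" "dim_col M' = n ! k" for i
    using mtendstoD[OF M, THEN carrier_matD(2)] by auto
  have "(\<lambda>i. \<Sum>a<n ! k. M i $$ (idx j ! k, a) * T (Z i) ((idx j)[k := a])) \<longlonglongrightarrow>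
     (\<Sum>a<n ! k. M' $$ (idx j ! k, a) * T Z' ((idx j)[k := a]))"
    unfolding to_tensor_def
    by (intro tendsto_sum tendsto_mult mtendsto_entry[OF M] tendsto_vec_nth Z)
      (use k multi_indices_nth[OF idx_in] in auto)
  then show "(\<lambda>i. mode_op k (M i) (Z i) $ j) \<longlonglongrightarrow> mode_op k M' Z' $ j"
    by (simp add: mode_op_def of_tensor_def mode_prod_def dims)
qed

lemma tendsto_mode_ops:
  assumes "\<And>k. k \<in> set ks \<Longrightarrow> k < length n \<and> mtendsto (n ! k) (n ! k) (\<lambda>i. M i k) (M' k)"
    and "Z \<longlonglongrightarrow> Z'"
  shows "(\<lambda>i. mode_ops ks (M i) (Z i)) \<longlonglongrightarrow> mode_ops ks M' Z'"
  using assms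
proof (induction ks arbitrary: Z Z')
  case (Cons k ks)
  have "(\<lambda>i. mode_ops ks (M i) (mode_op k (M i k) (Z i))) \<longlonglongrightarrow> mode_ops ks M' (mode_op k (M' k) Z')"
    by (rule Cons.IH) (use Cons.prems tendsto_mode_op[of k "\<lambda>i. M i k"] in auto)
  then show ?case by (simp add: mode_ops_Cons)
qed simp

lemma rank_tc_iff:
  assumes "length r = length n"
  shows "rank_tc n (T Z) = r \<longleftrightarrow> (\<forall>k<length n. mat_rank (unf k Z) = r ! k)"
  unfolding list_eq_iff_nth_eq[of "rank_tc n (T Z)"] using assms by (simp add: rank_tc_def)

text \<open>A consequence of the semicontinuity of the rank of each unfolding.\<close>

lemma tucker_variety_closed:
  assumes r: "length r = length n" and Z: "Z \<longlonglongrightarrow> Z'" and mem: "\<And>i. Z i \<in> tucker_variety idx n r"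
  shows "Z' \<in> tucker_variety idx n r"
  unfolding tucker_variety_iff[OF r]
proof (intro allI impI)
  fix k assume k: "k < length n"
  obtain i where "mat_rank (unf k Z') \<le> mat_rank (unf k (Z i))"
    using eventually_happens'[OF sequentially_bot rank_lower_semicontinuous[OF mtendsto_unf[OF k Z]]] by blast
  also have "\<dots> \<le> r ! k" using mem[of i] k by (simp add: tucker_variety_iff[OF r])
  finally show "mat_rank (unf k Z') \<le> r ! k" .
qed

lemma rank_tc_eventually:
  assumes r: "length r = length n" and Z: "Z \<longlonglongrightarrow> Z'" and mem: "\<And>i. Z i \<in> tucker_variety idx n r"
    and rank: "rank_tc n (T Z') = r"
  shows "\<forall>\<^sub>F i in sequentially. rank_tc n (T (Z i)) = r"
proof -
  have "\<forall>\<^sub>F i in sequentially. \<forall>k\<in>{..<length n}. mat_rank (unf k Z') \<le> mat_rank (unf k (Z i))"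
    by (rule eventually_ball_finite) (use rank_lower_semicontinuous[OF mtendsto_unf[OF _ Z]] in auto)
  then show ?thesis
  proof eventually_elim
    case (elim i)
    have "mat_rank (unf k (Z i)) = r ! k" if k: "k < length n" for k
      using elim k mem[of i] rank unfolding rank_tc_iff[OF r] tucker_variety_iff[OF r]
      by (metis lessThan_iff le_antisym)
    then show ?case unfolding rank_tc_iff[OF r] by blast
  qed
qed

text \<open>Each unfolding of a tangent vector \<open>v\<close> satisfies the condition for matrices, with the oblique projections
  \<open>P = X R\<close> onto the column space of the unfolding and \<open>R X\<close> along its kernel. The condition
  \<open>(1 - P) V (1 - R X) = 0\<close> says \<open>(1 - P) V = B X\<close> with \<open>B = (1 - P) V R\<close>. So \<open>v\<close> differs from \<open>v \<times>\<^sub>k P\<^sub>k\<close>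
  by \<open>X \<times>\<^sub>k B\<^sub>k\<close>; and as \<open>X\<close> is invariant under all \<open>P\<^sub>k\<close>, this can be repeated mode by mode.\<close>

lemma bouligand_cone_subset_tangents:
  assumes r: "length r = length n" and rank: "rank_tc n (T X) = r"
    and v: "v \<in> bouligand_cone (tucker_variety idx n r) X"
  shows "v \<in> tangents X"
proof -
  let ?d = "length n"
  obtain y t where y: "\<And>i. y i \<in> tucker_variety idx n r" and t0: "\<And>i. t i > (0::real)" and
    t: "t \<longlonglongrightarrow> 0" and quot: "(\<lambda>i. (y i - X) /\<^sub>R t i) \<longlonglongrightarrow> v"
    using v unfolding bouligand_cone_def by blast
  define good where "good k R B \<longleftrightarrow> R \<in> carrier_mat (nc k) (n ! k) \<and> B \<in> sq k \<and>
      unf k X * R * unf k X = unf k X \<and> mode_op k (1\<^sub>m (n ! k) - unf k X * R) v = mode_op k B X" for k R B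
  have ex: "\<exists>RB. good k (fst RB) (snd RB)" if k: "k < ?d" for k
  proof -
    let ?X = "unf k X" and ?V = "unf k v"
    define p where "p = mat_rank ?X"
    have Xc: "?X \<in> carrier_mat (n ! k) (nc k)" and Vc: "?V \<in> carrier_mat (n ! k) (nc k)" using unf_carrier by auto
    obtain C D E F where *: "C \<in> carrier_mat (n ! k) p" "D \<in> carrier_mat p (nc k)" "E \<in> carrier_mat p (n ! k)"
      "F \<in> carrier_mat (nc k) p" "E * C = 1\<^sub>m p" "D * F = 1\<^sub>m p" and XCD: "?X = C * D"
      using rank_factorization[OF Xc p_def] by metis
    define R where "R = F * E"
    have R: "R \<in> carrier_mat (nc k) (n ! k)" using * by (simp add: R_def)
    have "C * D * (F * E) * (C * D) = C * (D * F) * (E * C) * D" using *(1-4) by (simp add: mat_mult_assoc)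
    then have XRX: "?X * R * ?X = ?X" unfolding R_def XCD *(5,6) using *(1-4) by simp
    define L where "L = 1\<^sub>m (n ! k) - ?X * R"
    define Q where "Q = 1\<^sub>m (nc k) - R * ?X"
    have XRsq: "?X * R \<in> sq k" and RXsq: "R * ?X \<in> carrier_mat (nc k) (nc k)" using R Xc by auto
    have L: "L \<in> sq k" unfolding L_def by (rule minus_carrier_mat[OF XRsq])
    have Q: "Q \<in> carrier_mat (nc k) (nc k)" unfolding Q_def by (rule minus_carrier_mat[OF RXsq])
    have "L * ?X = 1\<^sub>m (n ! k) * ?X - ?X * R * ?X" unfolding L_def
      by (rule minus_mult_distrib_mat[of _ "n ! k" "n ! k"]) (use XRsq Xc in auto)
    then have LX: "L * ?X = 0\<^sub>m (n ! k) (nc k)" unfolding XRX using Xc by simp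
    have "?X * Q = ?X * 1\<^sub>m (nc k) - ?X * (R * ?X)" unfolding Q_def
      by (rule mult_minus_distrib_mat[of _ "n ! k" "nc k"]) (use RXsq Xc in auto)
    also have "?X * (R * ?X) = ?X * R * ?X" using R Xc by (simp add: mat_mult_assoc)
    finally have XQ: "?X * Q = 0\<^sub>m (n ! k) (nc k)" unfolding XRX using Xc by simp
    have "L * ?V * Q = 0\<^sub>m (n ! k) (nc k)"
    proof (rule bounded_rank_tangent[OF Xc mtendsto_unf[OF k quot] t _ _ L LX Q XQ])
      fix i
      show "t i \<noteq> 0" using t0[of i] by simp
      have "t i *\<^sub>R ((y i - X) /\<^sub>R t i) = y i - X" using t0[of i] by simp
      then have "?X + t i \<cdot>\<^sub>m unf k ((y i - X) /\<^sub>R t i) = unf k (y i)"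
        unfolding unf_scale[symmetric] unf_add[symmetric] by simp
      then show "mat_rank (?X + t i \<cdot>\<^sub>m unf k ((y i - X) /\<^sub>R t i)) \<le> mat_rank ?X"
        using y[of i] k rank unfolding rank_tc_iff[OF r] tucker_variety_iff[OF r] by simp
    qed
    moreover have "L * ?V * Q = L * ?V * 1\<^sub>m (nc k) - L * ?V * (R * ?X)" unfolding Q_def
      by (rule mult_minus_distrib_mat[of _ "n ! k" "nc k"]) (use L Vc RXsq in auto)
    ultimately have zero: "L * ?V - L * ?V * (R * ?X) = 0\<^sub>m (n ! k) (nc k)" using L Vc by simp
    define B where "B = L * ?V * R"
    have B: "B \<in> sq k" using L Vc R by (simp add: B_def)
    have "L * ?V = L * ?V * (R * ?X)"
    proof (rule eq_matI)
      fix a b assume "a < dim_row (L * ?V * (R * ?X))" "b < dim_col (L * ?V * (R * ?X))"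
      then have ab: "a < n ! k" "b < nc k" using L Xc by auto
      have "(L * ?V - L * ?V * (R * ?X)) $$ (a, b) = 0" using zero ab by simp
      moreover have "(L * ?V - L * ?V * (R * ?X)) $$ (a, b) = (L * ?V) $$ (a, b) - (L * ?V * (R * ?X)) $$ (a, b)"
        by (rule index_minus_mat) (use ab L Xc in auto)
      ultimately show "(L * ?V) $$ (a, b) = (L * ?V * (R * ?X)) $$ (a, b)" by simp
    qed (use L Vc Xc in auto)
    also have "\<dots> = B * ?X" using L Vc R Xc by (simp add: B_def mat_mult_assoc)
    finally have "mode_op k L v = mode_op k B X"
      by (intro mode_op_eqI[OF k B]) (simp add: unf_mode_op[OF k L])
    then have "good k R B" using R B XRX unfolding good_def L_def by blast
    then show ?thesis by (intro exI[of _ "(R, B)"]) simp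
  qed
  obtain RB where RB: "\<And>k. k < ?d \<Longrightarrow> good k (fst (RB k)) (snd (RB k))"
    using bchoice[of "{..<?d}" "\<lambda>k RB. good k (fst RB) (snd RB)"] ex by auto
  define R where "R k = fst (RB k)" for k
  define B where "B k = snd (RB k)" for k
  note good = RB[folded R_def B_def, unfolded good_def]
  have R: "R k \<in> carrier_mat (nc k) (n ! k)" and B: "B k \<in> sq k"
    and XRX: "unf k X * R k * unf k X = unf k X"
    and opB: "mode_op k (1\<^sub>m (n ! k) - unf k X * R k) v = mode_op k (B k) X" if "k < ?d" for k
    using good[OF that] by blast+
  define P where "P k = unf k X * R k" for k
  have P: "P k \<in> sq k" if "k < ?d" for k using R[OF that] unf_carrier[of k X] by (simp add: P_def)
  have PX: "mode_op k (P k) X = X" if "k < ?d" for k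
    by (rule mode_op_eqI[OF that P[OF that], symmetric]) (simp add: P_def XRX[OF that])
  have split: "mode_op k (P k) v = v - mode_op k (B k) X" if "k < ?d" for k
    using opB[OF that] mode_op_mat_diff[OF that _ P[OF that], of "1\<^sub>m (n ! k)" v] mode_op_one[OF that, of v]
    by (simp add: P_def algebra_simps)
  have "mode_ops [0..<j] P v = v - (\<Sum>k<j. mode_op k (B k) X)" if "j \<le> ?d" for j
    using that
  proof (induction j)
    case (Suc j)
    then have j: "j < ?d" by simp
    have "mode_ops [0..<Suc j] P v = mode_op j (P j) (v - (\<Sum>k<j. mode_op k (B k) X))"
      using Suc by (simp add: mode_ops_snoc)
    also have "\<dots> = mode_op j (P j) v - (\<Sum>k<j. mode_op j (P j) (mode_op k (B k) X))" by (simp add: mode_op_diff mode_op_sum)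
    also have "(\<Sum>k<j. mode_op j (P j) (mode_op k (B k) X)) = (\<Sum>k<j. mode_op k (B k) X)"
    proof (rule sum.cong)
      fix k assume "k \<in> {..<j}"
      then have "k < ?d" "j \<noteq> k" using j by auto
      then show "mode_op j (P j) (mode_op k (B k) X) = mode_op k (B k) X"
        using mode_op_commute[OF j _ _ P[OF j] B] PX[OF j] by simp
    qed simp
    finally show ?case using split[OF j] by (simp add: algebra_simps)
  qed simp
  from this[of ?d] have "v = mode_ops [0..<?d] (\<lambda>k. unf k X * R k) v + (\<Sum>k<?d. mode_op k (B k) X)"
    by (simp add: P_def[abs_def])
  then show ?thesis unfolding tangents_def using R B by blast
qed

text \<open>Keep the parameters \<open>R\<close>, \<open>B\<close>, \<open>C\<close> of \<open>v\<close> and replace \<open>X'\<close> by \<open>X t\<close>: this gives \<open>w t \<rightarrow> v\<close> with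
  \<open>\<langle>A t, w t\<rangle> = \<langle>g t, w t\<rangle> \<rightarrow> 0\<close>.\<close>

lemma tangents_inner_limit:
  assumes X: "X \<longlonglongrightarrow> X'" and A: "A \<longlonglongrightarrow> A'" and g: "g \<longlonglongrightarrow> 0"
    and proj: "\<And>t. g t \<in> approx_projs idx n r (X t) (A t)" and v: "v \<in> tangents X'"
  shows "inner A' v = 0"
proof -
  obtain R B C where v: "v = mode_ops [0..<length n] (\<lambda>k. unf k X' * R k) C + (\<Sum>k<length n. mode_op k (B k) X')"
    and R: "\<And>k. k < length n \<Longrightarrow> R k \<in> carrier_mat (nc k) (n ! k)" and B: "\<And>k. k < length n \<Longrightarrow> B k \<in> sq k"
    using v unfolding tangents_def by blast
  define w where "w t = mode_ops [0..<length n] (\<lambda>k. unf k (X t) * R k) C + (\<Sum>k<length n. mode_op k (B k) (X t))" for t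
  have w: "w \<longlonglongrightarrow> v"
    unfolding w_def v
    by (intro tendsto_add tendsto_mode_ops tendsto_sum tendsto_mode_op tendsto_const X)
      (use R B in \<open>auto intro!: mtendsto_mult mtendsto_unf mtendsto_const X\<close>)
  have "w t \<in> tangents (X t)" for t unfolding tangents_def w_def using R B by blast
  then have "inner (A t) (w t) = inner (g t) (w t)" for t
    using approx_projs_inner_tangents[OF proj] by blast
  moreover have "(\<lambda>t. inner (g t) (w t)) \<longlonglongrightarrow> inner 0 v" by (intro tendsto_inner g w)
  moreover have "(\<lambda>t. inner (A t) (w t)) \<longlonglongrightarrow> inner A' v" by (intro tendsto_inner A w)
  ultimately show ?thesis using LIMSEQ_unique by fastforce
qed

end

section \<open>Nearest points, tangent spaces and gradients\<close>

text \<open>By Pythagoras' theorem the origin is the only nearest point.\<close>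

lemma closest_point_eq_0:
  assumes "0 \<in> S" and orth: "\<And>v. v \<in> S \<Longrightarrow> inner a v = 0"
  shows "closest_point S a = 0"
  unfolding closest_point_def
proof (rule some_equality)
  have dist: "(dist a v)\<^sup>2 = (norm a)\<^sup>2 + (norm v)\<^sup>2" if "v \<in> S" for v
    using orth[OF that] by (simp add: dist_norm power2_norm_eq_inner inner_diff_left inner_diff_right inner_commute)
  show "0 \<in> S \<and> (\<forall>y\<in>S. dist a 0 \<le> dist a y)"
  proof (intro conjI ballI)
    fix y assume "y \<in> S"
    then have "(dist a 0)\<^sup>2 \<le> (dist a y)\<^sup>2" using dist by simp
    then show "dist a 0 \<le> dist a y" by (rule power2_le_imp_le) simp
  qed fact
  fix x assume x: "x \<in> S \<and> (\<forall>y\<in>S. dist a x \<le> dist a y)"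
  then have "dist a x \<le> dist a 0" using assms(1) by blast
  then have "(dist a x)\<^sup>2 \<le> (norm a)\<^sup>2" using power_mono[of "dist a x" "dist a 0" 2] by simp
  then show "x = 0" using dist[of x] x by simp
qed

lemma zero_in_bouligand_cone:
  assumes "x \<in> M"
  shows "0 \<in> bouligand_cone M x"
proof -
  have "(\<lambda>_::nat. x) \<longlonglongrightarrow> x" "(\<lambda>_::nat. (x - x) /\<^sub>R inverse (real (Suc i))) \<longlonglongrightarrow> 0" for i by simp_all
  moreover have "(\<lambda>i. (x - x) /\<^sub>R inverse (real (Suc i))) \<longlonglongrightarrow> 0" by simp
  moreover have "\<forall>i::nat. x \<in> M \<and> 0 < inverse (real (Suc i))" using assms by simp
  ultimately show ?thesis
    unfolding bouligand_cone_def using LIMSEQ_inverse_real_of_nat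
    by (intro CollectI exI[of _ "\<lambda>_. x"] exI[of _ "\<lambda>i. inverse (real (Suc i))"] conjI) auto
qed

lemma C_k_on_const: "C_k_on k S (\<lambda>_. c)"
proof (induction k arbitrary: c)
  case (Suc k)
  have "frechet_derivative (\<lambda>_. c) (at x) = (\<lambda>_. 0)" for x
    by (rule frechet_derivative_at[symmetric]) (rule has_derivative_const)
  then show ?case using Suc by simp
qed simp

lemma zero_in_tangent_space:
  assumes "x \<in> M"
  shows "0 \<in> tangent_space M x"
proof -
  have "\<exists>e>0. smooth_on {-e<..<e} (\<lambda>_::real. x) \<and> (\<lambda>_. x) ` {-e<..<e::real} \<subseteq> M \<and> (\<lambda>_::real. x) 0 = x \<and>
      ((\<lambda>_. x) has_vector_derivative 0) (at (0::real))"
    by (rule exI[of _ 1]) (use assms in \<open>auto simp: smooth_on_def C_k_on_const\<close>)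
  then show ?thesis unfolding tangent_space_def by blast
qed

text \<open>Sample the curve at times tending to 0.\<close>

lemma tangent_space_subset_bouligand_cone: "tangent_space M x \<subseteq> bouligand_cone M x"
proof
  fix v assume "v \<in> tangent_space M x"
  then obtain c e where e: "e > 0" and c: "c ` {-e<..<e::real} \<subseteq> M" "c 0 = x"
    and deriv: "(c has_vector_derivative v) (at 0)" unfolding tangent_space_def by blast
  \<comment> \<open>The factor 1/2 keeps the first time inside the open interval.\<close>
  define t where "t i = e / 2 * inverse (real (Suc i))" for i
  have t: "t \<longlonglongrightarrow> 0"
    unfolding t_def using tendsto_mult_left[OF LIMSEQ_inverse_real_of_nat, of "e / 2"] by simp
  have t0: "0 < t i" for i using e by (simp add: t_def)
  have te: "t i < e" for i
  proof -
    have "t i \<le> e / 2 * 1"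
      unfolding t_def using e by (intro mult_left_mono) (auto simp: inverse_le_1_iff)
    then show ?thesis using e by linarith
  qed
  have tat: "filterlim t (at 0) sequentially"
    unfolding filterlim_at using t t0 by (simp add: less_imp_neq[THEN not_sym])
  have "((\<lambda>s. norm (c s - c 0 - (s - 0) *\<^sub>R v) / norm (s - 0)) \<longlongrightarrow> 0) (at 0)"
    using deriv unfolding has_vector_derivative_def has_derivative_iff_norm by simp
  then have "(\<lambda>i. norm (c (t i) - c 0 - (t i - 0) *\<^sub>R v) / norm (t i - 0)) \<longlonglongrightarrow> 0"
    by (rule filterlim_compose[OF _ tat])
  moreover have "norm (c (t i) - c 0 - (t i - 0) *\<^sub>R v) / norm (t i - 0) = norm ((c (t i) - x) /\<^sub>R t i - v)" for i
  proof -
    have "(c (t i) - x) /\<^sub>R t i - v = inverse (t i) *\<^sub>R (c (t i) - x - t i *\<^sub>R v)"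
      using t0[of i] by (simp add: scaleR_diff_right)
    then show ?thesis using t0[of i] c by (simp add: divide_inverse mult.commute)
  qed
  ultimately have "(\<lambda>i. norm ((c (t i) - x) /\<^sub>R t i - v)) \<longlonglongrightarrow> 0" by simp
  then have "(\<lambda>i. (c (t i) - x) /\<^sub>R t i - v) \<longlonglongrightarrow> 0" by (rule tendsto_norm_zero_cancel)
  then have "(\<lambda>i. (c (t i) - x) /\<^sub>R t i) \<longlonglongrightarrow> v" by (rule LIM_zero_cancel)
  moreover have "(\<lambda>i. c (t i)) \<longlonglongrightarrow> x"
    using isCont_tendsto_compose[OF has_vector_derivative_continuous[OF deriv] t] c by simp
  moreover have "c (t i) \<in> M" for i
    using te[of i] t0[of i] e by (intro subsetD[OF c(1)] imageI) auto
  ultimately show "v \<in> bouligand_cone M x"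
    unfolding bouligand_cone_def using t t0 by (intro CollectI exI[of _ "\<lambda>i. c (t i)"] exI[of _ t] conjI) auto
qed

text \<open>The partial derivatives are the components of the gradient.\<close>

lemma smooth_on_UNIV_gradient:
  fixes f :: "real ^ 'i::finite \<Rightarrow> real"
  assumes "smooth_on UNIV f"
  shows "continuous_on UNIV f" and "continuous_on UNIV (gradient f)"
proof -
  have "C_k_on (Suc 0) UNIV f" using assms by (simp only: smooth_on_def)
  then have diff: "f differentiable (at x)" and cont: "continuous_on UNIV (\<lambda>x. frechet_derivative f (at x) v)" for x v
    by auto
  show "continuous_on UNIV f"
    using assms unfolding smooth_on_def by (metis C_k_on.simps(1))
  have comp: "gradient f x $ i = frechet_derivative f (at x) (axis i 1)" for x i
  proof -
    let ?D = "frechet_derivative f (at x)"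
    have D: "(f has_derivative ?D) (at x)" using diff frechet_derivative_works by blast
    then have lin: "linear ?D" by (rule has_derivative_linear)
    define d where "d = (\<chi> i. ?D (axis i 1))"
    have "?D h = inner h d" for h
    proof -
      have "?D h = ?D (\<Sum>i\<in>UNIV. h $ i *\<^sub>R axis i 1)" using basis_expansion[of h] by (simp add: scalar_mult_eq_scaleR)
      also have "\<dots> = (\<Sum>i\<in>UNIV. h $ i * ?D (axis i 1))" by (simp add: linear_sum[OF lin] linear_scale[OF lin])
      finally show ?thesis by (simp add: d_def inner_vec_def)
    qed
    then have "?D = (\<lambda>h. inner h d)" by blast
    then have "GDERIV f x :> d" using D by (simp add: gderiv_def)
    moreover have "D' = d" if "GDERIV f x :> D'" for D'
    proof -
      have "(\<lambda>h. inner h D') = (\<lambda>h. inner h d)"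
        using that \<open>GDERIV f x :> d\<close> unfolding gderiv_def by (rule has_derivative_unique)
      then have "inner (D' - d) D' = inner (D' - d) d" by metis
      then have "inner (D' - d) (D' - d) = 0" by (simp add: inner_diff_right)
      then show ?thesis by simp
    qed
    ultimately have "gradient f x = d" unfolding gradient_def by (rule the_equality)
    then show ?thesis by (simp add: d_def)
  qed
  have "continuous_on UNIV (\<lambda>x. \<chi> i. frechet_derivative f (at x) (axis i 1))"
    by (intro continuous_on_vec_lambda cont)
  moreover have "gradient f = (\<lambda>x. \<chi> i. frechet_derivative f (at x) (axis i 1))"
    by (simp add: fun_eq_iff Finite_Cartesian_Product.vec_eq_iff comp)
  ultimately show "continuous_on UNIV (gradient f)" by simp
qed

section \<open>Convergence from the Lojasiewicz inequality\<close>

text \<open>The tangent of the concave function \<open>\<lambda>x. x powr \<theta>\<close> gives this with \<open>\<theta>\<close> in place of \<open>\<theta> / 2\<close>; the weaker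
  constant follows from \<open>u powr \<theta> \<le> exp (- s) \<le> 1 / (1 + s)\<close> with \<open>u = y / x\<close> and \<open>s = \<theta> * (1 - u)\<close>.\<close>

lemma powr_concave_gap:
  fixes x y \<theta> :: real
  assumes x: "0 < x" and y: "0 \<le> y" "y \<le> x" and \<theta>: "0 < \<theta>" "\<theta> \<le> 1"
  shows "\<theta> / 2 * x powr (\<theta> - 1) * (x - y) \<le> x powr \<theta> - y powr \<theta>"
proof -
  define u where "u = y / x"
  define s where "s = \<theta> * (1 - u)"
  have u: "0 \<le> u" "u \<le> 1" "y = u * x" using x y by (auto simp: u_def)
  have s: "0 \<le> s" "s \<le> 1"
    using u \<theta> mult_mono[of \<theta> 1 "1 - u" 1] by (auto simp: s_def)
  have "u powr \<theta> \<le> 1 - s / 2"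
  proof (cases "u = 0")
    case True
    then show ?thesis using s by simp
  next
    case False
    then have "ln u \<le> u - 1" using u by (intro ln_le_minus_one) auto
    then have "\<theta> * ln u \<le> - s" using \<theta> mult_left_mono[of "ln u" "u - 1" \<theta>] by (simp add: s_def algebra_simps)
    then have "u powr \<theta> \<le> exp (- s)" using False by (simp add: powr_def)
    also have "exp (- s) * (1 + s) \<le> exp (- s) * exp s" by (intro mult_left_mono) auto
    then have "exp (- s) \<le> 1 / (1 + s)" using s by (simp add: field_simps flip: exp_add)
    also have "1 / (1 + s) \<le> 1 - s / 2"
    proof -
      have "1 \<le> (1 - s / 2) * (1 + s)" using s mult_left_le[of s s] by (simp add: algebra_simps)
      then show ?thesis using s by (simp add: pos_divide_le_eq)
    qed
    finally show ?thesis .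
  qed
  then have le: "s / 2 * x powr \<theta> \<le> (1 - u powr \<theta>) * x powr \<theta>" by (intro mult_right_mono) auto
  have ypow: "y powr \<theta> = u powr \<theta> * x powr \<theta>" unfolding u(3) using u x by (simp add: powr_mult)
  have "\<theta> / 2 * x powr (\<theta> - 1) * (x - y) = s / 2 * x powr \<theta>"
    using x by (simp add: s_def u_def powr_diff field_simps)
  also have "\<dots> \<le> (1 - u powr \<theta>) * x powr \<theta>" by (rule le)
  also have "\<dots> = x powr \<theta> - y powr \<theta>" by (simp add: ypow left_diff_distrib)
  finally show ?thesis .
qed

text \<open>The graph of a convex function lies above its tangents.\<close>

lemma powr_neg_convex_gap:
  fixes x y \<beta> :: real
  assumes x: "0 < x" and y: "0 < y" and \<beta>: "0 < \<beta>"
  shows "x powr (- \<beta>) + \<beta> * x powr (- \<beta> - 1) * (x - y) \<le> y powr (- \<beta>)"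
proof -
  define u where "u = y / x"
  have u: "0 < u" "y = u * x" using x y by (auto simp: u_def)
  have "1 + \<beta> * (1 - u) \<le> 1 + (- \<beta> * ln u)"
    using \<beta> mult_left_mono[OF ln_le_minus_one[OF u(1)], of \<beta>] by (simp add: algebra_simps)
  also have "\<dots> \<le> exp (- \<beta> * ln u)" by (rule exp_ge_add_one_self)
  also have "\<dots> = u powr (- \<beta>)" using u by (simp add: powr_def)
  finally have "(1 + \<beta> * (1 - u)) * x powr (- \<beta>) \<le> u powr (- \<beta>) * x powr (- \<beta>)"
    by (intro mult_right_mono) auto
  moreover have "y powr (- \<beta>) = u powr (- \<beta>) * x powr (- \<beta>)" unfolding u(2) using u x by (simp add: powr_mult)
  moreover have "x powr (- \<beta>) + \<beta> * x powr (- \<beta> - 1) * (x - y) = (1 + \<beta> * (1 - u)) * x powr (- \<beta>)"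
    using x by (simp add: u_def powr_diff field_simps)
  ultimately show ?thesis by simp
qed

text \<open>As long as the iterates stay in the ball in which the Lojasiewicz inequality holds, a step has length at
  most \<open>K (e t powr \<theta> - e (Suc t) powr \<theta>)\<close>, by concavity of \<open>\<lambda>x. x powr \<theta>\<close>. These bounds telescope to
  at most \<open>K e t powr \<theta>\<close>. So, once an iterate is close enough to the accumulation point and \<open>e\<close> is small
  enough, the sequence cannot leave the ball; and the same sum bounds the distance to the limit.\<close>

lemma lojasiewicz_convergence:
  fixes X :: "nat \<Rightarrow> 'a::real_normed_vector" and x :: 'a and e \<psi> :: "nat \<Rightarrow> real"
  assumes dec: "decseq e" and e0: "e \<longlonglongrightarrow> 0"
    and c: "0 < c" and descent: "\<And>t. c * \<psi> t * norm (X (Suc t) - X t) \<le> e t - e (Suc t)"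
    and stop: "\<And>t. e (Suc t) = e t \<Longrightarrow> X (Suc t) = X t"
    and \<theta>: "0 < \<theta>" "\<theta> \<le> 1" and \<delta>: "0 < \<delta>" and L: "0 < L"
    and loj: "\<And>t. norm (X t - x) \<le> \<delta> \<Longrightarrow> e t powr (1 - \<theta>) \<le> L * \<psi> t"
    and sub: "strict_mono \<sigma>" "(X \<circ> \<sigma>) \<longlonglongrightarrow> x"
  obtains K T where "0 \<le> K" "\<And>t. T \<le> t \<Longrightarrow> norm (X t - x) \<le> K * e t powr \<theta>"
    "\<And>t. T \<le> t \<Longrightarrow> norm (X t - x) \<le> \<delta>" "X \<longlonglongrightarrow> x"
proof -
  have epos: "0 \<le> e t" for t using decseq_ge[OF dec e0] .
  have emono: "e (Suc t) \<le> e t" for t using dec by (simp add: decseq_Suc_iff)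
  define K where "K = 2 * L / (c * \<theta>)"
  have K: "0 < K" using L c \<theta> by (simp add: K_def)
  have step_bound: "norm (X (Suc t) - X t) \<le> K * (e t powr \<theta> - e (Suc t) powr \<theta>)" if near: "norm (X t - x) \<le> \<delta>" for t
  proof (cases "e t = 0")
    case True
    then have "e (Suc t) = 0" using epos[of "Suc t"] emono[of t] by simp
    then show ?thesis using True stop[of t] by simp
  next
    case False
    let ?D = "norm (X (Suc t) - X t)"
    have et: "0 < e t" using False epos[of t] by simp
    have "e t powr (1 - \<theta>) * ?D \<le> L * \<psi> t * ?D" using loj[OF near] by (intro mult_right_mono) auto
    then have "c * (e t powr (1 - \<theta>) * ?D) \<le> c * (L * \<psi> t * ?D)" using c by (intro mult_left_mono) auto
    also have "\<dots> = L * (c * \<psi> t * ?D)" by simp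
    also have "\<dots> \<le> L * (e t - e (Suc t))" using descent[of t] L by (intro mult_left_mono) auto
    finally have scaled: "e t powr (\<theta> - 1) * (c * (e t powr (1 - \<theta>) * ?D)) \<le> e t powr (\<theta> - 1) * (L * (e t - e (Suc t)))"
      by (intro mult_left_mono) auto
    have "e t powr (\<theta> - 1) * e t powr (1 - \<theta>) = 1" using et by (simp add: powr_add[symmetric])
    then have "e t powr (\<theta> - 1) * (c * (e t powr (1 - \<theta>) * ?D)) = c * ?D"
      by (metis mult.assoc mult.left_commute mult.right_neutral)
    with scaled have "c * ?D \<le> L * (e t powr (\<theta> - 1) * (e t - e (Suc t)))" by (simp only: mult.left_commute)
    also have "e t powr (\<theta> - 1) * (e t - e (Suc t)) \<le> 2 / \<theta> * (e t powr \<theta> - e (Suc t) powr \<theta>)"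
      using powr_concave_gap[OF et epos emono \<theta>] \<theta> by (simp add: field_simps)
    finally have "c * ?D \<le> L * (2 / \<theta> * (e t powr \<theta> - e (Suc t) powr \<theta>))" using L by simp
    then show ?thesis using c \<theta> by (simp add: K_def field_simps)
  qed
  have elim: "(\<lambda>t. e t powr \<theta>) \<longlonglongrightarrow> 0"
  proof -
    have "((\<lambda>t. e t powr \<theta>) \<longlongrightarrow> 0 powr \<theta>) sequentially"
      by (rule tendsto_powr2[OF e0 tendsto_const]) (use epos \<theta> in auto)
    then show ?thesis using \<theta> by simp
  qed
  have "(\<lambda>i. norm ((X \<circ> \<sigma>) i - x) + K * (e \<circ> \<sigma>) i powr \<theta>) \<longlonglongrightarrow> norm (x - x) + K * 0"
    using LIMSEQ_subseq_LIMSEQ[OF elim sub(1)] sub(2)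
    by (intro tendsto_intros) (auto simp: o_def)
  then have "(\<lambda>i. norm ((X \<circ> \<sigma>) i - x) + K * (e \<circ> \<sigma>) i powr \<theta>) \<longlonglongrightarrow> 0" by simp
  then have "\<forall>\<^sub>F i in sequentially. norm ((X \<circ> \<sigma>) i - x) + K * (e \<circ> \<sigma>) i powr \<theta> < \<delta>"
    using \<delta> by (rule order_tendstoD(2))
  then obtain i where i: "norm (X (\<sigma> i) - x) + K * e (\<sigma> i) powr \<theta> < \<delta>"
    using eventually_happens'[OF sequentially_bot] by fastforce
  \<comment> \<open>From this index on the whole remaining path fits into the ball.\<close>
  define T where "T = \<sigma> i"
  note T = i[folded T_def]
  have near: "norm (X t - x) \<le> \<delta> \<and> norm (X t - X T) \<le> K * (e T powr \<theta> - e t powr \<theta>)" if "T \<le> t" for t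
    using that
  proof (induction t rule: dec_induct)
    case base
    have "0 \<le> K * e T powr \<theta>" using K by simp
    then have "norm (X T - x) \<le> \<delta>" using T by linarith
    then show ?case by simp
  next
    case (step t)
    have "norm (X (Suc t) - X T) \<le> norm (X (Suc t) - X t) + norm (X t - X T)"
      using norm_triangle_ineq[of "X (Suc t) - X t" "X t - X T"] by simp
    also have "\<dots> \<le> K * (e t powr \<theta> - e (Suc t) powr \<theta>) + K * (e T powr \<theta> - e t powr \<theta>)"
      using step step_bound
      by (intro add_mono) auto
    also have "\<dots> = K * (e T powr \<theta> - e (Suc t) powr \<theta>)" by (simp add: algebra_simps)
    finally have 1: "norm (X (Suc t) - X T) \<le> K * (e T powr \<theta> - e (Suc t) powr \<theta>)" .
    have "norm (X (Suc t) - x) \<le> norm (X (Suc t) - X T) + norm (X T - x)"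
      using norm_triangle_ineq[of "X (Suc t) - X T" "X T - x"] by simp
    also have "\<dots> \<le> K * e T powr \<theta> + norm (X T - x)"
    proof -
      have "K * (e T powr \<theta> - e (Suc t) powr \<theta>) \<le> K * e T powr \<theta>" using K by (intro mult_left_mono) auto
      then show ?thesis using 1 by linarith
    qed
    finally show ?case using 1 T by simp
  qed
  have cauchy: "norm (X s - X t) \<le> K * (e t powr \<theta> - e s powr \<theta>)" if "T \<le> t" "t \<le> s" for s t
    using that(2)
  proof (induction s rule: dec_induct)
    case (step s)
    have "norm (X (Suc s) - X t) \<le> norm (X (Suc s) - X s) + norm (X s - X t)"
      using norm_triangle_ineq[of "X (Suc s) - X s" "X s - X t"] by simp
    also have "\<dots> \<le> K * (e s powr \<theta> - e (Suc s) powr \<theta>) + K * (e t powr \<theta> - e s powr \<theta>)"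
      using step near[of s] that(1) step_bound
      by (intro add_mono) auto
    finally show ?case by (simp add: algebra_simps)
  qed simp
  have bound: "norm (X t - x) \<le> K * e t powr \<theta>" if t: "T \<le> t" for t
  proof -
    have "(\<lambda>i. norm ((X \<circ> \<sigma>) i - X t)) \<longlonglongrightarrow> norm (x - X t)"
      by (intro tendsto_intros sub)
    moreover have "norm ((X \<circ> \<sigma>) i - X t) \<le> K * e t powr \<theta>" if "t \<le> i" for i
    proof -
      have "t \<le> \<sigma> i" using that seq_suble[OF sub(1), of i] by simp
      then have "norm (X (\<sigma> i) - X t) \<le> K * (e t powr \<theta> - e (\<sigma> i) powr \<theta>)" using cauchy[OF t] by blast
      also have "\<dots> \<le> K * e t powr \<theta>" using K by (intro mult_left_mono) auto
      finally show ?thesis by simp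
    qed
    ultimately have "norm (x - X t) \<le> K * e t powr \<theta>"
      by (intro LIMSEQ_le_const2) auto
    then show ?thesis by (simp add: norm_minus_commute)
  qed
  have "X \<longlonglongrightarrow> x"
  proof -
    have "(\<lambda>t. K * e t powr \<theta>) \<longlonglongrightarrow> 0" using tendsto_mult_left[OF elim, of K] by simp
    then have "(\<lambda>t. X t - x) \<longlonglongrightarrow> 0"
      by (rule Lim_null_comparison[rotated]) (use bound in \<open>auto simp: eventually_sequentially\<close>)
    then show ?thesis by (rule LIM_zero_cancel)
  qed
  then show ?thesis using that[of K T] K bound near by auto
qed

text \<open>Finitely many exceptions are absorbed in the constant.\<close>

lemma eventual_bound_imp_bound:
  fixes u w :: "nat \<Rightarrow> real"
  assumes "\<And>t. T \<le> t \<Longrightarrow> u t \<le> B * w t" and w: "\<And>t. t0 \<le> t \<Longrightarrow> 0 < w t"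
  shows "\<exists>C>0. \<forall>t\<ge>t0. u t \<le> C * w t"
proof -
  define C where "C = \<bar>B\<bar> + 1 + (\<Sum>t<T. \<bar>u t\<bar> / \<bar>w t\<bar>)"
  have S: "0 \<le> (\<Sum>t<T. \<bar>u t\<bar> / \<bar>w t\<bar>)" by (intro sum_nonneg) auto
  have "u t \<le> C * w t" if t: "t0 \<le> t" for t
  proof (cases "T \<le> t")
    case True
    have "u t \<le> B * w t" by (rule assms(1)[OF True])
    also have "\<dots> \<le> C * w t" using S w[OF t] by (intro mult_right_mono) (auto simp: C_def)
    finally show ?thesis .
  next
    case False
    then have "\<bar>u t\<bar> / \<bar>w t\<bar> \<le> (\<Sum>t<T. \<bar>u t\<bar> / \<bar>w t\<bar>)" by (intro member_le_sum) auto
    then have "\<bar>u t\<bar> / \<bar>w t\<bar> \<le> C" by (simp add: C_def)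
    then show ?thesis using w[OF t] by (simp add: pos_divide_le_eq)
  qed
  moreover have "0 < C" using S by (simp add: C_def)
  ultimately show ?thesis by blast
qed

lemma descent_linear_rate:
  fixes e :: "nat \<Rightarrow> real"
  assumes epos: "\<And>t. 0 \<le> e t" and step: "\<And>t. T \<le> t \<Longrightarrow> \<kappa> * e t \<le> e t - e (Suc t)" and t: "T \<le> t"
  shows "e t \<le> e T * exp (- \<kappa> * (real t - real T))"
  using t
proof (induction t rule: dec_induct)
  case (step t)
  have "e (Suc t) \<le> (1 - \<kappa>) * e t" using assms(2)[of t] step by (simp add: algebra_simps)
  also have "\<dots> \<le> exp (- \<kappa>) * e t"
    using epos exp_ge_add_one_self[of "- \<kappa>"] by (intro mult_right_mono) auto
  also have "\<dots> \<le> exp (- \<kappa>) * (e T * exp (- \<kappa> * (real t - real T)))"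
    using step by (intro mult_left_mono) auto
  also have "\<dots> = e T * exp (- \<kappa> * (real (Suc t) - real T))"
  proof -
    have "exp (- \<kappa>) * exp (- \<kappa> * (real t - real T)) = exp (- \<kappa> * (real (Suc t) - real T))"
      by (simp add: algebra_simps flip: exp_add)
    then show ?thesis by simp
  qed
  finally show ?case .
qed simp

text \<open>By convexity of \<open>\<lambda>x. x powr (- \<beta>)\<close>, the recursion makes \<open>e t powr (- \<beta>)\<close> grow by at least \<open>\<beta> \<kappa>\<close> in
  each step.\<close>

lemma descent_sublinear_rate:
  fixes e :: "nat \<Rightarrow> real"
  assumes epos: "\<And>t. 0 \<le> e t" and \<beta>: "0 < \<beta>" and \<kappa>: "0 < \<kappa>"
    and step: "\<And>t. T \<le> t \<Longrightarrow> \<kappa> * e t powr (1 + \<beta>) \<le> e t - e (Suc t)" and t: "T \<le> t"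
  shows "e t = 0 \<or> \<beta> * \<kappa> * (real t - real T) \<le> e t powr (- \<beta>)"
  using t
proof (induction t rule: dec_induct)
  case (step t)
  show ?case
  proof (cases "e (Suc t) = 0")
    case False
    have Tt: "T \<le> t" using step by simp
    have "0 \<le> \<kappa> * e t powr (1 + \<beta>)" using \<kappa> by simp
    then have "e (Suc t) \<le> e t" using assms(4)[OF Tt] by simp
    then have pos: "0 < e (Suc t)" "0 < e t" using False epos[of "Suc t"] by auto
    have "\<kappa> = e t powr (- \<beta> - 1) * (\<kappa> * e t powr (1 + \<beta>))"
      using pos by (simp add: powr_add[symmetric] mult.left_commute)
    also have "\<dots> \<le> e t powr (- \<beta> - 1) * (e t - e (Suc t))" by (intro mult_left_mono assms(4)[OF Tt]) auto
    finally have "\<beta> * \<kappa> \<le> \<beta> * e t powr (- \<beta> - 1) * (e t - e (Suc t))" using \<beta> by (simp add: mult.assoc)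
    then have "e t powr (- \<beta>) + \<beta> * \<kappa> \<le> e (Suc t) powr (- \<beta>)"
      using powr_neg_convex_gap[OF pos(2,1) \<beta>] by simp
    then show ?thesis using step pos by (simp add: algebra_simps)
  qed simp
qed simp

text \<open>For \<open>\<theta> = 1/2\<close> the recursion is linear. Otherwise its exponent is \<open>1 + \<beta>\<close> with \<open>\<beta> = 1 - 2 \<theta>\<close>, so \<open>e t\<close> is
  of order \<open>t powr (- 1 / \<beta>)\<close>, and \<open>e t powr \<theta>\<close> of order \<open>t powr (- \<theta> / \<beta>)\<close>.\<close>

lemma lojasiewicz_rates:
  fixes e d :: "nat \<Rightarrow> real"
  assumes epos: "\<And>t. 0 \<le> e t" and K: "0 \<le> K" and d: "\<And>t. T \<le> t \<Longrightarrow> d t \<le> K * e t powr \<theta>"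
    and \<theta>: "0 < \<theta>" "\<theta> \<le> 1 / 2" and \<kappa>: "0 < \<kappa>"
    and step: "\<And>t. T \<le> t \<Longrightarrow> \<kappa> * e t powr (2 * (1 - \<theta>)) \<le> e t - e (Suc t)"
  shows "\<exists>C>0. \<exists>c>0. (\<theta> = 1/2 \<longrightarrow> (\<forall>t. d t \<le> C * exp (- c * real t))) \<and>
    (\<theta> < 1/2 \<longrightarrow> (\<forall>t\<ge>1. d t \<le> C * real t powr (- (\<theta> / (1 - 2 * \<theta>)))))"
proof (cases "\<theta> = 1/2")
  case True
  define c where "c = \<kappa> / 2"
  have lin: "\<kappa> * e t \<le> e t - e (Suc t)" if "T \<le> t" for t
    using step[OF that] True epos[of t] by simp
  have "d t \<le> (K * (e T * exp (\<kappa> * real T)) powr \<theta>) * exp (- c * real t)" if t: "T \<le> t" for t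
  proof -
    have "e t \<le> e T * exp (- \<kappa> * (real t - real T))"
      by (rule descent_linear_rate[where e = e and T = T, OF epos lin t])
    also have "\<dots> = e T * exp (\<kappa> * real T) * exp (- \<kappa> * real t)"
      by (simp add: algebra_simps flip: exp_add)
    finally have "e t powr \<theta> \<le> (e T * exp (\<kappa> * real T) * exp (- \<kappa> * real t)) powr \<theta>"
      using \<theta> epos by (intro powr_mono2) auto
    also have "\<dots> = (e T * exp (\<kappa> * real T)) powr \<theta> * exp (- \<kappa> * real t) powr \<theta>"
      by (rule powr_mult)
    also have "exp (- \<kappa> * real t) powr \<theta> = exp (- c * real t)"
      using True by (simp add: powr_def c_def)
    finally have "K * e t powr \<theta> \<le> K * ((e T * exp (\<kappa> * real T)) powr \<theta> * exp (- c * real t))"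
      using K by (intro mult_left_mono) auto
    then show ?thesis using d[OF t] by (simp add: mult.assoc)
  qed
  from eventual_bound_imp_bound[of T d _ "\<lambda>t. exp (- c * real t)" 0, OF this]
  obtain C where "C > 0" "\<forall>t. d t \<le> C * exp (- c * real t)" by auto
  then show ?thesis using True \<kappa> by (intro exI[of _ C] conjI exI[of _ c]) (auto simp: c_def)
next
  case False
  then have \<theta>2: "\<theta> < 1/2" using \<theta> by simp
  define \<beta> where "\<beta> = 1 - 2 * \<theta>"
  have \<beta>: "0 < \<beta>" using \<theta>2 by (simp add: \<beta>_def)
  have st: "\<kappa> * e t powr (1 + \<beta>) \<le> e t - e (Suc t)" if "T \<le> t" for t
  proof -
    have "2 * (1 - \<theta>) = 1 + \<beta>" by (simp add: \<beta>_def)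
    then show ?thesis using step[OF that] by (simp only:)
  qed
  define B where "B = K * (\<beta> * \<kappa> / 2) powr (- (\<theta> / \<beta>))"
  \<comment> \<open>From there on \<open>t - T \<ge> t / 2\<close>, which allows \<open>t\<close> in place of \<open>t - T\<close>.\<close>
  have "d t \<le> B * real t powr (- (\<theta> / \<beta>))" if t: "2 * T + 1 \<le> t" for t
  proof -
    have Tt: "T \<le> t" using t by simp
    have dt: "d t \<le> K * e t powr \<theta>" using d[OF Tt] .
    show ?thesis
    proof (cases "e t = 0")
      case True
      have "0 \<le> B * real t powr (- (\<theta> / \<beta>))" using K by (simp add: B_def)
      then show ?thesis using dt True by simp
    next
      case nz: False
      then have et: "0 < e t" using epos[of t] by simp
      have "real t / 2 \<le> real t - real T" using t by simp
      then have "\<beta> * \<kappa> * (real t / 2) \<le> \<beta> * \<kappa> * (real t - real T)"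
        using \<beta> \<kappa> by (intro mult_left_mono) auto
      also have "\<dots> \<le> e t powr (- \<beta>)"
        using descent_sublinear_rate[where e = e and T = T, OF epos \<beta> \<kappa> st Tt] nz by simp
      finally have le: "\<beta> * \<kappa> / 2 * real t \<le> e t powr (- \<beta>)" by simp
      have pos: "0 < \<beta> * \<kappa> / 2 * real t" using \<beta> \<kappa> t by simp
      have "e t powr \<theta> = (e t powr (- \<beta>)) powr (- (\<theta> / \<beta>))" using \<beta> by (simp add: powr_powr)
      also have "\<dots> \<le> (\<beta> * \<kappa> / 2 * real t) powr (- (\<theta> / \<beta>))"
        by (rule powr_mono2') (use le pos \<theta> \<beta> in auto)
      also have "\<dots> = (\<beta> * \<kappa> / 2) powr (- (\<theta> / \<beta>)) * real t powr (- (\<theta> / \<beta>))"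
        by (rule powr_mult)
      finally have "K * e t powr \<theta> \<le> K * ((\<beta> * \<kappa> / 2) powr (- (\<theta> / \<beta>)) * real t powr (- (\<theta> / \<beta>)))"
        using K by (intro mult_left_mono) auto
      then show ?thesis using dt by (simp add: B_def mult.assoc)
    qed
  qed
  from eventual_bound_imp_bound[of "2 * T + 1" d _ "\<lambda>t. real t powr (- (\<theta> / \<beta>))" 1, OF this]
  obtain C where "C > 0" "\<forall>t\<ge>1. d t \<le> C * real t powr (- (\<theta> / \<beta>))" by auto
  then show ?thesis using False by (intro exI[of _ C] conjI exI[of _ 1]) (auto simp: \<beta>_def)
qed

section \<open>Estimates for one iteration\<close>

lemma bouligand_cone_mono: "M \<subseteq> N \<Longrightarrow> bouligand_cone M x \<subseteq> bouligand_cone N x"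
  unfolding bouligand_cone_def by blast

context tensor_shape
begin

text \<open>The angle condition holds trivially if \<open>g = 0\<close>, even when the projected gradient is not 0; therefore
  this case is kept apart. As the current iterate belongs to the variety, quasi-optimality bounds the
  truncation error by a multiple of \<open>s |g|\<close>.\<close>

lemma grap_step_estimates:
  assumes r: "length r = length n" and par: "0 < \<omega>" "0 < a" "0 < smin"
    and X: "X \<in> tucker_variety idx n r" and step: "grap_step idx n r \<omega> \<rho> a smin f X X'"
  obtains g where "g \<in> approx_projs idx n r X (- gradient f X)"
    "X' \<in> tucker_variety idx n r"
    "a * smin * (norm g)\<^sup>2 \<le> f X - f X'"
    "g = 0 \<or> \<omega> * norm (cone_proj (tucker_variety idx n r) X (- gradient f X)) \<le> norm g"
    "a * norm g * norm (X' - X) \<le> (1 + real (sum_list n)) * (f X - f X')"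
    "g = 0 \<Longrightarrow> X' = X"
proof -
  let ?K = "real (sum_list n)" and ?\<psi> = "norm (cone_proj (tucker_variety idx n r) X (- gradient f X))"
  obtain g s0 l Y where g: "g \<in> approx_projs idx n r X (- gradient f X)"
    and angle: "inner (- gradient f X) g \<ge> \<omega> * ?\<psi> * norm g"
    and Y: "\<And>m. m \<le> l \<Longrightarrow> Y m \<in> hosvd idx n r (X + (\<rho> ^ m * s0) *\<^sub>R g)"
    and armijo: "f X - f (Y l) \<ge> \<rho> ^ l * s0 * a * inner (- gradient f X) g"
    and smin: "\<rho> ^ l * s0 > smin" and X': "X' = Y l"
    using step unfolding grap_step_def by blast
  define s where "s = \<rho> ^ l * s0"
  have s: "smin < s" "0 < s" using smin par by (auto simp: s_def)
  have X'h: "X' \<in> hosvd idx n r (X + s *\<^sub>R g)" using Y[of l] by (simp add: X' s_def)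
  have X'M: "X' \<in> tucker_variety idx n r" by (rule hosvd_in_variety[OF r X'h])
  have gg: "inner (- gradient f X) g = (norm g)\<^sup>2" by (rule approx_projs_inner_self[OF g])
  have dec: "s * a * (norm g)\<^sup>2 \<le> f X - f X'" using armijo unfolding gg X' s_def by simp
  have "norm (X + s *\<^sub>R g - X') \<le> ?K * norm (X + s *\<^sub>R g - X)" by (rule hosvd_error[OF r X'h X])
  moreover have "norm (X' - X) \<le> norm (s *\<^sub>R g) + norm (X + s *\<^sub>R g - X')"
    using norm_triangle_ineq4[of "s *\<^sub>R g" "X + s *\<^sub>R g - X'"] by simp
  ultimately have step_len: "norm (X' - X) \<le> (1 + ?K) * (s * norm g)"
    using s by (simp add: algebra_simps)
  have "a * smin * (norm g)\<^sup>2 \<le> s * a * (norm g)\<^sup>2"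
    using s par by (intro mult_right_mono) (auto simp: mult.commute)
  then have 1: "a * smin * (norm g)\<^sup>2 \<le> f X - f X'" using dec by simp
  have 2: "g = 0 \<or> \<omega> * ?\<psi> \<le> norm g"
    using angle unfolding gg power2_eq_square by (auto simp: mult_le_cancel_right)
  have "a * norm g * norm (X' - X) \<le> a * norm g * ((1 + ?K) * (s * norm g))"
    using step_len par by (intro mult_left_mono) auto
  also have "\<dots> = (1 + ?K) * (s * a * (norm g)\<^sup>2)" by (simp add: power2_eq_square)
  also have "\<dots> \<le> (1 + ?K) * (f X - f X')" by (intro mult_left_mono dec) simp
  finally have 3: "a * norm g * norm (X' - X) \<le> (1 + ?K) * (f X - f X')" .
  have 4: "X' = X" if "g = 0" using step_len that by simp
  show ?thesis by (rule that[OF g X'M 1 2 3 4])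
qed

text \<open>At points of rank \<open>r\<close> a vanishing direction is not accidental: \<open>A\<close> is then orthogonal to the tangent
  cone.\<close>

lemma approx_proj_zero_imp_cone_proj_zero:
  assumes r: "length r = length n" and X: "rank_tc n (T X) = r" and g: "0 \<in> approx_projs idx n r X A"
  shows "cone_proj (tucker_variety idx n r) X A = 0"
  unfolding cone_proj_def
proof (rule closest_point_eq_0)
  have "X \<in> tucker_variety idx n r" using X unfolding tucker_variety_iff[OF r] rank_tc_iff[OF r] by simp
  then show "0 \<in> bouligand_cone (tucker_variety idx n r) X" by (rule zero_in_bouligand_cone)
  show "inner A v = 0" if "v \<in> bouligand_cone (tucker_variety idx n r) X" for v
    using approx_projs_inner_tangents[OF g bouligand_cone_subset_tangents[OF r X that]] by simp
qed

end

theorem theorem3: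
  fixes n r :: "nat list" and idx :: "'i::finite \<Rightarrow> nat list"
    and f :: "real ^ 'i \<Rightarrow> real" and fstar \<omega> \<rho> a smin :: real
    and X :: "nat \<Rightarrow> real ^ 'i" and Xstar :: "real ^ 'i"
  assumes "n \<noteq> []"
    and "bij_betw idx UNIV (multi_indices n)"
    and "length r = length n"
    and "\<forall>k<length n. 1 \<le> r ! k \<and> r ! k \<le> n ! k"
    and "smooth_on UNIV f"
    and "0 < \<omega>" and "\<omega> \<le> 1"
    and "0 < \<rho>" and "\<rho> < 1"
    and "0 < a" and "a < 1"
    and "0 < smin"
    and "grap_sequence idx n r \<omega> \<rho> a smin f X"
    and "\<forall>Y. fstar \<le> f Y"
    and "\<forall>Y\<in>tucker_variety idx n r. \<exists>\<theta>. lojasiewicz_at (tucker_variety idx n r) f Y \<theta>"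
    and "\<exists>\<sigma>::nat \<Rightarrow> nat. strict_mono \<sigma> \<and> (X \<circ> \<sigma>) \<longlonglongrightarrow> Xstar"
  shows "X \<longlonglongrightarrow> Xstar \<and>
    (rank_tc n (to_tensor idx Xstar) = r \<longrightarrow>
      norm (cone_proj (tucker_variety idx n r) Xstar (- gradient f Xstar))
        = norm (riemannian_gradient (tucker_manifold idx n r) f Xstar) \<and>
      norm (riemannian_gradient (tucker_manifold idx n r) f Xstar) = 0 \<and>
      (\<forall>\<theta>. lojasiewicz_at (tucker_variety idx n r) f Xstar \<theta> \<longrightarrow>
        (\<exists>C>0. \<exists>c>0.
          (\<theta> = 1/2 \<longrightarrow> (\<forall>t. norm (X t - Xstar) \<le> C * exp (- c * real t))) \<and>
          (\<theta> < 1/2 \<longrightarrow>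
             (\<forall>t\<ge>1. norm (X t - Xstar) \<le> C * real t powr (- (\<theta> / (1 - 2 * \<theta>))))))))"
proof -
  interpret tensor_shape idx n by unfold_locales (rule assms(2))
  note r = assms(3)
  define M where "M = tucker_variety idx n r"
  define A where "A t = - gradient f (X t)" for t
  define \<psi> where "\<psi> t = norm (cone_proj M (X t) (A t))" for t
  define e where "e t = f (X t) - f Xstar" for t
  define B where "B = 1 + real (sum_list n)"
  have B: "0 < B" by (simp add: B_def)
  have X0: "X 0 \<in> M" and step: "grap_step idx n r \<omega> \<rho> a smin f (X t) (X (Suc t))" for t
    using assms(13) by (auto simp: grap_sequence_def M_def)
  have XM: "X t \<in> M" for t
  proof (induction t)
    case (Suc t)
    then show ?case
      using grap_step_estimates[OF r assms(6,10,12) _ step[of t]] unfolding M_def by blast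
  qed (rule X0)
  define good where "good t g \<longleftrightarrow> g \<in> approx_projs idx n r (X t) (A t) \<and> a * smin * (norm g)\<^sup>2 \<le> e t - e (Suc t) \<and>
      (g = 0 \<or> \<omega> * \<psi> t \<le> norm g) \<and> a * norm g * norm (X (Suc t) - X t) \<le> B * (e t - e (Suc t)) \<and>
      (g = 0 \<longrightarrow> X (Suc t) = X t)" for t g
  have "\<exists>g. good t g" for t
  proof -
    have e_diff: "f (X t) - f (X (Suc t)) = e t - e (Suc t)" by (simp add: e_def)
    show ?thesis
      by (rule grap_step_estimates[OF r assms(6,10,12) XM[of t, unfolded M_def] step[of t],
            folded A_def M_def, folded \<psi>_def, folded B_def, unfolded e_diff])
        (unfold good_def, blast)
  qed
  then obtain g where good: "\<And>t. good t (g t)" by metis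
  have g: "g t \<in> approx_projs idx n r (X t) (A t)"
    and dec: "a * smin * (norm (g t))\<^sup>2 \<le> e t - e (Suc t)"
    and angle: "g t = 0 \<or> \<omega> * \<psi> t \<le> norm (g t)"
    and len: "a * norm (g t) * norm (X (Suc t) - X t) \<le> B * (e t - e (Suc t))"
    and stuck: "g t = 0 \<Longrightarrow> X (Suc t) = X t" for t
    using good[of t] unfolding good_def by blast+
  obtain \<sigma> where \<sigma>: "strict_mono \<sigma>" "(X \<circ> \<sigma>) \<longlonglongrightarrow> Xstar" using assms(16) by blast
  have f_cont: "continuous_on UNIV f" and grad_cont: "continuous_on UNIV (gradient f)"
    using smooth_on_UNIV_gradient[OF assms(5)] by auto
  have mono: "e (Suc t) \<le> e t" for t
  proof -
    have "0 \<le> a * smin * (norm (g t))\<^sup>2" using assms(10,12) by simp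
    then show ?thesis using dec[of t] by linarith
  qed
  then have decs: "decseq e" by (simp add: decseq_Suc_iff)
  \<comment> \<open>A decreasing sequence has the limit of any of its convergent subsequences.\<close>
  have e_sub: "(e \<circ> \<sigma>) \<longlonglongrightarrow> 0"
  proof -
    have "(\<lambda>i. f ((X \<circ> \<sigma>) i) - f Xstar) \<longlonglongrightarrow> f Xstar - f Xstar"
      by (intro tendsto_diff tendsto_const continuous_on_tendsto_compose[OF f_cont \<sigma>(2)]) auto
    then show ?thesis by (simp add: e_def o_def)
  qed
  have epos: "0 \<le> e t" for t
  proof (rule LIMSEQ_le_const2[OF e_sub])
    show "\<exists>N. \<forall>i\<ge>N. (e \<circ> \<sigma>) i \<le> e t"
    proof (intro exI allI impI)
      fix i assume "t \<le> i"
      then have "t \<le> \<sigma> i" using seq_suble[OF \<sigma>(1), of i] by simp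
      then show "(e \<circ> \<sigma>) i \<le> e t" using decseqD[OF decs] by simp
    qed
  qed
  have e0: "e \<longlonglongrightarrow> 0"
  proof -
    obtain l where l: "e \<longlonglongrightarrow> l" using decseq_convergent[OF decs, of 0] epos by blast
    have "l = 0" using LIMSEQ_unique[OF LIMSEQ_subseq_LIMSEQ[OF l \<sigma>(1)] e_sub] .
    then show ?thesis using l by simp
  qed
  have starM: "Xstar \<in> M" unfolding M_def
    by (rule tucker_variety_closed[OF r \<sigma>(2)]) (use XM in \<open>simp add: M_def\<close>)
  define c where "c = a * \<omega> / B"
  have c: "0 < c" using assms(6,10) B by (simp add: c_def)
  have descent: "c * \<psi> t * norm (X (Suc t) - X t) \<le> e t - e (Suc t)" for t
  proof (cases "g t = 0")
    case True
    then show ?thesis using stuck[of t] mono[of t] by simp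
  next
    case False
    then have "a * (\<omega> * \<psi> t) * norm (X (Suc t) - X t) \<le> a * norm (g t) * norm (X (Suc t) - X t)"
      using angle[of t] assms(10) by (intro mult_right_mono mult_left_mono) auto
    also have "\<dots> \<le> B * (e t - e (Suc t))" by (rule len)
    finally show ?thesis using B by (simp add: c_def field_simps)
  qed
  have stop: "X (Suc t) = X t" if "e (Suc t) = e t" for t
  proof -
    have "a * smin * (norm (g t))\<^sup>2 \<le> 0" using dec[of t] that by simp
    then have "g t = 0" using assms(10,12) by (simp add: mult_le_0_iff)
    then show ?thesis by (rule stuck)
  qed
  have loj: "\<exists>K T L. 0 \<le> K \<and> 0 < L \<and> (\<forall>t\<ge>T. norm (X t - Xstar) \<le> K * e t powr \<theta>) \<and>
      (\<forall>t\<ge>T. e t powr (1 - \<theta>) \<le> L * \<psi> t) \<and> X \<longlonglongrightarrow> Xstar"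
    if l: "lojasiewicz_at M f Xstar \<theta>" for \<theta>
  proof -
    obtain \<delta> L where \<theta>: "0 < \<theta>" "\<theta> \<le> 1/2" and \<delta>: "0 < \<delta>" and L: "0 < L" and ineq:
      "\<And>y. y \<in> M \<Longrightarrow> norm (y - Xstar) \<le> \<delta> \<Longrightarrow>
        \<bar>f Xstar - f y\<bar> powr (1 - \<theta>) \<le> L * norm (cone_proj M y (- gradient f y))"
      using l unfolding lojasiewicz_at_def by blast
    have ineq': "e t powr (1 - \<theta>) \<le> L * \<psi> t" if "norm (X t - Xstar) \<le> \<delta>" for t
      using ineq[OF XM that] epos[of t] by (simp add: e_def \<psi>_def A_def abs_minus_commute)
    have \<theta>1: "\<theta> \<le> 1" using \<theta> by simp
    obtain K T where "0 \<le> K" "\<And>t. T \<le> t \<Longrightarrow> norm (X t - Xstar) \<le> K * e t powr \<theta>"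
      "\<And>t. T \<le> t \<Longrightarrow> norm (X t - Xstar) \<le> \<delta>" "X \<longlonglongrightarrow> Xstar"
      using lojasiewicz_convergence[OF decs e0 c descent stop \<theta>(1) \<theta>1 \<delta> L ineq' \<sigma>] by blast
    then show ?thesis using ineq' L by blast
  qed
  obtain \<theta>0 where "lojasiewicz_at M f Xstar \<theta>0" using assms(15) starM unfolding M_def by blast
  then have conv: "X \<longlonglongrightarrow> Xstar" using loj by blast
  show ?thesis
  proof (intro conjI impI conv)
    assume rank: "rank_tc n (T Xstar) = r"
    have Alim: "A \<longlonglongrightarrow> - gradient f Xstar"
      unfolding A_def by (intro tendsto_minus continuous_on_tendsto_compose[OF grad_cont conv]) auto
    have glim: "g \<longlonglongrightarrow> 0"
    proof -
      have "(\<lambda>t. inverse (a * smin) * (e t - e (Suc t))) \<longlonglongrightarrow> inverse (a * smin) * (0 - 0)"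
        by (rule tendsto_mult_left, rule tendsto_diff[OF e0 LIMSEQ_Suc[OF e0]])
      then have lim: "(\<lambda>t. inverse (a * smin) * (e t - e (Suc t))) \<longlonglongrightarrow> 0" by simp
      have le: "(norm (g t))\<^sup>2 \<le> inverse (a * smin) * (e t - e (Suc t))" for t
        using dec[of t] assms(10,12) by (simp add: divide_simps mult.commute)
      have "(\<lambda>t. (norm (g t))\<^sup>2) \<longlonglongrightarrow> 0"
        by (rule tendsto_sandwich[OF always_eventually always_eventually tendsto_const lim]) (use le in auto)
      from tendsto_real_sqrt[OF this] have "(\<lambda>t. norm (g t)) \<longlonglongrightarrow> 0" by simp
      then show ?thesis by (rule tendsto_norm_zero_cancel)
    qed
    have orth: "inner (- gradient f Xstar) v = 0" if "v \<in> bouligand_cone M Xstar" for v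
      using tangents_inner_limit[OF conv Alim glim g] bouligand_cone_subset_tangents[OF r rank] that
      unfolding M_def by blast
    have "closest_point (bouligand_cone M Xstar) (- gradient f Xstar) = 0"
      by (rule closest_point_eq_0[OF zero_in_bouligand_cone[OF starM] orth])
    then have cone0: "norm (cone_proj M Xstar (- gradient f Xstar)) = 0" by (simp add: cone_proj_def)
    have sub: "tucker_manifold idx n r \<subseteq> M"
      unfolding M_def tucker_manifold_def tucker_variety_iff[OF r] subset_iff mem_Collect_eq rank_tc_iff[OF r]
      by (simp add: tucker_variety_iff[OF r])
    have "closest_point (tangent_space (tucker_manifold idx n r) Xstar) (gradient f Xstar) = 0"
    proof (rule closest_point_eq_0)
      show "0 \<in> tangent_space (tucker_manifold idx n r) Xstar"
        by (rule zero_in_tangent_space) (use rank in \<open>simp add: tucker_manifold_def\<close>)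
      fix v assume "v \<in> tangent_space (tucker_manifold idx n r) Xstar"
      then have "v \<in> bouligand_cone M Xstar"
        using tangent_space_subset_bouligand_cone bouligand_cone_mono[OF sub] by blast
      then show "inner (gradient f Xstar) v = 0" using orth[of v] by simp
    qed
    then have grad0: "norm (riemannian_gradient (tucker_manifold idx n r) f Xstar) = 0"
      by (simp add: riemannian_gradient_def)
    show "norm (cone_proj (tucker_variety idx n r) Xstar (- gradient f Xstar)) =
        norm (riemannian_gradient (tucker_manifold idx n r) f Xstar)"
      using cone0 grad0 by (simp add: M_def)
    show "norm (riemannian_gradient (tucker_manifold idx n r) f Xstar) = 0" by (rule grad0)
    have "\<forall>\<^sub>F t in sequentially. rank_tc n (T (X t)) = r"
      by (rule rank_tc_eventually[OF r conv _ rank]) (use XM in \<open>simp add: M_def\<close>)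
    then obtain T1 where T1: "\<And>t. T1 \<le> t \<Longrightarrow> rank_tc n (T (X t)) = r"
      by (auto simp: eventually_sequentially)
    \<comment> \<open>At rank \<open>r\<close> the exceptional case of the angle condition does not occur.\<close>
    have \<psi>_le: "\<omega> * \<psi> t \<le> norm (g t)" if "T1 \<le> t" for t
    proof (cases "g t = 0")
      case True
      have "cone_proj M (X t) (A t) = 0" unfolding M_def
        by (rule approx_proj_zero_imp_cone_proj_zero[OF r T1[OF that]]) (use g[of t] True in simp)
      then show ?thesis by (simp add: \<psi>_def)
    qed (use angle[of t] in simp)
    show "\<forall>\<theta>. lojasiewicz_at (tucker_variety idx n r) f Xstar \<theta> \<longrightarrow>
        (\<exists>C>0. \<exists>c>0.
          (\<theta> = 1/2 \<longrightarrow> (\<forall>t. norm (X t - Xstar) \<le> C * exp (- c * real t))) \<and>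
          (\<theta> < 1/2 \<longrightarrow>
             (\<forall>t\<ge>1. norm (X t - Xstar) \<le> C * real t powr (- (\<theta> / (1 - 2 * \<theta>))))))"
    proof (intro allI impI)
      fix \<theta> assume l: "lojasiewicz_at (tucker_variety idx n r) f Xstar \<theta>"
      then have \<theta>: "0 < \<theta>" "\<theta> \<le> 1/2" by (auto simp: lojasiewicz_at_def)
      obtain K T0 L where K: "0 \<le> K" and L: "0 < L"
        and bound: "\<And>t. T0 \<le> t \<Longrightarrow> norm (X t - Xstar) \<le> K * e t powr \<theta>"
        and ineq: "\<And>t. T0 \<le> t \<Longrightarrow> e t powr (1 - \<theta>) \<le> L * \<psi> t"
        using loj[OF l[folded M_def]] by blast
      \<comment> \<open>the Lojasiewicz inequality squared, with \<open>\<psi> t\<close> bounded by \<open>norm (g t) / \<omega>\<close>\<close>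
      define \<kappa> where "\<kappa> = a * smin * (\<omega> / L)\<^sup>2"
      have \<kappa>: "0 < \<kappa>" using assms(6,10,12) L by (simp add: \<kappa>_def)
      have recursion: "\<kappa> * e t powr (2 * (1 - \<theta>)) \<le> e t - e (Suc t)" if t: "max T0 T1 \<le> t" for t
      proof -
        have "\<omega> * e t powr (1 - \<theta>) \<le> \<omega> * (L * \<psi> t)"
          using ineq[of t] t assms(6) by (intro mult_left_mono) auto
        also have "\<dots> \<le> L * norm (g t)"
          using mult_left_mono[OF \<psi>_le[of t], of L] t L by (simp add: mult.left_commute)
        finally have "\<omega> / L * e t powr (1 - \<theta>) \<le> norm (g t)" using L by (simp add: field_simps)
        then have "(\<omega> / L * e t powr (1 - \<theta>))\<^sup>2 \<le> (norm (g t))\<^sup>2"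
          using assms(6) L by (intro power_mono) auto
        then have "a * smin * (\<omega> / L * e t powr (1 - \<theta>))\<^sup>2 \<le> a * smin * (norm (g t))\<^sup>2"
          using assms(10,12) by (intro mult_left_mono) auto
        moreover have "(e t powr (1 - \<theta>))\<^sup>2 = e t powr (2 * (1 - \<theta>))"
          by (simp add: power2_eq_square flip: powr_add)
        ultimately show ?thesis
          using dec[of t] unfolding \<kappa>_def power_mult_distrib by (simp add: mult.assoc)
      qed
      show "\<exists>C>0. \<exists>c>0.
          (\<theta> = 1/2 \<longrightarrow> (\<forall>t. norm (X t - Xstar) \<le> C * exp (- c * real t))) \<and>
          (\<theta> < 1/2 \<longrightarrow>
             (\<forall>t\<ge>1. norm (X t - Xstar) \<le> C * real t powr (- (\<theta> / (1 - 2 * \<theta>)))))"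
        by (rule lojasiewicz_rates[where e = e and K = K and T = "max T0 T1" and \<kappa> = \<kappa>])
          (use epos K bound \<theta> \<kappa> recursion in auto)
    qed
  qed
qed

end
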